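(* Let $\mathsf{P}=(\mathcal{D},\mathcal{C},\mathcal{R})$ be a (fixed) orthogonal program. There exist a polynomial $p:\mathbb{N}\times\mathbb{N}\to\mathbb{N}$ and an algorithm such that, whenever $\mathsf{f}\in\mathcal{D}$ is a $k$-ary operation symbol, $v_1,\dots,v_k\in\mathcal{T}(\mathcal{C})$ are values, and $\langle\emptyset,\mathsf{f}(v_1,\dots,v_k)\rangle\Downarrow_m\langle C,v\rangle$ holds for some $m\in\mathbb{N}$, cache $C$ and value $v$, the algorithm computes, from $\mathsf{f}$ and $v_1,\dots,v_k$, a DAG representation of $v$ in time at most $p\bigl(\sum_{i=1}^k|v_i|,\,m\bigr)$.
   Context: **Programs.** Fix a set of variables $\mathcal{V}$. A program is a triple $(\mathcal{D},\mathcal{C},\mathcal{R})$ with two disjoint finite signatures $\mathcal{D}$ (operation symbols) and $\mathcal{C}$ (constructors), each symbol having a fixed arity, and a finite set $\mathcal{R}$ of rules $l\to r$ between terms over $\mathcal{D}\cup\mathcal{C}$ and $\mathcal{V}$, where $l=\mathsf{f}(p_1,\dots,p_k)$ with $\mathsf{f}\in\mathcal{D}$, the patterns $p_j$ contain only variables and constructors, and every variable of $r$ occurs in $l$. It is orthogonal if every left-hand side is linear (no variable occurs twice) and no two rules have overlapping left-hand sides. Values are the ground constructor terms $v\in\mathcal{T}(\mathcal{C})$. **Memoizing semantics.** A cache $C$ is a set of pairs $(\mathsf{f}(v_1,\dots,v_k),v)$ with $\mathsf{f}\in\mathcal{D}$ and $v_i,v$ values. The relation $\langle C,t\rangle\Downarrow_m\langle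 D,v\rangle$ ($C,D$ caches, $t$ a ground term over $\mathcal{D}\cup\mathcal{C}$, $v$ a value, $m\in\mathbb{N}$) is inductively defined by: - (Split) if $\mathsf{f}\in\mathcal{D}$, $\langle C_{i-1},t_i\rangle\Downarrow_{n_i}\langle C_i,v_i\rangle$ for $1\le i\le k$, and $\langle C_k,\mathsf{f}(v_1,\dots,v_k)\rangle\Downarrow_n\langle C_{k+1},v\rangle$, then $\langle C_0,\mathsf{f}(t_1,\dots,t_k)\rangle\Downarrow_{m}\langle C_{k+1},v\rangle$ with $m=n+\sum_i n_i$; - (Con) if $\mathsf{c}\in\mathcal{C}$ and $\langle C_{i-1},t_i\rangle\Downarrow_{n_i}\langle C_i,v_i\rangle$ for $1\le i\le k$, then $\langle C_0,\mathsf{c}(t_1,\dots,t_k)\rangle\Downarrow_{m}\langle C_k,\mathsf{c}(v_1,\dots,v_k)\rangle$ with $m=\sum_i n_i$; - (Read) if $(\mathsf{f}(v_1,\dots,v_k),v)\in C$, then $\langle C,\mathsf{f}(v_1,\dots,v_k)\rangle\Downarrow_0\langle C,v\rangle$; - (Update) if $(\mathsf{f}(v_1,\dots,v_k),v)\notin C$, $\mathsf{f}(p_1,\dots,p_k)\to r\in\mathcal{R}$, $p_i\sigma=v_i$ for all $i$, and $\langle C,r\sigma\rangle\Downarrow_m\langle D,v\rangle$, then $\langle C,\mathsf{f}(v_1,\dots,v_k)\rangle\Downarrow_{m+1}\langle D\cup\{(\mathsf{f}(v_1,\dots,v_k),v)\},v\rangle$. **Size and representation.** $|v|$ is the number of symbol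 occurrences in the value $v$, i.e. $|\mathsf{c}(v_1,\dots,v_k)|=1+\sum_i|v_i|$. A DAG representation of a value $v$ is a (string encoding of a) rooted directed acyclic graph with nodes labeled by constructors and ordered outgoing edges (a node labeled $\mathsf{c}$ has exactly as many successors as the arity of $\mathsf{c}$), maximally shared (no two distinct nodes have the same label and the same successor list), whose unfolding from the root is $v$. Inputs $v_i$ are given as ordinary terms. Time is measured on a standard model such as Turing machines. *)

theory Defs
  imports Main
begin

section \<open>Terms\<close>

datatype (funs_trm: 'f, vars_trm: 'v) trm = Var 'v | Fun 'f "('f, 'v) trm list"

primrec subst :: "('v \<Rightarrow> ('f, 'v) trm) \<Rightarrow> ('f, 'v) trm \<Rightarrow> ('f, 'v) trm" where
  "subst \<sigma> (Var x) = \<sigma> x"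
| "subst \<sigma> (Fun f ts) = Fun f (map (subst \<sigma>) ts)"

primrec var_list :: "('f, 'v) trm \<Rightarrow> 'v list" where
  "var_list (Var x) = [x]"
| "var_list (Fun f ts) = concat (map var_list ts)"

primrec subterms :: "('f, 'v) trm \<Rightarrow> ('f, 'v) trm set" where
  "subterms (Var x) = {Var x}"
| "subterms (Fun f ts) = insert (Fun f ts) (\<Union> (set (map subterms ts)))"

text \<open>Only applied to values, so the clause for variables is immaterial.\<close>

primrec trm_size :: "('f, 'v) trm \<Rightarrow> nat" where
  "trm_size (Var x) = 1"
| "trm_size (Fun f ts) = 1 + sum_list (map trm_size ts)"

text \<open>\<open>terms ar F V\<close> is the set of terms over the signature \<open>F\<close>, with arities \<open>ar\<close>, and the
  variables \<open>V\<close>.\<close>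

inductive_set terms :: "('f \<Rightarrow> nat) \<Rightarrow> 'f set \<Rightarrow> 'v set \<Rightarrow> ('f, 'v) trm set"
  for ar :: "'f \<Rightarrow> nat" and F :: "'f set" and V :: "'v set" where
  Var: "x \<in> V \<Longrightarrow> Var x \<in> terms ar F V"
| Fun: "\<lbrakk>f \<in> F; length ts = ar f; \<forall>t\<in>set ts. t \<in> terms ar F V\<rbrakk> \<Longrightarrow> Fun f ts \<in> terms ar F V"

abbreviation vals :: "('f \<Rightarrow> nat) \<Rightarrow> 'f set \<Rightarrow> ('f, 'v) trm set" where
  "vals ar C \<equiv> terms ar C {}"


section \<open>Orthogonal programs\<close>

type_synonym ('f, 'v) rules = "(('f, 'v) trm \<times> ('f, 'v) trm) set"

definition program :: "('f \<Rightarrow> nat) \<Rightarrow> 'f set \<Rightarrow> 'f set \<Rightarrow> ('f, 'v) rules \<Rightarrow> bool" where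
  "program ar D C R \<longleftrightarrow>
     finite D \<and> finite C \<and> D \<inter> C = {} \<and> finite R \<and>
     (\<forall>(l, r)\<in>R.
        (\<exists>f ps. l = Fun f ps \<and> f \<in> D \<and> length ps = ar f \<and> set ps \<subseteq> terms ar C UNIV) \<and>
        r \<in> terms ar (D \<union> C) UNIV \<and>
        vars_trm r \<subseteq> vars_trm l)"

text \<open>\<open>l2\<close>, renamed apart, unifies with a non-variable subterm of \<open>l1\<close>. Instantiating the two
  sides by independent substitutions takes the place of the renaming.\<close>

definition overlap :: "('f, 'v) trm \<Rightarrow> ('f, 'v) trm \<Rightarrow> bool" where
  "overlap l1 l2 \<longleftrightarrow>
     (\<exists>s\<in>subterms l1. (\<forall>x. s \<noteq> Var x) \<and> (\<exists>\<sigma> \<tau>. subst \<sigma> s = subst \<tau> l2))"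

text \<open>An overlap of a rule with itself below the root cannot occur in a program, since proper
  subterms of a left-hand side contain no operation symbol.\<close>

definition orthogonal :: "('f, 'v) rules \<Rightarrow> bool" where
  "orthogonal R \<longleftrightarrow>
     (\<forall>(l, r)\<in>R. distinct (var_list l)) \<and>
     (\<forall>(l1, r1)\<in>R. \<forall>(l2, r2)\<in>R. (l1, r1) \<noteq> (l2, r2) \<longrightarrow> \<not> overlap l1 l2)"


section \<open>Memoizing semantics\<close>

type_synonym ('f, 'v) cache = "(('f, 'v) trm \<times> ('f, 'v) trm) set"

definition caches :: "('f \<Rightarrow> nat) \<Rightarrow> 'f set \<Rightarrow> 'f set \<Rightarrow> ('f, 'v) cache set" where
  "caches ar D C =
     Pow {(Fun f vs, v) | f vs v.
            f \<in> D \<and> length vs = ar f \<and> set vs \<subseteq> vals ar C \<and> v \<in> vals ar C}"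

text \<open>\<open>eval ar D C R K t m K' v\<close> is the judgement \<open>\<langle>K, t\<rangle> \<Down>\<^sub>m \<langle>K', v\<rangle>\<close>. The relation \<open>evals\<close> threads
  the cache through an argument list from left to right and adds up the costs.\<close>

inductive
  eval :: "('f \<Rightarrow> nat) \<Rightarrow> 'f set \<Rightarrow> 'f set \<Rightarrow> ('f, 'v) rules \<Rightarrow>
    ('f, 'v) cache \<Rightarrow> ('f, 'v) trm \<Rightarrow> nat \<Rightarrow> ('f, 'v) cache \<Rightarrow> ('f, 'v) trm \<Rightarrow> bool" and
  evals :: "('f \<Rightarrow> nat) \<Rightarrow> 'f set \<Rightarrow> 'f set \<Rightarrow> ('f, 'v) rules \<Rightarrow>
    ('f, 'v) cache \<Rightarrow> ('f, 'v) trm list \<Rightarrow> nat \<Rightarrow> ('f, 'v) cache \<Rightarrow> ('f, 'v) trm list \<Rightarrow> bool"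
  for ar :: "'f \<Rightarrow> nat" and D :: "'f set" and C :: "'f set" and R :: "('f, 'v) rules" where
  Split: "\<lbrakk>f \<in> D; length ts = ar f; evals ar D C R K ts n K' vs;
           eval ar D C R K' (Fun f vs) n' K'' v\<rbrakk>
    \<Longrightarrow> eval ar D C R K (Fun f ts) (n' + n) K'' v"
| Con: "\<lbrakk>c \<in> C; length ts = ar c; evals ar D C R K ts n K' vs\<rbrakk>
    \<Longrightarrow> eval ar D C R K (Fun c ts) n K' (Fun c vs)"
| Read: "\<lbrakk>K \<in> caches ar D C; (Fun f vs, v) \<in> K\<rbrakk>
    \<Longrightarrow> eval ar D C R K (Fun f vs) 0 K v"
| Update: "\<lbrakk>set vs \<subseteq> vals ar C; (Fun f vs, v) \<notin> K; (Fun f ps, r) \<in> R; map (subst \<sigma>) ps = vs;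
            eval ar D C R K (subst \<sigma> r) m K' v\<rbrakk>
    \<Longrightarrow> eval ar D C R K (Fun f vs) (m + 1) (insert (Fun f vs, v) K') v"
| Nil: "K \<in> caches ar D C \<Longrightarrow> evals ar D C R K [] 0 K []"
| Cons: "\<lbrakk>eval ar D C R K t n K' v; evals ar D C R K' ts n' K'' vs\<rbrakk>
    \<Longrightarrow> evals ar D C R K (t # ts) (n + n') K'' (v # vs)"


section \<open>Deterministic multi-tape Turing machines\<close>

text \<open>A tape is a head position and the contents of the cells, \<open>None\<close> being the blank.\<close>

type_synonym 'a tape = "int \<times> (int \<Rightarrow> 'a option)"

datatype move = Left | Stay | Right

record ('q, 'a) tm =
  ntapes :: nat
  states :: "'q set"
  alphabet :: "'a set"
  start :: 'q
  halt :: 'q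
  delta :: "'q \<Rightarrow> 'a option list \<Rightarrow> 'q \<times> ('a option \<times> move) list"

definition turing_machine :: "('q, 'a) tm \<Rightarrow> bool" where
  "turing_machine M \<longleftrightarrow>
     ntapes M \<ge> 1 \<and> finite (states M) \<and> finite (alphabet M) \<and>
     start M \<in> states M \<and> halt M \<in> states M \<and>
     (\<forall>q\<in>states M. \<forall>as. length as = ntapes M \<and> set as \<subseteq> insert None (Some ` alphabet M) \<longrightarrow>
        (case delta M q as of (q', acts) \<Rightarrow>
           q' \<in> states M \<and> length acts = ntapes M \<and>
           fst ` set acts \<subseteq> insert None (Some ` alphabet M)))"

fun act :: "'a tape \<Rightarrow> 'a option \<times> move \<Rightarrow> 'a tape" where
  "act (h, c) (a, d) =
     ((case d of Left \<Rightarrow> h - 1 | Stay \<Rightarrow> h | Right \<Rightarrow> h + 1), c(h := a))"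

fun tm_step :: "('q, 'a) tm \<Rightarrow> 'q \<times> 'a tape list \<Rightarrow> 'q \<times> 'a tape list" where
  "tm_step M (q, tps) =
     (if q = halt M then (q, tps)
      else case delta M q (map (\<lambda>(h, c). c h) tps) of
        (q', acts) \<Rightarrow> (q', map2 act tps acts))"

definition contents :: "'a list \<Rightarrow> int \<Rightarrow> 'a option" where
  "contents w i = (if 0 \<le> i \<and> nat i < length w then Some (w ! nat i) else None)"

definition tm_init :: "('q, 'a) tm \<Rightarrow> 'a list \<Rightarrow> 'q \<times> 'a tape list" where
  "tm_init M x = (start M, (0, contents x) # replicate (ntapes M - 1) (0, contents []))"

text \<open>The input is on the first tape, the output on the last one. At the end the output tape holds
  exactly the output word, starting in cell \<open>0\<close>.\<close>

definition computes_within :: "('q, 'a) tm \<Rightarrow> 'a list \<Rightarrow> 'a list \<Rightarrow> nat \<Rightarrow> bool" where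
  "computes_within M x y T \<longleftrightarrow>
     set x \<subseteq> alphabet M \<and>
     (\<exists>n\<le>T. \<exists>tps. (tm_step M ^^ n) (tm_init M x) = (halt M, tps) \<and> snd (last tps) = contents y)"


section \<open>Representation of terms by strings and by DAGs\<close>

text \<open>\<open>Bit\<close> and \<open>Sep\<close> serve for writing down graphs; the letters \<open>Aux n\<close> occur neither in inputs nor in
  outputs and are there so that machines can have further work letters.\<close>

datatype 'f letter = Sym 'f | Bit bool | Sep | Aux nat

text \<open>Prefix notation, which is unambiguous since arities are fixed. Only applied to ground terms.\<close>

primrec trm_string :: "('f, 'v) trm \<Rightarrow> 'f letter list" where
  "trm_string (Var x) = []"
| "trm_string (Fun f ts) = Sym f # concat (map trm_string ts)"

record ('n, 'f) dag =
  nodes :: "'n set"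
  label :: "'n \<Rightarrow> 'f"
  succs :: "'n \<Rightarrow> 'n list"
  root :: 'n

definition edges :: "('n, 'f) dag \<Rightarrow> ('n \<times> 'n) set" where
  "edges G = {(u, w). u \<in> nodes G \<and> w \<in> set (succs G u)}"

text \<open>Rootedness includes that all nodes are reachable from the root.\<close>

definition rooted_dag :: "('f \<Rightarrow> nat) \<Rightarrow> 'f set \<Rightarrow> ('n, 'f) dag \<Rightarrow> bool" where
  "rooted_dag ar C G \<longleftrightarrow>
     finite (nodes G) \<and> root G \<in> nodes G \<and>
     (\<forall>u\<in>nodes G. label G u \<in> C \<and> length (succs G u) = ar (label G u) \<and>
        set (succs G u) \<subseteq> nodes G) \<and>
     acyclic (edges G) \<and>
     (\<forall>u\<in>nodes G. (root G, u) \<in> (edges G)\<^sup>*)"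

definition maximally_shared :: "('n, 'f) dag \<Rightarrow> bool" where
  "maximally_shared G \<longleftrightarrow>
     (\<forall>u\<in>nodes G. \<forall>w\<in>nodes G. label G u = label G w \<and> succs G u = succs G w \<longrightarrow> u = w)"

inductive unfolds :: "('n, 'f) dag \<Rightarrow> 'n \<Rightarrow> ('f, 'v) trm \<Rightarrow> bool" for G :: "('n, 'f) dag" where
  "\<lbrakk>u \<in> nodes G; list_all2 (unfolds G) (succs G u) ts\<rbrakk> \<Longrightarrow> unfolds G u (Fun (label G u) ts)"

text \<open>The nodes of an encoded graph are named by pairwise distinct, otherwise arbitrary binary words.
  The encoding consists of the name of the root followed by, for every node in some order, its
  label, its name and the names of its successors. It can be decoded uniquely: names end with
  \<open>Sep\<close>, and node entries start with a \<open>Sym\<close>.\<close>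

definition name_string :: "bool list \<Rightarrow> 'f letter list" where
  "name_string u = map Bit u @ [Sep]"

definition node_string :: "(bool list, 'f) dag \<Rightarrow> bool list \<Rightarrow> 'f letter list" where
  "node_string G u =
     Sym (label G u) # name_string u @ concat (map name_string (succs G u))"

definition encodes_dag :: "'f letter list \<Rightarrow> (bool list, 'f) dag \<Rightarrow> bool" where
  "encodes_dag w G \<longleftrightarrow>
     (\<exists>us. distinct us \<and> set us = nodes G \<and>
        w = name_string (root G) @ concat (map (node_string G) us))"

definition dag_representation ::
    "('f \<Rightarrow> nat) \<Rightarrow> 'f set \<Rightarrow> 'f letter list \<Rightarrow> ('f, 'v) trm \<Rightarrow> bool" where
  "dag_representation ar C w v \<longleftrightarrow>
     (\<exists>G. rooted_dag ar C G \<and> maximally_shared G \<and> unfolds G (root G) v \<and> encodes_dag w G)"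


section \<open>Polynomials in two variables\<close>

definition polynomial2 :: "(nat \<times> nat \<Rightarrow> nat) \<Rightarrow> bool" where
  "polynomial2 p \<longleftrightarrow>
     (\<exists>d (a :: nat \<Rightarrow> nat \<Rightarrow> nat). \<forall>x y. p (x, y) = (\<Sum>i\<le>d. \<Sum>j\<le>d. a i j * x ^ i * y ^ j))"

end

theory Submission
  imports Defs
begin

text \<open>
  The interpreter is written in a language of structured stack programs, which compiles to multi-tape
  Turing machines with one tape per stack and one state per continuation.

  It keeps a single table of rows (symbol, arguments, result). Rows of constructors are the nodes of a
  maximally shared heap, rows of operations are the entries of the cache, and all arguments and results
  are row numbers, written in unary. Equality of values is then equality of numbers, and (Con), (Read)
  and (Update) all start with the same look-up. By orthogonality the semantics is deterministic, so the
  look-up of a call fails exactly when (Update) is applicable, and at most one rule matches.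

  A derivation of cost \<open>m\<close> from an input of size \<open>n\<close> is followed in \<open>O(n + m)\<close> steps: terms are executed
  as postfix code, and each (Update) adds the code of one right-hand side. Every step appends at most
  one row, so it takes time polynomial in \<open>n + m\<close>. In the end the rows reachable from the result are
  written down.
\<close>


section \<open>Stack programs and their compilation to Turing machines\<close>

text \<open>The obstacle is sharing. A value obtained at cost m can have a size exponential in m,
  and an instance \<open>subst \<sigma> r\<close> repeats whole values. So no instance is ever
  written down: the code of r is pushed with row numbers in place of its variables. Where a
  derivation walks through such a value with (Con), at cost 0 but in arbitrarily many inferences,
  the machine makes a single push. Hence the steps are counted by the size of the rule and not of
  its instance, which gives the bound \<open>n + 1 + m * rules_size\<close> with n the size of the
  arguments. Row numbers are below this bound as well, so unary notation and linear search are
  affordable.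

  The semantics is not syntax-directed: (Split) also applies to a call whose arguments are values
  already, and (Update) excludes only one particular pair from the cache. The simulation therefore
  follows a given derivation, and determinism shows that the machine makes the same choices.

  A node refers to older nodes only and rows are never changed. This keeps pending numbers valid,
  makes the output acyclic and lets a single backward pass find what is reachable.\<close>

datatype ('r, 'a) com =
    Skip
  | Push 'r 'a
  | Pop 'r
  | Mov 'r 'r
  | Out 'r 'r
  | Seq "('r, 'a) com" "('r, 'a) com" (infixr ";;" 60)
  | Test 'r 'r "'a option \<Rightarrow> 'a option \<Rightarrow> bool" "('r, 'a) com" "('r, 'a) com"
  | While 'r 'r "'a option \<Rightarrow> 'a option \<Rightarrow> bool" "('r, 'a) com"

text \<open>Every register holds a stack. \<open>Out r q\<close> moves a letter from the stack \<open>r\<close> to the far end of \<open>q\<close>;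
  only the output tape is written in this way. The number in \<open>exec\<close> is the exact number of steps of
  the compiled Turing machine.\<close>

definition top_of :: "'a list \<Rightarrow> 'a option" where
  "top_of xs = (case xs of [] \<Rightarrow> None | x # _ \<Rightarrow> Some x)"

lemma top_of_simps [simp]: "top_of [] = None" "top_of (x # xs) = Some x"
  by (simp_all add: top_of_def)

inductive exec :: "('r, 'a) com \<Rightarrow> ('r \<Rightarrow> 'a list) \<Rightarrow> ('r \<Rightarrow> 'a list) \<Rightarrow> nat \<Rightarrow> bool" where
  Skip: "exec Skip s s 1"
| Push: "exec (Push r a) s (s(r := a # s r)) 2"
| Pop: "exec (Pop r) s (s(r := tl (s r))) 1"
| Mov: "s r = a # xs \<Longrightarrow> r \<noteq> q \<Longrightarrow> exec (Mov r q) s (s(r := xs, q := a # s q)) 2"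
| Out: "s r = a # xs \<Longrightarrow> r \<noteq> q \<Longrightarrow> exec (Out r q) s (s(r := xs, q := s q @ [a])) 1"
| Seq: "exec c1 s t n1 \<Longrightarrow> exec c2 t u n2 \<Longrightarrow> exec (c1 ;; c2) s u (Suc (n1 + n2))"
| IfT: "p (top_of (s r)) (top_of (s q)) \<Longrightarrow> exec c1 s t n \<Longrightarrow> exec (Test r q p c1 c2) s t (Suc n)"
| IfF: "\<not> p (top_of (s r)) (top_of (s q)) \<Longrightarrow> exec c2 s t n \<Longrightarrow> exec (Test r q p c1 c2) s t (Suc n)"
| WhileT: "p (top_of (s r)) (top_of (s q)) \<Longrightarrow> exec c s t n1 \<Longrightarrow> exec (While r q p c) t u n2 \<Longrightarrow>
    exec (While r q p c) s u (Suc (n1 + n2))"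
| WhileF: "\<not> p (top_of (s r)) (top_of (s q)) \<Longrightarrow> exec (While r q p c) s s 1"

primrec regs :: "('r, 'a) com \<Rightarrow> 'r set" where
  "regs Skip = {}"
| "regs (Push r a) = {r}"
| "regs (Pop r) = {r}"
| "regs (Mov r q) = {r, q}"
| "regs (Out r q) = {r, q}"
| "regs (c1 ;; c2) = regs c1 \<union> regs c2"
| "regs (Test r q p c1 c2) = {r, q} \<union> regs c1 \<union> regs c2"
| "regs (While r q p c) = {r, q} \<union> regs c"

primrec letters :: "('r, 'a) com \<Rightarrow> 'a set" where
  "letters Skip = {}"
| "letters (Push r a) = {a}"
| "letters (Pop r) = {}"
| "letters (Mov r q) = {}"
| "letters (Out r q) = {}"
| "letters (c1 ;; c2) = letters c1 \<union> letters c2"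
| "letters (Test r q p c1 c2) = letters c1 \<union> letters c2"
| "letters (While r q p c) = letters c"

text \<open>A stack grows to the left of its head and drifts along its tape, whereas the output has
  to start in cell \<open>0\<close>. So \<open>w\<close> may be nothing but the target of
  \<open>Out\<close>, and it is never tested, since its head stands on the blank behind the
  word.\<close>

primrec out_only :: "'r \<Rightarrow> ('r, 'a) com \<Rightarrow> bool" where
  "out_only w Skip = True"
| "out_only w (Push r a) = (r \<noteq> w)"
| "out_only w (Pop r) = (r \<noteq> w)"
| "out_only w (Mov r q) = (r \<noteq> w \<and> q \<noteq> w)"
| "out_only w (Out r q) = (r \<noteq> w \<and> q = w)"
| "out_only w (c1 ;; c2) = (out_only w c1 \<and> out_only w c2)"
| "out_only w (Test r q p c1 c2) = (r \<noteq> w \<and> q \<noteq> w \<and> out_only w c1 \<and> out_only w c2)"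
| "out_only w (While r q p c) = (r \<noteq> w \<and> q \<noteq> w \<and> out_only w c)"

text \<open>The states of the compiled machine are the continuations, lists of commands still to be executed.\<close>

primrec conts :: "('r, 'a) com \<Rightarrow> ('r, 'a) com list \<Rightarrow> ('r, 'a) com list set" where
  "conts Skip k = {Skip # k}"
| "conts (Push r a) k = {Push r a # k}"
| "conts (Pop r) k = {Pop r # k}"
| "conts (Mov r q) k = {Mov r q # k}"
| "conts (Out r q) k = {Out r q # k}"
| "conts (c1 ;; c2) k = {(c1 ;; c2) # k} \<union> conts c1 (c2 # k) \<union> conts c2 k"
| "conts (Test r q p c1 c2) k = {Test r q p c1 c2 # k} \<union> conts c1 k \<union> conts c2 k"
| "conts (While r q p c) k = {While r q p c # k} \<union> conts c (While r q p c # k)"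

lemma finite_regs: "finite (regs c)"
  by (induction c) auto

lemma finite_letters: "finite (letters c)"
  by (induction c) auto

lemma finite_conts: "finite (conts c k)"
  by (induction c arbitrary: k) auto

lemma conts_self: "c # k \<in> conts c k"
  by (cases c) auto

text \<open>A push takes two steps: the head moves left first and writes afterwards. The Boolean
  component of the state tells the two steps apart.\<close>

fun next_state :: "('r, 'a) com list \<Rightarrow> bool \<Rightarrow> ('r \<Rightarrow> 'a option) \<Rightarrow> ('r, 'a) com list \<times> bool" where
  "next_state [] b t = ([], False)"
| "next_state (Skip # k) b t = (k, False)"
| "next_state (Push r a # k) b t = (if b then (k, False) else (Push r a # k, True))"
| "next_state (Pop r # k) b t = (k, False)"
| "next_state (Mov r q # k) b t = (if b then (k, False) else (Mov r q # k, True))"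
| "next_state (Out r q # k) b t = (k, False)"
| "next_state ((c1 ;; c2) # k) b t = (c1 # c2 # k, False)"
| "next_state (Test r q p c1 c2 # k) b t = ((if p (t r) (t q) then c1 else c2) # k, False)"
| "next_state (While r q p c # k) b t = (if p (t r) (t q) then c # While r q p c # k else k, False)"

text \<open>In the first step of \<open>Mov\<close> only the target head moves. The letter is then
  still under the source head, so the second step can erase it there and write it to the target at
  once. \<open>Out\<close> writes before it moves and needs one step.\<close>

fun next_act :: "('r, 'a) com list \<Rightarrow> bool \<Rightarrow> ('r \<Rightarrow> 'a option) \<Rightarrow> 'r \<Rightarrow> 'a option \<times> move" where
  "next_act (Push r a # k) b t = (\<lambda>x. (t x, Stay))(r := if b then (Some a, Stay) else (t r, Left))"
| "next_act (Pop r # k) b t = (\<lambda>x. (t x, Stay))(r := (None, Right))"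
| "next_act (Mov r q # k) b t =
    (if b then (\<lambda>x. (t x, Stay))(r := (None, Right), q := (t r, Stay))
     else (\<lambda>x. (t x, Stay))(q := (t q, Left)))"
| "next_act (Out r q # k) b t = (\<lambda>x. (t x, Stay))(r := (None, Right), q := (t r, Right))"
| "next_act _ b t = (\<lambda>x. (t x, Stay))"

definition compile :: "'r list \<Rightarrow> 'a set \<Rightarrow> ('r, 'a) com \<Rightarrow> (('r, 'a) com list \<times> bool, 'a) tm" where
  "compile rs Al c =
    \<lparr>ntapes = length rs, states = insert [] (conts c []) \<times> UNIV, alphabet = Al \<union> letters c,
     start = ([c], False), halt = ([], False),
     delta = (\<lambda>(k, b) as. let t = (\<lambda>r. case map_of (zip rs as) r of None \<Rightarrow> None | Some x \<Rightarrow> x)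
        in (next_state k b t, map (next_act k b t) rs))\<rparr>"

text \<open>\<open>While\<close> returns to its own continuation, so unboundedly many rounds of a
  loop stay within finitely many states.\<close>

lemma next_state_conts:
  "k' \<in> conts c k \<Longrightarrow> fst (next_state k' b t) \<in> insert k (conts c k)"
proof (induction c arbitrary: k)
  case (Seq c1 c2)
  then show ?case
    using conts_self[of c1 "c2 # k"] conts_self[of c2 k] by fastforce
next
  case (Test r q p c1 c2)
  then show ?case
    using conts_self[of c1 k] conts_self[of c2 k] by (auto split: if_splits)
next
  case (While r q p c)
  then show ?case
    using conts_self[of c "While r q p c # k"] by fastforce
qed auto

section \<open>Tapes as stacks\<close>

definition scan :: "'a tape \<Rightarrow> 'a option" where
  "scan tp = snd tp (fst tp)"

text \<open>For a stack only the contents relative to the head \<open>h\<close> matter, since pushes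
  and pops shift it. The output tape is anchored at cell \<open>0\<close>, with the head just behind
  the last letter.\<close>

definition tape_rep :: "bool \<Rightarrow> 'a list \<Rightarrow> 'a tape \<Rightarrow> bool" where
  "tape_rep out xs tp \<longleftrightarrow>
     (if out then tp = (int (length xs), contents xs) else (\<exists>h. tp = (h, \<lambda>i. contents xs (i - h))))"

lemma scan_stack: "tape_rep False xs tp \<Longrightarrow> scan tp = top_of xs"
  by (auto simp: tape_rep_def scan_def contents_def top_of_def split: list.split)

lemma act_stay: "act tp (scan tp, Stay) = tp"
  by (cases tp) (auto simp: scan_def)

lemma act_left: "act tp (scan tp, Left) = (fst tp - 1, snd tp)"
  by (cases tp) (auto simp: scan_def)

lemma act_push:
  assumes "tape_rep False xs tp"
  shows "tape_rep False (a # xs) (act (fst tp - 1, snd tp) (Some a, Stay))"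
proof -
  from assms obtain h where h: "tp = (h, \<lambda>i. contents xs (i - h))"
    by (auto simp: tape_rep_def)
  have "(\<lambda>i. contents xs (i - h))(h - 1 := Some a) = (\<lambda>i. contents (a # xs) (i - (h - 1)))"
  proof
    fix i
    consider "i < h - 1" | "i = h - 1" | "i \<ge> h" by linarith
    then show "((\<lambda>i. contents xs (i - h))(h - 1 := Some a)) i = contents (a # xs) (i - (h - 1))"
    proof cases
      case 3
      then have "nat (i - (h - 1)) = Suc (nat (i - h))" by simp
      with 3 show ?thesis by (simp add: contents_def)
    qed (auto simp: contents_def)
  qed
  then show ?thesis
    by (simp add: tape_rep_def h)
qed

text \<open>Covers the empty stack too: the head then moves over blanks, and the shifted blank tape
  still represents the empty list. This matches \<open>tl [] = []\<close> in
  \<open>exec\<close>.\<close>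

lemma act_pop:
  assumes "tape_rep False xs tp"
  shows "tape_rep False (tl xs) (act tp (None, Right))"
proof -
  from assms obtain h where h: "tp = (h, \<lambda>i. contents xs (i - h))"
    by (auto simp: tape_rep_def)
  have "(\<lambda>i. contents xs (i - h))(h := None) = (\<lambda>i. contents (tl xs) (i - (h + 1)))"
  proof
    fix i
    consider "i < h" | "i = h" | "i > h" by linarith
    then show "((\<lambda>i. contents xs (i - h))(h := None)) i = contents (tl xs) (i - (h + 1))"
    proof cases
      case 3
      then have "nat (i - h) = Suc (nat (i - (h + 1)))" by simp
      with 3 show ?thesis by (cases xs) (auto simp: contents_def)
    qed (auto simp: contents_def)
  qed
  then show ?thesis
    by (auto simp add: tape_rep_def h)
qed

lemma act_out:
  assumes "tape_rep True xs tp"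
  shows "tape_rep True (xs @ [a]) (act tp (Some a, Right))"
  using assms by (auto simp: tape_rep_def contents_def fun_eq_iff nth_append)

definition tapes_rep :: "'r \<Rightarrow> 'r list \<Rightarrow> ('r \<Rightarrow> 'a list) \<Rightarrow> ('r \<Rightarrow> 'a tape) \<Rightarrow> bool" where
  "tapes_rep w rs s \<tau> \<longleftrightarrow> (\<forall>r\<in>set rs. tape_rep (r = w) (s r) (\<tau> r))"

definition reads :: "'r list \<Rightarrow> ('r \<Rightarrow> 'a tape) \<Rightarrow> 'r \<Rightarrow> 'a option" where
  "reads rs \<tau> r = (if r \<in> set rs then scan (\<tau> r) else None)"

lemma reads_top: "tapes_rep w rs s \<tau> \<Longrightarrow> r \<in> set rs \<Longrightarrow> r \<noteq> w \<Longrightarrow> reads rs \<tau> r = top_of (s r)"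
  using scan_stack[of "s r" "\<tau> r"] by (auto simp: tapes_rep_def reads_def)

lemma compile_step:
  assumes "k \<noteq> []"
  shows "tm_step (compile rs Al c) ((k, b), map \<tau> rs) =
    (next_state k b (reads rs \<tau>), map (\<lambda>r. act (\<tau> r) (next_act k b (reads rs \<tau>) r)) rs)"
proof -
  have 1: "map (\<lambda>(h, c). c h) (map \<tau> rs) = map (\<lambda>r. scan (\<tau> r)) rs"
    by (simp add: scan_def case_prod_beta)
  have 2: "(\<lambda>r. case map_of (zip rs (map (\<lambda>r. scan (\<tau> r)) rs)) r of None \<Rightarrow> None | Some x \<Rightarrow> x) = reads rs \<tau>"
    by (auto simp: map_of_zip_map fun_eq_iff reads_def)
  have 3: "map2 act (map \<tau> rs) (map g rs) = map (\<lambda>r. act (\<tau> r) (g r)) rs" for g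
    by (induction rs) auto
  show ?thesis
    unfolding tm_step.simps 1 using assms by (simp add: compile_def Let_def 2 3)
qed

lemma funpow_chain:
  "f x = y \<Longrightarrow> (f ^^ m) y = z \<Longrightarrow> (f ^^ n) z = u \<Longrightarrow> (f ^^ Suc (m + n)) x = u"
  by (simp add: add.commute[of m n] funpow_add funpow_swap1)

declare tm_step.simps [simp del]

text \<open>The rest \<open>k\<close> of the program is part of the state, so it has to be arbitrary
  in the induction. The transitions depend on the continuation alone; \<open>c0\<close> enters only
  through the set of states, the alphabet and the start state.\<close>

lemma compile_exec:
  assumes "exec c s s' n" "out_only w c" "regs c \<subseteq> set rs" "tapes_rep w rs s \<tau>"
  shows "\<exists>\<tau>'. tapes_rep w rs s' \<tau>' \<and>
    (tm_step (compile rs Al c0) ^^ n) ((c # k, False), map \<tau> rs) = ((k, False), map \<tau>' rs)"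
  using assms
proof (induction arbitrary: \<tau> k)
  case (Skip s)
  then show ?case
    by (intro exI[of _ \<tau>]) (auto simp: compile_step reads_def act_stay)
next
  case (Push r a s)
  let ?\<tau> = "\<tau>(r := (fst (\<tau> r) - 1, snd (\<tau> r)))"
  let ?\<tau>' = "?\<tau>(r := act (?\<tau> r) (Some a, Stay))"
  have 1: "tm_step (compile rs Al c0) ((Push r a # k, False), map \<tau> rs) = ((Push r a # k, True), map ?\<tau> rs)"
    by (auto simp: compile_step reads_def act_stay act_left)
  have 2: "tm_step (compile rs Al c0) ((Push r a # k, True), map ?\<tau> rs) = ((k, False), map ?\<tau>' rs)"
    by (auto simp: compile_step reads_def act_stay)
  have "(tm_step (compile rs Al c0) ^^ 2) ((Push r a # k, False), map \<tau> rs) = ((k, False), map ?\<tau>' rs)"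
    unfolding numeral_2_eq_2 funpow.simps o_apply id_apply 1 2 ..
  moreover have "tapes_rep w rs (s(r := a # s r)) ?\<tau>'"
    using Push act_push[of "s r" "\<tau> r" a] by (auto simp: tapes_rep_def)
  ultimately show ?case by blast
next
  case (Pop r s)
  let ?\<tau> = "\<tau>(r := act (\<tau> r) (None, Right))"
  have "(tm_step (compile rs Al c0) ^^ 1) ((Pop r # k, False), map \<tau> rs) = ((k, False), map ?\<tau> rs)"
    by (auto simp: compile_step reads_def act_stay)
  moreover have "tapes_rep w rs (s(r := tl (s r))) ?\<tau>"
    using Pop act_pop[of "s r" "\<tau> r"] by (auto simp: tapes_rep_def)
  ultimately show ?case by blast
next
  case (Mov s r a xs q)
  let ?\<tau> = "\<tau>(q := (fst (\<tau> q) - 1, snd (\<tau> q)))"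
  let ?\<tau>' = "?\<tau>(r := act (?\<tau> r) (None, Right), q := act (?\<tau> q) (Some a, Stay))"
  have r: "r \<in> set rs" "scan (\<tau> r) = Some a"
    using Mov scan_stack[of "s r" "\<tau> r"] by (auto simp: tapes_rep_def)
  have 1: "tm_step (compile rs Al c0) ((Mov r q # k, False), map \<tau> rs) = ((Mov r q # k, True), map ?\<tau> rs)"
    by (auto simp: compile_step reads_def act_stay act_left)
  have 2: "tm_step (compile rs Al c0) ((Mov r q # k, True), map ?\<tau> rs) = ((k, False), map ?\<tau>' rs)"
    using r Mov(2) by (auto simp: compile_step reads_def act_stay)
  have "(tm_step (compile rs Al c0) ^^ 2) ((Mov r q # k, False), map \<tau> rs) = ((k, False), map ?\<tau>' rs)"
    unfolding numeral_2_eq_2 funpow.simps o_apply id_apply 1 2 ..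
  moreover have "tapes_rep w rs (s(r := xs, q := a # s q)) ?\<tau>'"
    using Mov act_push[of "s q" "\<tau> q" a] act_pop[of "s r" "\<tau> r"] by (auto simp: tapes_rep_def)
  ultimately show ?case by blast
next
  case (Out s r a xs q)
  let ?\<tau> = "\<tau>(r := act (\<tau> r) (None, Right), q := act (\<tau> q) (Some a, Right))"
  have "r \<in> set rs" "scan (\<tau> r) = Some a"
    using Out scan_stack[of "s r" "\<tau> r"] by (auto simp: tapes_rep_def)
  then have "(tm_step (compile rs Al c0) ^^ 1) ((Out r q # k, False), map \<tau> rs) = ((k, False), map ?\<tau> rs)"
    using Out(2) by (auto simp: compile_step reads_def act_stay)
  moreover have "tapes_rep w rs (s(r := xs, q := s q @ [a])) ?\<tau>"
    using Out act_out[of "s q" "\<tau> q" a] act_pop[of "s r" "\<tau> r"] by (auto simp: tapes_rep_def)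
  ultimately show ?case by blast
next
  case (Seq c1 s t n1 c2 u n2)
  have 1: "tm_step (compile rs Al c0) (((c1 ;; c2) # k, False), map \<tau> rs) = ((c1 # c2 # k, False), map \<tau> rs)"
    by (auto simp: compile_step reads_def act_stay)
  obtain \<tau>1 where \<tau>1: "tapes_rep w rs t \<tau>1"
    "(tm_step (compile rs Al c0) ^^ n1) ((c1 # c2 # k, False), map \<tau> rs) = ((c2 # k, False), map \<tau>1 rs)"
    using Seq.IH(1)[of \<tau> "c2 # k"] Seq.prems by auto
  obtain \<tau>2 where "tapes_rep w rs u \<tau>2"
    "(tm_step (compile rs Al c0) ^^ n2) ((c2 # k, False), map \<tau>1 rs) = ((k, False), map \<tau>2 rs)"
    using Seq.IH(2)[of \<tau>1 k] Seq.prems \<tau>1 by auto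
  then show ?case
    using funpow_chain[OF 1 \<tau>1(2)] by blast
next
  case (IfT p s r q c1 t n c2)
  have "tm_step (compile rs Al c0) ((Test r q p c1 c2 # k, False), map \<tau> rs) = ((c1 # k, False), map \<tau> rs)"
    using IfT.prems IfT.hyps by (auto simp: compile_step act_stay reads_top) (auto simp: reads_def act_stay)
  then show ?case
    using IfT.IH[of \<tau> k] IfT.prems by (auto simp: funpow_swap1)
next
  case (IfF p s r q c2 t n c1)
  have "tm_step (compile rs Al c0) ((Test r q p c1 c2 # k, False), map \<tau> rs) = ((c2 # k, False), map \<tau> rs)"
    using IfF.prems IfF.hyps by (auto simp: compile_step act_stay reads_top) (auto simp: reads_def act_stay)
  then show ?case
    using IfF.IH[of \<tau> k] IfF.prems by (auto simp: funpow_swap1)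
next
  case (WhileT p s r q c t n1 u n2)
  let ?W = "While r q p c"
  have 1: "tm_step (compile rs Al c0) ((?W # k, False), map \<tau> rs) = ((c # ?W # k, False), map \<tau> rs)"
    using WhileT.prems WhileT.hyps by (auto simp: compile_step act_stay reads_top) (auto simp: reads_def act_stay)
  obtain \<tau>1 where \<tau>1: "tapes_rep w rs t \<tau>1"
    "(tm_step (compile rs Al c0) ^^ n1) ((c # ?W # k, False), map \<tau> rs) = ((?W # k, False), map \<tau>1 rs)"
    using WhileT.IH(1)[of \<tau> "?W # k"] WhileT.prems by auto
  obtain \<tau>2 where "tapes_rep w rs u \<tau>2"
    "(tm_step (compile rs Al c0) ^^ n2) ((?W # k, False), map \<tau>1 rs) = ((k, False), map \<tau>2 rs)"
    using WhileT.IH(2)[of \<tau>1 k] WhileT.prems \<tau>1 by auto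
  then show ?case
    using funpow_chain[OF 1 \<tau>1(2)] by blast
next
  case (WhileF p s r q c)
  have "tm_step (compile rs Al c0) ((While r q p c # k, False), map \<tau> rs) = ((k, False), map \<tau> rs)"
    using WhileF.prems WhileF.hyps by (auto simp: compile_step act_stay reads_top) (auto simp: reads_def act_stay)
  then show ?case
    using WhileF.prems by (auto intro!: exI[of _ \<tau>])
qed

section \<open>Well-formedness of the compiled machine and renaming of its states\<close>

lemma conts_letters: "k' \<in> conts c k \<Longrightarrow> k' \<noteq> [] \<and> letters (hd k') \<subseteq> letters c"
  by (induction c arbitrary: k) fastforce+

lemma next_act_letters:
  assumes "k = [] \<or> letters (hd k) \<subseteq> A" "\<And>r. t r \<in> insert None (Some ` A)"
  shows "fst (next_act k b t r) \<in> insert None (Some ` A)"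
  using assms by (cases "(k, b, t)" rule: next_act.cases) auto

text \<open>Stronger than what \<open>turing_machine\<close> asks, as \<open>as\<close> ranges over
  all lists. Because of this \<open>rename_states\<close> need not follow which letters occur on the
  tapes.\<close>

lemma compile_closed:
  assumes "q \<in> states (compile rs Al c)"
  shows "fst (delta (compile rs Al c) q as) \<in> states (compile rs Al c)"
proof -
  obtain k b where q: "q = (k, b)" by (cases q)
  have "k = [] \<or> k \<in> conts c []"
    using assms by (auto simp: compile_def q)
  then have "fst (next_state k b t) \<in> insert [] (conts c [])" for t
    using next_state_conts[of k c "[]" b t] by auto
  then show ?thesis
    by (auto simp: compile_def q Let_def mem_Times_iff)
qed

lemma turing_machine_compile:
  assumes "finite Al" "rs \<noteq> []"
  shows "turing_machine (compile rs Al c)"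
proof -
  let ?M = "compile rs Al c"
  let ?A = "insert None (Some ` alphabet ?M)"
  have "fst ` set (snd (delta ?M q as)) \<subseteq> ?A"
    if "q \<in> states ?M" "length as = length rs" "set as \<subseteq> ?A" for q as
  proof -
    obtain k b where q: "q = (k, b)" by (cases q)
    define t where "t = (\<lambda>r. case map_of (zip rs as) r of None \<Rightarrow> None | Some x \<Rightarrow> x)"
    have "t r \<in> ?A" for r
      using that(3) by (auto simp: t_def split: option.split dest!: map_of_SomeD set_zip_rightD)
    moreover have "k = [] \<or> letters (hd k) \<subseteq> alphabet ?M"
      using that(1) conts_letters[of k c "[]"] by (auto simp: compile_def q)
    ultimately have "fst (next_act k b t r) \<in> ?A" for r
      by (rule next_act_letters[rotated])
    moreover have "snd (delta ?M q as) = map (next_act k b t) rs"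
      by (simp add: compile_def q t_def Let_def)
    ultimately show ?thesis
      by (metis (no_types, lifting) imageE image_subsetI list.set_map)
  qed
  then have letters: "fst ` set acts \<subseteq> ?A"
    if "q \<in> states ?M" "length as = length rs" "set as \<subseteq> ?A" "delta ?M q as = (q', acts)" for q as q' acts
    using that by (metis snd_conv)
  have "length (snd (delta ?M q as)) = length rs" for q as
    by (simp add: compile_def case_prod_beta Let_def)
  then have len: "length acts = length rs" if "delta ?M q as = (q', acts)" for q as q' acts
    using that by (metis snd_conv)
  have closed: "q' \<in> states ?M" if "q \<in> states ?M" "delta ?M q as = (q', acts)" for q as q' acts
    using that compile_closed by (metis fst_conv)
  have "ntapes ?M = length rs" "length rs \<ge> 1" "finite (states ?M)" "finite (alphabet ?M)"
    "start ?M \<in> states ?M" "halt ?M \<in> states ?M"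
    using assms by (auto simp: compile_def finite_conts finite_letters conts_self Suc_le_eq)
  then show ?thesis
    unfolding turing_machine_def
  proof (intro conjI ballI allI impI; (simp; fail)?)
    fix q as
    assume q: "q \<in> states ?M" and as: "length as = ntapes ?M \<and> set as \<subseteq> ?A"
    obtain q' acts where d: "delta ?M q as = (q', acts)" by fastforce
    have "length as = length rs" using as by (simp add: compile_def)
    then show "case delta ?M q as of (q', acts) \<Rightarrow>
        q' \<in> states ?M \<and> length acts = ntapes ?M \<and> fst ` set acts \<subseteq> ?A"
      using letters[OF q _ _ d] len[OF d] closed[OF q d] as
      by (simp add: d \<open>ntapes ?M = length rs\<close> del: insert_iff)
  qed
qed

text \<open>Adjusts the type of states from continuations to numbers. A finite set of states embeds
  into the naturals, and every state met during a run lies in that set, where \<open>d\<close>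
  inverts \<open>e\<close>.\<close>

lemma rename_states:
  fixes M :: "('q, 'a) tm"
  assumes M: "turing_machine M" and cl: "\<And>q as. q \<in> states M \<Longrightarrow> fst (delta M q as) \<in> states M"
  shows "\<exists>M' :: (nat, 'a) tm. turing_machine M' \<and>
    (\<forall>x y T. computes_within M x y T \<longrightarrow> computes_within M' x y T)"
proof -
  have "finite (states M)" and st: "start M \<in> states M" "halt M \<in> states M"
    using M by (auto simp: turing_machine_def)
  then obtain e :: "'q \<Rightarrow> nat" where e: "inj_on e (states M)"
    using finite_imp_inj_to_nat_seg by metis
  define d where "d = the_inv_into (states M) e"
  have d: "d (e q) = q" if "q \<in> states M" for q
    unfolding d_def using e that by (rule the_inv_into_f_f)
  define M' where "M' = \<lparr>ntapes = ntapes M, states = e ` states M, alphabet = alphabet M,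
    start = e (start M), halt = e (halt M),
    delta = (\<lambda>q as. case delta M (d q) as of (q', acts) \<Rightarrow> (e q', acts))\<rparr>"
  have "turing_machine M'"
    using M unfolding turing_machine_def M'_def
    by (auto simp: d case_prod_beta)
  moreover have "computes_within M' x y T" if "computes_within M x y T" for x y T
  proof -
    have step: "tm_step M' (e q, tps) = (case tm_step M (q, tps) of (q', tps') \<Rightarrow> (e q', tps'))"
      and step_states: "fst (tm_step M (q, tps)) \<in> states M"
      if "q \<in> states M" for q tps
      using that st e cl[OF that] d[OF that]
      by (auto simp: M'_def inj_on_eq_iff case_prod_beta tm_step.simps)
    have "fst ((tm_step M ^^ n) (tm_init M x)) \<in> states M \<and>
      (tm_step M' ^^ n) (tm_init M' x) =
        (case (tm_step M ^^ n) (tm_init M x) of (q', tps') \<Rightarrow> (e q', tps'))" for n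
    proof (induction n)
      case 0
      then show ?case using st by (simp add: tm_init_def M'_def)
    next
      case (Suc n)
      obtain q tps where q: "(tm_step M ^^ n) (tm_init M x) = (q, tps)" by fastforce
      with Suc have "q \<in> states M" "(tm_step M' ^^ n) (tm_init M' x) = (e q, tps)" by auto
      with step[of q tps] step_states[of q tps] show ?case by (simp add: q)
    qed
    then show ?thesis
      using that unfolding computes_within_def by (fastforce simp: M'_def)
  qed
  ultimately show ?thesis by blast
qed

theorem com_to_tm:
  fixes c :: "('r, 'a) com"
  assumes "finite Al" "inp \<noteq> out" "out_only out c"
  shows "\<exists>M :: (nat, 'a) tm. turing_machine M \<and>
    (\<forall>x s n. set x \<subseteq> Al \<and> exec c (\<lambda>r. if r = inp then x else []) s n \<longrightarrow> computes_within M x (s out) n)"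
proof -
  obtain rs' where rs': "set rs' = regs c - {inp, out}"
    using finite_list[OF finite_Diff[OF finite_regs]] by metis
  \<comment> \<open>\<open>tm_init\<close> puts the input on the first tape and
    \<open>computes_within\<close> reads the last one. Repetitions in \<open>rs'\<close> do no harm:
    all tapes of one register carry the same contents.\<close>
  define rs where "rs = inp # rs' @ [out]"
  let ?M = "compile rs Al c"
  have "computes_within ?M x (s out) n"
    if "set x \<subseteq> Al" and ex: "exec c (\<lambda>r. if r = inp then x else []) s n" for x s n
  proof -
    define \<tau> :: "'r \<Rightarrow> 'a tape" where "\<tau> r = (0, contents (if r = inp then x else []))" for r
    have "contents [] = (\<lambda>_. None)" by (auto simp: contents_def)
    then have "tapes_rep out rs (\<lambda>r. if r = inp then x else []) \<tau>"
      using assms(2) by (auto simp: tapes_rep_def tape_rep_def \<tau>_def intro!: exI[of _ 0])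
    moreover have "regs c \<subseteq> set rs" using rs' by (auto simp: rs_def)
    ultimately obtain \<tau>' where \<tau>': "tapes_rep out rs s \<tau>'"
      "(tm_step ?M ^^ n) (([c], False), map \<tau> rs) = (([], False), map \<tau>' rs)"
      using compile_exec[OF ex assms(3), of rs \<tau> Al c "[]"] by blast
    have "map \<tau> (rs' @ [out]) = replicate (Suc (length rs')) (0, contents [])"
      using assms(2) rs' by (intro replicate_eqI) (auto simp: \<tau>_def)
    then have "tm_init ?M x = (([c], False), map \<tau> rs)"
      by (simp add: tm_init_def compile_def rs_def \<tau>_def replicate_append_same)
    moreover have "snd (last (map \<tau>' rs)) = contents (s out)"
      using \<tau>'(1) by (auto simp: rs_def tapes_rep_def tape_rep_def)
    moreover have "halt ?M = ([], False)" "set x \<subseteq> alphabet ?M"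
      using that by (auto simp: compile_def)
    ultimately show ?thesis
      using \<tau>'(2) unfolding computes_within_def by (metis order.refl)
  qed
  moreover obtain M' :: "(nat, 'a) tm" where "turing_machine M'"
    "\<forall>x y T. computes_within ?M x y T \<longrightarrow> computes_within M' x y T"
    using rename_states[OF turing_machine_compile[OF assms(1)] compile_closed]
    by (metis list.discI rs_def)
  ultimately show ?thesis by blast
qed


section \<open>Unary numbers on stacks\<close>

definition runs :: "('r, 'a) com \<Rightarrow> ('r \<Rightarrow> 'a list) \<Rightarrow> ('r \<Rightarrow> 'a list) \<Rightarrow> nat \<Rightarrow> bool" where
  "runs c s t N \<longleftrightarrow> (\<exists>n\<le>N. exec c s t n)"

lemma runs_mono: "runs c s t N \<Longrightarrow> N \<le> N' \<Longrightarrow> runs c s t N'"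
  by (auto simp: runs_def intro: order_trans)

lemma runs_skip: "t = s \<Longrightarrow> N \<ge> 1 \<Longrightarrow> runs Skip s t N"
  unfolding runs_def using exec.Skip by metis

lemma runs_push: "t = s(r := a # s r) \<Longrightarrow> N \<ge> 2 \<Longrightarrow> runs (Push r a) s t N"
  by (auto simp: runs_def intro: exec.Push)

lemma runs_pop: "t = s(r := tl (s r)) \<Longrightarrow> N \<ge> 1 \<Longrightarrow> runs (Pop r) s t N"
  unfolding runs_def using exec.Pop by metis

lemma runs_mov: "s r = a # xs \<Longrightarrow> r \<noteq> q \<Longrightarrow> t = s(r := xs, q := a # s q) \<Longrightarrow> N \<ge> 2 \<Longrightarrow> runs (Mov r q) s t N"
  by (auto simp: runs_def intro: exec.Mov)

lemma runs_out: "s r = a # xs \<Longrightarrow> r \<noteq> q \<Longrightarrow> t = s(r := xs, q := s q @ [a]) \<Longrightarrow> N \<ge> 1 \<Longrightarrow> runs (Out r q) s t N"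
  unfolding runs_def using exec.Out by metis

lemma runs_seq:
  assumes "runs c1 s t n1" "runs c2 t u n2" "Suc (n1 + n2) \<le> N"
  shows "runs (c1 ;; c2) s u N"
proof -
  from assms obtain m1 m2 where "exec c1 s t m1" "exec c2 t u m2" "m1 \<le> n1" "m2 \<le> n2"
    by (auto simp: runs_def)
  with assms(3) show ?thesis
    by (auto simp: runs_def intro!: exI[of _ "Suc (m1 + m2)"] exec.Seq)
qed

lemma runs_test:
  assumes "p (top_of (s r)) (top_of (s q)) \<Longrightarrow> runs c1 s t n"
    and "\<not> p (top_of (s r)) (top_of (s q)) \<Longrightarrow> runs c2 s t n" "Suc n \<le> N"
  shows "runs (Test r q p c1 c2) s t N"
proof (cases "p (top_of (s r)) (top_of (s q))")
  case True
  with assms(1) obtain m where "exec c1 s t m" "m \<le> n" by (auto simp: runs_def)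
  with exec.IfT[where p = p and s = s and r = r and q = q, OF True] assms(3) show ?thesis
    unfolding runs_def by (metis Suc_le_mono order_trans)
next
  case False
  with assms(2) obtain m where "exec c2 s t m" "m \<le> n" by (auto simp: runs_def)
  with exec.IfF[where p = p and s = s and r = r and q = q, OF False] assms(3) show ?thesis
    unfolding runs_def by (metis Suc_le_mono order_trans)
qed

lemma runs_while_end: "\<not> p (top_of (s r)) (top_of (s q)) \<Longrightarrow> N \<ge> 1 \<Longrightarrow> runs (While r q p c) s s N"
  unfolding runs_def using exec.WhileF[where p = p and s = s and r = r and q = q] by metis

lemma runs_while_step:
  assumes "p (top_of (s r)) (top_of (s q))" "runs c s t n1" "runs (While r q p c) t u n2"
    "Suc (n1 + n2) \<le> N"
  shows "runs (While r q p c) s u N"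
proof -
  from assms obtain m1 m2 where "exec c s t m1" "exec (While r q p c) t u m2" "m1 \<le> n1" "m2 \<le> n2"
    by (auto simp: runs_def)
  with exec.WhileT[where p = p and s = s and r = r and q = q, OF assms(1)] have "exec (While r q p c) s u (Suc (m1 + m2))" by blast
  with \<open>m1 \<le> n1\<close> \<open>m2 \<le> n2\<close> assms(4) show ?thesis
    unfolding runs_def by (metis Suc_le_mono add_mono order_trans)
qed

text \<open>Loops are verified by writing down the state \<open>st i\<close> after \<open>i\<close>
  rounds explicitly.\<close>

lemma runs_while:
  assumes "\<And>i. i < n \<Longrightarrow> p (top_of (st i r)) (top_of (st i q)) \<and> runs c (st i) (st (Suc i)) N"
    and "\<not> p (top_of (st n r)) (top_of (st n q))"
    and "s = st 0" "t = st n" "n * Suc N + 1 \<le> M"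
  shows "runs (While r q p c) s t M"
proof -
  \<comment> \<open>Unfolding a loop exposes its first round, so the induction runs backwards from
    the exit, with \<open>k\<close> the number of rounds still to come.\<close>
  have "runs (While r q p c) (st (n - k)) (st n) (k * Suc N + 1)" if "k \<le> n" for k
    using that
  proof (induction k)
    case 0
    then show ?case using assms(2) by (simp add: runs_while_end)
  next
    case (Suc k)
    then have "n - Suc k < n" "Suc (n - Suc k) = n - k" by auto
    with assms(1)[of "n - Suc k"]
    have 1: "p (top_of (st (n - Suc k) r)) (top_of (st (n - Suc k) q))"
      and 2: "runs c (st (n - Suc k)) (st (n - k)) N" by auto
    have 3: "runs (While r q p c) (st (n - k)) (st n) (k * Suc N + 1)"
      using Suc by simp
    show ?case
      by (rule runs_while_step[where p = p, OF 1 2 3]) simp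
  qed
  from this[of n] assms(3-5) show ?thesis
    by (auto intro: runs_mono)
qed

section \<open>Sequences of commands, in particular on disjoint sets of registers\<close>

primrec seqs :: "('r, 'a) com list \<Rightarrow> ('r, 'a) com" where
  "seqs [] = Skip"
| "seqs (c # cs) = c ;; seqs cs"

lemma runs_seqs:
  assumes "\<And>i. i < length cs \<Longrightarrow> runs (cs ! i) (st i) (st (Suc i)) N"
    and "s = st 0" "t = st (length cs)" "length cs * Suc N + 1 \<le> M"
  shows "runs (seqs cs) s t M"
proof -
  have "runs (seqs cs) (st 0) (st (length cs)) (length cs * Suc N + 1)"
    using assms(1)
  proof (induction cs arbitrary: st)
    case Nil
    then show ?case by (simp add: runs_skip)
  next
    case (Cons c cs)
    have "runs (seqs cs) (st (Suc 0)) (st (Suc (length cs))) (length cs * Suc N + 1)"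
      using Cons.prems by (intro Cons.IH[of "\<lambda>i. st (Suc i)"]) force
    with Cons.prems[of 0] show ?case
      by (auto intro!: runs_seq[where t = "st (Suc 0)"])
  qed
  with assms(2-4) show ?thesis by (auto intro: runs_mono)
qed

text \<open>For commands with disjoint footprints \<open>X i\<close>, as when all columns are
  treated alike, the joint effect does not depend on the order. When \<open>c i\<close> starts, its
  own registers and those outside all footprints are still as in \<open>s\<close>; nothing is said
  about the other footprints, so intermediate states need not be described.\<close>

lemma runs_par:
  assumes "distinct js" "\<And>i j. i \<in> set js \<Longrightarrow> j \<in> set js \<Longrightarrow> i \<noteq> j \<Longrightarrow> X i \<inter> X j = {}"
    and c: "\<And>i u. i \<in> set js \<Longrightarrow> (\<And>r. r \<in> X i \<or> r \<notin> \<Union> (X ` set js) \<Longrightarrow> u r = s r) \<Longrightarrow>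
      runs (c i) u (\<lambda>r. if r \<in> X i then t r else u r) N"
    and "t' = (\<lambda>r. if r \<in> \<Union> (X ` set js) then t r else s r)" "length js * Suc N + 1 \<le> M"
  shows "runs (seqs (map c js)) s t' M"
proof (rule runs_seqs[where st = "\<lambda>i r. if r \<in> \<Union> (X ` set (take i js)) then t r else s r" and N = N])
  fix i assume "i < length (map c js)"
  then have i: "i < length js" by simp
  let ?u = "\<lambda>r. if r \<in> \<Union> (X ` set (take i js)) then t r else s r"
  have notin: "js ! i \<notin> set (take i js)"
    using assms(1) i by (metis distinct_take id_take_nth_drop not_distinct_conv_prefix distinct_append
        disjoint_insert(1) list.set(2))
  have "X (js ! i) \<inter> X j = {}" if "j \<in> set (take i js)" for j
    using that i notin by (intro assms(2)) (auto dest: in_set_takeD)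
  then have "runs (c (js ! i)) ?u (\<lambda>r. if r \<in> X (js ! i) then t r else ?u r) N"
    using i by (intro c) (auto dest: in_set_takeD)
  moreover have "(\<lambda>r. if r \<in> X (js ! i) then t r else ?u r) =
      (\<lambda>r. if r \<in> \<Union> (X ` set (take (Suc i) js)) then t r else s r)"
    using i by (auto simp: take_Suc_conv_app_nth fun_eq_iff)
  ultimately show "runs (map c js ! i) ?u
      (\<lambda>r. if r \<in> \<Union> (X ` set (take (Suc i) js)) then t r else s r) N"
    using i by simp
qed (use assms in auto)

text \<open>\<open>Ctl\<close> holds the pending tokens, \<open>Vs\<close> the numbers of the values computed so far, \<open>Fr j\<close> the \<open>j\<close>-th
  arguments of the calls in progress and \<open>Cnt\<close> the number of rows of the table. The rows on the right
  of a cursor are in \<open>Sy\<close> (symbols) and \<open>Col j\<close> (columns), those on its left in \<open>Sy2\<close> and \<open>Col2 j\<close>.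
  Pattern matching uses \<open>Pt\<close> (values to be matched) and \<open>Ev x\<close> (the value of \<open>x\<close>), garbage collection \<open>Mk\<close>,
  \<open>Mk2\<close> (marked nodes) and \<open>Hit\<close>. \<open>Mis\<close> receives a letter for every failed comparison, \<open>Flg\<close> keeps a search
  going and \<open>Scr\<close> is scratch space.\<close>

datatype 'v reg = Inp | Outp | Ctl | Vs | Sy | Sy2 | Col nat | Col2 nat | Fr nat | Pt | Ev 'v
  | Mis | Scr | Flg | Cnt | Mk | Mk2 | Hit

abbreviation "stroke \<equiv> Bit True"

text \<open>This is at the same time the encoding of a node name, the binary word of
  \<open>n\<close> ones (lemma \<open>name_string\<close>), so numbers are copied to the output
  unchanged.\<close>

definition num :: "nat \<Rightarrow> 'f letter list" where
  "num n = replicate n stroke @ [Sep]"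

definition ns :: "nat list \<Rightarrow> 'f letter list" where
  "ns xs = concat (map num xs)"

lemma ns_simps [simp]: "ns [] = []" "ns (x # xs) = num x @ ns xs" "ns (xs @ ys) = ns xs @ ns ys"
  by (simp_all add: ns_def)

lemma num_0: "num 0 = [Sep]" and num_Suc: "num (Suc n) = stroke # num n"
  by (simp_all add: num_def)

lemma top_num: "top_of (num n @ xs) = Some (if n = 0 then Sep else stroke)"
  by (cases n) (simp_all add: num_0 num_Suc)

section \<open>Copying, moving, printing and comparing unary numbers\<close>

abbreviation test_top where
  "test_top r a \<equiv> Test r r (\<lambda>x _. x = Some a)"
abbreviation while_top where
  "while_top r a \<equiv> While r r (\<lambda>x _. x = Some a)"
abbreviation test_empty where
  "test_empty r \<equiv> Test r r (\<lambda>x _. x = None)"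
abbreviation while_nonempty where
  "while_nonempty r \<equiv> While r r (\<lambda>x _. x \<noteq> None)"

text \<open>Dominates every macro on a number of size at most \<open>b\<close>; the most expensive
  one is \<open>movetop\<close> with \<open>11 * n + 10\<close>.\<close>

definition unit_cost :: "nat \<Rightarrow> nat" where
  "unit_cost b = 12 * (b + 1)"

text \<open>Moved letter by letter, a number would arrive with \<open>Sep\<close> on top. So its
  strokes are parked on \<open>Scr\<close>, \<open>Sep\<close> is pushed first, and the strokes then
  go back to \<open>r\<close> and onto \<open>q\<close> together.\<close>

definition copytop :: "'v reg \<Rightarrow> 'v reg \<Rightarrow> ('v reg, 'f letter) com" where
  "copytop r q = while_top r stroke (Mov r Scr) ;; Push q Sep ;; while_top Scr stroke (Mov Scr r ;; Push q stroke)"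

definition poptop :: "'v reg \<Rightarrow> ('v reg, 'f letter) com" where
  "poptop r = while_top r stroke (Pop r) ;; Pop r"

definition movetop :: "'v reg \<Rightarrow> 'v reg \<Rightarrow> ('v reg, 'f letter) com" where
  "movetop r q = copytop r q ;; poptop r"

definition emittop :: "'v reg \<Rightarrow> ('v reg, 'f letter) com" where
  "emittop r = while_top r stroke (Out r Outp) ;; Out r Outp"

definition clear :: "'v reg \<Rightarrow> ('v reg, 'f letter) com" where
  "clear r = while_nonempty r (Pop r)"

text \<open>Common strokes are cancelled; the numbers are equal if and only if both tops are
  \<open>Sep\<close> afterwards, and the strokes kept on \<open>Scr\<close> restore both. A mismatch
  is recorded on \<open>Mis\<close> so that several comparisons form a conjunction: all succeeded if
  and only if \<open>Mis\<close> is still empty.\<close>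

definition eqtest :: "'v reg \<Rightarrow> 'v reg \<Rightarrow> ('v reg, 'f letter) com" where
  "eqtest r q =
    While r q (\<lambda>x y. x = Some stroke \<and> y = Some stroke) (Mov r Scr ;; Pop q) ;;
    Test r q (\<lambda>x y. x = Some Sep \<and> y = Some Sep) Skip (Push Mis Sep) ;;
    while_top Scr stroke (Mov Scr r ;; Push q stroke)"

lemma top_rep: "top_of (replicate n stroke @ Sep # xs) = Some (if n = 0 then Sep else stroke)"
  "top_of (replicate n stroke) = (if n = 0 then None else Some stroke)"
  by (cases n; simp)+

lemma rep_split: "i < n \<Longrightarrow> replicate (n - i) x = x # replicate (n - Suc i) x"
  by (metis Suc_diff_Suc replicate_Suc)

lemma runs_mov_push:
  assumes "s r = a # xs" "r \<noteq> r'" "t = (s(r := xs, r' := a # s r'))(q := b # (s(r := xs, r' := a # s r')) q)"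
  shows "runs (Mov r r' ;; Push q b) s t 5"
  by (rule runs_seq[OF runs_mov[where s = s and r = r and q = r', OF assms(1,2) refl order.refl] runs_push[OF assms(3) order.refl]]) simp

lemma runs_mov_pop:
  assumes "s r = a # xs" "r \<noteq> r'" "t = (s(r := xs, r' := a # s r'))(q := tl ((s(r := xs, r' := a # s r')) q))"
  shows "runs (Mov r r' ;; Pop q) s t 4"
  by (rule runs_seq[OF runs_mov[where s = s and r = r and q = r', OF assms(1,2) refl order.refl] runs_pop[OF assms(3) order.refl]]) simp

lemma copytop:
  assumes s: "s r = num n @ xs" "s Scr = []" and ne: "r \<noteq> q" "r \<noteq> Scr" "q \<noteq> Scr"
  shows "runs (copytop r q) s (s(q := num n @ s q)) (9 * n + 6)"
proof -
  let ?s1 = "s(r := Sep # xs, Scr := replicate n stroke)"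
  have 1: "runs (while_top r stroke (Mov r Scr)) s ?s1 (3 * n + 1)"
    by (rule runs_while[where st = "\<lambda>i. s(r := replicate (n - i) stroke @ Sep # xs, Scr := replicate i stroke)"
          and n = n and N = 2])
      (use s ne in \<open>auto simp: top_rep rep_split num_def fun_eq_iff intro!: runs_mov\<close>)
  have 2: "runs (Push q Sep) ?s1 (?s1(q := Sep # s q)) 2"
    using ne by (intro runs_push) auto
  have 3: "runs (while_top Scr stroke (Mov Scr r ;; Push q stroke)) (?s1(q := Sep # s q)) (s(q := num n @ s q)) (6 * n + 1)"
    by (rule runs_while[where st = "\<lambda>i. s(r := replicate i stroke @ Sep # xs, Scr := replicate (n - i) stroke,
          q := replicate i stroke @ Sep # s q)" and n = n and N = 5])
      (use s ne in \<open>auto simp: top_rep rep_split num_def fun_eq_iff intro!: runs_mov_push\<close>)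
  show ?thesis
    unfolding copytop_def by (rule runs_seq[OF 1 runs_seq[OF 2 3 order.refl]]) simp
qed

lemma poptop:
  assumes "s r = num n @ xs"
  shows "runs (poptop r) s (s(r := xs)) (2 * n + 3)"
proof -
  have 1: "runs (while_top r stroke (Pop r)) s (s(r := Sep # xs)) (2 * n + 1)"
    by (rule runs_while[where st = "\<lambda>i. s(r := replicate (n - i) stroke @ Sep # xs)" and n = n and N = 1])
      (use assms in \<open>auto simp: top_rep rep_split num_def fun_eq_iff intro!: runs_pop\<close>)
  have 2: "runs (Pop r) (s(r := Sep # xs)) (s(r := xs)) 1"
    by (intro runs_pop) auto
  show ?thesis
    unfolding poptop_def by (rule runs_seq[OF 1 2]) simp
qed

lemma movetop:
  assumes s: "s r = num n @ xs" "s Scr = []" and ne: "r \<noteq> q" "r \<noteq> Scr" "q \<noteq> Scr"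
  shows "runs (movetop r q) s (s(r := xs, q := num n @ s q)) (11 * n + 10)"
proof -
  let ?s = "s(q := num n @ s q)"
  have 1: "runs (copytop r q) s ?s (9 * n + 6)"
    using s ne by (rule copytop)
  have 2: "runs (poptop r) ?s (?s(r := xs)) (2 * n + 3)"
    using s(1) ne(1) by (intro poptop) simp
  have "?s(r := xs) = s(r := xs, q := num n @ s q)"
    using ne(1) by (simp add: fun_upd_twist)
  then show ?thesis
    unfolding movetop_def using runs_seq[OF 1 2] by simp
qed

lemma emittop:
  assumes "s r = num n @ xs" "r \<noteq> Outp"
  shows "runs (emittop r) s (s(r := xs, Outp := s Outp @ num n)) (2 * n + 3)"
proof -
  have 1: "runs (while_top r stroke (Out r Outp)) s (s(r := Sep # xs, Outp := s Outp @ replicate n stroke)) (2 * n + 1)"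
    by (rule runs_while[where st = "\<lambda>i. s(r := replicate (n - i) stroke @ Sep # xs, Outp := s Outp @ replicate i stroke)"
          and n = n and N = 1])
      (use assms in \<open>auto simp: top_rep rep_split num_def fun_eq_iff replicate_append_same intro!: runs_out\<close>)
  have 2: "runs (Out r Outp) (s(r := Sep # xs, Outp := s Outp @ replicate n stroke))
     (s(r := xs, Outp := s Outp @ num n)) 1"
    using assms(2) by (intro runs_out) (auto simp: num_def)
  show ?thesis
    unfolding emittop_def by (rule runs_seq[OF 1 2]) simp
qed

lemma clear: "runs (clear r) s (s(r := [])) (2 * length (s r) + 1)"
  unfolding clear_def
  by (rule runs_while[where st = "\<lambda>i. s(r := drop i (s r))" and n = "length (s r)" and N = 1])
    (auto simp: fun_eq_iff top_of_def drop_Suc tl_drop[symmetric] split: list.split intro!: runs_pop)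

lemma eqtest:
  assumes s: "s r = num n @ xs" "s q = num k @ ys" "s Scr = []"
    and ne: "r \<noteq> q" "r \<noteq> Scr" "q \<noteq> Scr" "r \<noteq> Mis" "q \<noteq> Mis"
  shows "runs (eqtest r q) s (s(Mis := if n = k then s Mis else Sep # s Mis)) (11 * n + 7)"
proof -
  let ?m = "min n k"
  let ?s1 = "s(r := replicate (n - ?m) stroke @ Sep # xs, q := replicate (k - ?m) stroke @ Sep # ys, Scr := replicate ?m stroke)"
  have 1: "runs (While r q (\<lambda>x y. x = Some stroke \<and> y = Some stroke) (Mov r Scr ;; Pop q)) s ?s1 (5 * ?m + 1)"
    by (rule runs_while[where st = "\<lambda>i. s(r := replicate (n - i) stroke @ Sep # xs,
          q := replicate (k - i) stroke @ Sep # ys, Scr := replicate i stroke)" and n = ?m and N = 4])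
      (use s ne in \<open>auto simp: top_rep rep_split num_def fun_eq_iff intro!: runs_mov_pop\<close>)
  let ?ms = "if n = k then s Mis else Sep # s Mis"
  have 2: "runs (Test r q (\<lambda>x y. x = Some Sep \<and> y = Some Sep) Skip (Push Mis Sep)) ?s1 (?s1(Mis := ?ms)) 3"
    by (rule runs_test[where n = 2])
      (use ne in \<open>auto simp: top_rep fun_eq_iff min_def split: if_splits intro!: runs_skip runs_push\<close>)
  have 3: "runs (while_top Scr stroke (Mov Scr r ;; Push q stroke)) (?s1(Mis := ?ms)) (s(Mis := ?ms)) (6 * ?m + 1)"
    by (rule runs_while[where st = "\<lambda>i. s(r := replicate (n - ?m + i) stroke @ Sep # xs, Scr := replicate (?m - i) stroke,
          q := replicate (k - ?m + i) stroke @ Sep # ys, Mis := ?ms)" and n = ?m and N = 5])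
      (use s ne in \<open>auto simp: top_rep rep_split num_def fun_eq_iff intro!: runs_mov_push\<close>)
  show ?thesis
    unfolding eqtest_def by (rule runs_seq[OF 1 runs_seq[OF 2 3 order.refl]]) simp
qed


section \<open>Tokens\<close>

text \<open>\<open>TApp s\<close> finds its arguments on the value stack with the last one on top, \<open>TRev s\<close> with the first
  one on top: the input is consumed from right to left. \<open>TMemo s\<close> records the result of a call.\<close>

datatype 'f tok = TPush nat | TApp 'f | TRev 'f | TMemo 'f

primrec code :: "('f, nat) trm \<Rightarrow> 'f tok list" where
  "code (Var i) = [TPush i]"
| "code (Fun s us) = concat (map code us) @ [TApp s]"

lemma trm_size_pos: "trm_size t > 0"
  by (cases t) auto

lemma length_le_sizes: "length ts \<le> sum_list (map trm_size ts)"
proof (induction ts)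
  case (Cons t ts)
  then show ?case using trm_size_pos[of t] by simp
qed simp

text \<open>\<open>\<rho> x\<close> is the stack \<open>Ev x\<close> read as a list of numbers, and
  its head is the number bound last.\<close>

definition ren :: "('v \<Rightarrow> nat list) \<Rightarrow> ('f, 'v) trm \<Rightarrow> ('f, nat) trm" where
  "ren \<rho> = map_trm id (\<lambda>x. hd (\<rho> x))"

lemma ren_simps [simp]: "ren \<rho> (Var x) = Var (hd (\<rho> x))" "ren \<rho> (Fun s ts) = Fun s (map (ren \<rho>) ts)"
  by (simp_all add: ren_def)

lemma sum_list_le: "x \<in> set xs \<Longrightarrow> f x \<le> sum_list (map f xs)" for f :: "'a \<Rightarrow> nat"
  by (induction xs) auto

lemma subst_eq_iff: "subst \<sigma> t = subst \<tau> t \<longleftrightarrow> (\<forall>x\<in>vars_trm t. \<sigma> x = \<tau> x)"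
  by (induction t) auto

text \<open>Moving the input word to \<open>Ctl\<close> reverses it. So the arguments come from last
  to first, and each symbol comes after its arguments.\<close>

primrec input_code :: "('f, 'v) trm \<Rightarrow> 'f tok list" where
  "input_code (Var x) = []"
| "input_code (Fun s ts) = concat (rev (map input_code ts)) @ [TRev s]"


section \<open>The table\<close>

text \<open>Besides the program, the locale fixes a numbering \<open>e\<close> of the symbols, a bound \<open>A\<close> on the arities,
  and enumerations \<open>sl\<close>, \<open>rl\<close>, \<open>vl\<close> of the symbols, the rules and the variables.\<close>

locale prog =
  fixes ar :: "'f \<Rightarrow> nat" and D C :: "'f set" and R :: "('f, 'v) rules"
    and e :: "'f \<Rightarrow> nat" and A :: nat and sl :: "'f list" and rl :: "(('f, 'v) trm \<times> ('f, 'v) trm) list"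
    and vl :: "'v list"
  assumes prog: "program ar D C R" and orth: "orthogonal R"
    and e_inj: "inj_on e (D \<union> C)" and ar_le: "\<And>s. s \<in> D \<union> C \<Longrightarrow> ar s \<le> A"
    and sl: "set sl = D \<union> C" "distinct sl" and rl: "set rl = R" "distinct rl"
    and vl: "\<And>l r. (l, r) \<in> R \<Longrightarrow> vars_trm l \<subseteq> set vl" "distinct vl"
begin

text \<open>Columns of a row: its own number, its result, and the arguments padded with zeros to length \<open>A\<close>.\<close>

definition W :: nat where "W = A + 2"

type_synonym 'a row = "'a \<times> nat list"

definition column :: "nat \<Rightarrow> 'f row list \<Rightarrow> 'f letter list" where
  "column j T = ns (map (\<lambda>rw. snd rw ! j) T)"

lemma column_simps [simp]: "column j [] = []" "column j (rw # T) = num (snd rw ! j) @ column j T"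
  by (simp_all add: column_def)

text \<open>An overlay: the table registers are prescribed and all others are taken from
  \<open>s\<close>, so statements about the table need not mention the rest of the state.
  \<open>L\<close> lists the rows on the left with the one next to the cursor first; the whole table
  is \<open>rev L @ T\<close>.\<close>

definition settab :: "'f row list \<Rightarrow> 'f row list \<Rightarrow> ('v reg \<Rightarrow> 'f letter list) \<Rightarrow> 'v reg \<Rightarrow> 'f letter list" where
  "settab L T s r = (case r of
     Sy \<Rightarrow> map (Sym \<circ> fst) T
   | Sy2 \<Rightarrow> map (Sym \<circ> fst) L
   | Col j \<Rightarrow> if j < W then column j T else s r
   | Col2 j \<Rightarrow> if j < W then column j L else s r
   | _ \<Rightarrow> s r)"

lemma settab_simps [simp]:
  "settab L T s Sy = map (Sym \<circ> fst) T" "settab L T s Sy2 = map (Sym \<circ> fst) L"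
  "settab L T s (Col j) = (if j < W then column j T else s (Col j))"
  "settab L T s (Col2 j) = (if j < W then column j L else s (Col2 j))"
  "settab L T s Inp = s Inp" "settab L T s Outp = s Outp" "settab L T s Ctl = s Ctl"
  "settab L T s Vs = s Vs" "settab L T s (Fr j) = s (Fr j)" "settab L T s Pt = s Pt"
  "settab L T s (Ev x) = s (Ev x)" "settab L T s Mis = s Mis" "settab L T s Scr = s Scr"
  "settab L T s Flg = s Flg" "settab L T s Cnt = s Cnt" "settab L T s Mk = s Mk"
  "settab L T s Mk2 = s Mk2" "settab L T s Hit = s Hit"
  by (simp_all add: settab_def)

definition table_reg :: "'v reg \<Rightarrow> bool" where
  "table_reg r = (case r of Sy \<Rightarrow> True | Sy2 \<Rightarrow> True | Col j \<Rightarrow> True | Col2 j \<Rightarrow> True | _ \<Rightarrow> False)"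

lemma table_reg_simps [simp]: "table_reg Sy" "table_reg Sy2" "table_reg (Col j)" "table_reg (Col2 j)"
  "\<not> table_reg Inp" "\<not> table_reg Outp" "\<not> table_reg Ctl" "\<not> table_reg Vs" "\<not> table_reg (Fr j)"
  "\<not> table_reg Pt" "\<not> table_reg (Ev x)" "\<not> table_reg Mis" "\<not> table_reg Scr" "\<not> table_reg Flg"
  "\<not> table_reg Cnt" "\<not> table_reg Mk" "\<not> table_reg Mk2" "\<not> table_reg Hit"
  by (simp_all add: table_reg_def)

lemma settab_upd: "\<not> table_reg r \<Longrightarrow> (settab L T s)(r := x) = settab L T (s(r := x))"
  by (rule ext, rename_tac q, case_tac q) (auto simp: settab_def table_reg_def)

definition row_ok :: "nat \<Rightarrow> 'f row \<Rightarrow> bool" where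
  "row_ok b rw \<longleftrightarrow> length (snd rw) = W \<and> (\<forall>x\<in>set (snd rw). x \<le> b)"

lemma row_ok_nth: "row_ok b rw \<Longrightarrow> j < W \<Longrightarrow> snd rw ! j \<le> b"
  by (auto simp: row_ok_def)

section \<open>Moving the cursor\<close>

definition advance :: "('v reg, 'f letter) com" where
  "advance = seqs (map (\<lambda>j. movetop (Col j) (Col2 j)) [0..<W]) ;; Mov Sy Sy2"

definition retreat :: "('v reg, 'f letter) com" where
  "retreat = seqs (map (\<lambda>j. movetop (Col2 j) (Col j)) [0..<W]) ;; Mov Sy2 Sy"

definition adv_cost :: "nat \<Rightarrow> nat" where
  "adv_cost b = W * Suc (unit_cost b) + 4"

lemma advance:
  assumes "row_ok b rw" "s Scr = []"
  shows "runs advance (settab L (rw # T) s) (settab (rw # L) T s) (adv_cost b)"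
proof -
  let ?s = "settab L (rw # T) s" and ?t = "settab (rw # L) T s"
  let ?m = "(settab (rw # L) T s)(Sy := map (Sym \<circ> fst) (rw # T), Sy2 := map (Sym \<circ> fst) L)"
  have 1: "runs (seqs (map (\<lambda>j. movetop (Col j) (Col2 j)) [0..<W])) ?s ?m (W * Suc (unit_cost b) + 1)"
  proof (rule runs_par[where X = "\<lambda>j. {Col j, Col2 j}" and t = ?t and N = "unit_cost b"])
    fix i u
    assume i: "i \<in> set [0..<W]"
      and u: "\<And>r. r \<in> {Col i, Col2 i} \<or> r \<notin> (\<Union>j\<in>set [0..<W]. {Col j, Col2 j}) \<Longrightarrow> u r = ?s r"
    have "u Scr = []" "u (Col i) = num (snd rw ! i) @ column i T" "u (Col2 i) = column i L"
      using u[of Scr] u[of "Col i"] u[of "Col2 i"] assms(2) i by auto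
    then have "runs (movetop (Col i) (Col2 i)) u
        (u(Col i := column i T, Col2 i := num (snd rw ! i) @ column i L)) (11 * (snd rw ! i) + 10)"
      using movetop[of u "Col i" "snd rw ! i" "column i T" "Col2 i"] by simp
    moreover have "u(Col i := column i T, Col2 i := num (snd rw ! i) @ column i L) =
        (\<lambda>r. if r \<in> {Col i, Col2 i} then ?t r else u r)"
      using i by (auto simp: fun_eq_iff)
    moreover have "11 * (snd rw ! i) + 10 \<le> unit_cost b"
      using row_ok_nth[OF assms(1), of i] i by (simp add: unit_cost_def)
    ultimately show "runs (movetop (Col i) (Col2 i)) u (\<lambda>r. if r \<in> {Col i, Col2 i} then ?t r else u r) (unit_cost b)"
      by (auto intro: runs_mono)
  qed (auto simp: fun_eq_iff settab_def split: reg.split)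
  have 2: "runs (Mov Sy Sy2) ?m ?t 2"
    by (rule runs_mov) (auto simp: fun_eq_iff)
  show ?thesis
    unfolding advance_def by (rule runs_seq[OF 1 2]) (simp add: adv_cost_def)
qed

lemma retreat:
  assumes "row_ok b rw" "s Scr = []"
  shows "runs retreat (settab (rw # L) T s) (settab L (rw # T) s) (adv_cost b)"
proof -
  let ?s = "settab (rw # L) T s" and ?t = "settab L (rw # T) s"
  let ?m = "(settab L (rw # T) s)(Sy := map (Sym \<circ> fst) T, Sy2 := map (Sym \<circ> fst) (rw # L))"
  have 1: "runs (seqs (map (\<lambda>j. movetop (Col2 j) (Col j)) [0..<W])) ?s ?m (W * Suc (unit_cost b) + 1)"
  proof (rule runs_par[where X = "\<lambda>j. {Col j, Col2 j}" and t = ?t and N = "unit_cost b"])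
    fix i u
    assume i: "i \<in> set [0..<W]"
      and u: "\<And>r. r \<in> {Col i, Col2 i} \<or> r \<notin> (\<Union>j\<in>set [0..<W]. {Col j, Col2 j}) \<Longrightarrow> u r = ?s r"
    have "u Scr = []" "u (Col2 i) = num (snd rw ! i) @ column i L" "u (Col i) = column i T"
      using u[of Scr] u[of "Col i"] u[of "Col2 i"] assms(2) i by auto
    then have "runs (movetop (Col2 i) (Col i)) u
        (u(Col2 i := column i L, Col i := num (snd rw ! i) @ column i T)) (11 * (snd rw ! i) + 10)"
      using movetop[of u "Col2 i" "snd rw ! i" "column i L" "Col i"] by simp
    moreover have "u(Col2 i := column i L, Col i := num (snd rw ! i) @ column i T) =
        (\<lambda>r. if r \<in> {Col i, Col2 i} then ?t r else u r)"
      using i by (auto simp: fun_eq_iff)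
    moreover have "11 * (snd rw ! i) + 10 \<le> unit_cost b"
      using row_ok_nth[OF assms(1), of i] i by (simp add: unit_cost_def)
    ultimately show "runs (movetop (Col2 i) (Col i)) u (\<lambda>r. if r \<in> {Col i, Col2 i} then ?t r else u r) (unit_cost b)"
      by (auto intro: runs_mono)
  qed (auto simp: fun_eq_iff settab_def split: reg.split)
  have 2: "runs (Mov Sy2 Sy) ?m ?t 2"
    by (rule runs_mov) (auto simp: fun_eq_iff)
  show ?thesis
    unfolding retreat_def by (rule runs_seq[OF 1 2]) (simp add: adv_cost_def)
qed

definition to_end :: "('v reg, 'f letter) com" where
  "to_end = while_nonempty Sy advance"

definition rewind :: "('v reg, 'f letter) com" where
  "rewind = while_nonempty Sy2 retreat"

lemma to_end:
  assumes "\<forall>rw\<in>set T. row_ok b rw" "s Scr = []"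
  shows "runs to_end (settab L T s) (settab (rev T @ L) [] s) (length T * Suc (adv_cost b) + 1)"
  using assms(1)
proof (induction T arbitrary: L)
  case Nil
  then show ?case by (simp add: to_end_def runs_while_end)
next
  case (Cons rw T)
  have "runs to_end (settab (rw # L) T s) (settab (rev T @ rw # L) [] s) (length T * Suc (adv_cost b) + 1)"
    using Cons by simp
  then have 1: "runs (while_nonempty Sy advance) (settab (rw # L) T s) (settab (rev T @ rw # L) [] s)
    (length T * Suc (adv_cost b) + 1)"
    by (simp add: to_end_def)
  have 2: "runs advance (settab L (rw # T) s) (settab (rw # L) T s) (adv_cost b)"
    using Cons.prems assms(2) by (intro advance) auto
  show ?case
    using runs_while_step[OF _ 2 1] by (simp add: to_end_def)
qed

lemma rewind:
  assumes "\<forall>rw\<in>set L. row_ok b rw" "s Scr = []"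
  shows "runs rewind (settab L T s) (settab [] (rev L @ T) s) (length L * Suc (adv_cost b) + 1)"
  using assms(1)
proof (induction L arbitrary: T)
  case Nil
  then show ?case by (simp add: rewind_def runs_while_end)
next
  case (Cons rw L)
  have "runs rewind (settab L (rw # T) s) (settab [] (rev L @ rw # T) s) (length L * Suc (adv_cost b) + 1)"
    using Cons by simp
  then have 1: "runs (while_nonempty Sy2 retreat) (settab L (rw # T) s) (settab [] (rev L @ rw # T) s)
    (length L * Suc (adv_cost b) + 1)"
    by (simp add: rewind_def)
  have 2: "runs retreat (settab (rw # L) T s) (settab L (rw # T) s) (adv_cost b)"
    using Cons.prems assms(2) by (intro retreat) auto
  show ?case
    using runs_while_step[OF _ 2 1] by (simp add: rewind_def)
qed

section \<open>Linear search for the first row that passes a test\<close>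

definition find_row :: "('v reg, 'f letter) com \<Rightarrow> ('v reg, 'f letter) com" where
  "find_row tst = rewind ;; Push Flg Sep ;;
     while_nonempty Flg (test_empty Sy (Pop Flg)
       (tst ;; test_empty Mis (Pop Flg) (clear Mis ;; advance)))"

text \<open>\<open>k\<close> counts failed comparisons: at most one for the symbol and one for each
  of the \<open>A\<close> argument columns. It determines the cost of emptying \<open>Mis\<close>
  again.\<close>

definition tests :: "nat \<Rightarrow> ('v reg, 'f letter) com \<Rightarrow> ('f row \<Rightarrow> bool) \<Rightarrow> ('v reg \<Rightarrow> 'f letter list) \<Rightarrow> nat \<Rightarrow> bool" where
  "tests b tst Q s N \<longleftrightarrow> (\<forall>L rw T. row_ok b rw \<longrightarrow>
     (\<exists>k \<le> A + 1. (k = 0 \<longleftrightarrow> Q rw) \<and>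
       runs tst (settab L (rw # T) s) (settab L (rw # T) (s(Mis := replicate k Sep))) N))"

definition find_cost :: "nat \<Rightarrow> nat \<Rightarrow> nat" where
  "find_cost b N = (b + 1) * (N + 2 * adv_cost b + 2 * A + 20)"

lemma find_loop:
  assumes ok: "\<forall>rw\<in>set T. row_ok b rw" and t: "tests b tst Q s N"
    and s: "s Scr = []" "s Mis = []" "s Flg = [Sep]"
    and s': "s' = s(Flg := [])"
  shows "runs (while_nonempty Flg (test_empty Sy (Pop Flg)
       (tst ;; test_empty Mis (Pop Flg) (clear Mis ;; advance)))) (settab L T s)
     (settab (rev (takeWhile (\<lambda>rw. \<not> Q rw) T) @ L) (dropWhile (\<lambda>rw. \<not> Q rw) T) s')
     (length T * (N + adv_cost b + 2 * A + 8) + N + 10)"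
  (is "runs ?W _ _ _") using ok
proof (induction T arbitrary: L)
  case Nil
  have 1: "runs (test_empty Sy (Pop Flg) (tst ;; test_empty Mis (Pop Flg) (clear Mis ;; advance)))
    (settab L [] s) (settab L [] s') 2"
    by (rule runs_test[where n = 1]) (use s s' in \<open>auto intro!: runs_pop simp: settab_upd\<close>)
  have "runs ?W (settab L [] s) (settab L [] s') 4"
    by (rule runs_while_step[OF _ 1 runs_while_end[where N = 1]]) (use s s' in auto)
  then show ?case
    by (simp add: runs_mono)
next
  case (Cons rw T)
  have "row_ok b rw" using Cons.prems by simp
  then obtain k where k: "k \<le> A + 1" "k = 0 \<longleftrightarrow> Q rw"
    "runs tst (settab L (rw # T) s) (settab L (rw # T) (s(Mis := replicate k Sep))) N"
    using t unfolding tests_def by blast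
  show ?case
  proof (cases "Q rw")
    case True
    with k have "k = 0" by simp
    then have k': "runs tst (settab L (rw # T) s) (settab L (rw # T) s) N"
      using k(3) s(2) by (simp add: fun_upd_idem)
    have 0: "runs (test_empty Mis (Pop Flg) (clear Mis ;; advance)) (settab L (rw # T) s) (settab L (rw # T) s') 2"
      by (rule runs_test[where n = 1]) (use s s' in \<open>auto intro!: runs_pop simp: settab_upd\<close>)
    have 1: "runs (test_empty Sy (Pop Flg) (tst ;; test_empty Mis (Pop Flg) (clear Mis ;; advance)))
      (settab L (rw # T) s) (settab L (rw # T) s') (N + 4)"
      by (rule runs_test[where n = "N + 3"]) (use runs_seq[OF k' 0] in auto)
    have "runs ?W (settab L (rw # T) s) (settab L (rw # T) s') (N + 6)"
      by (rule runs_while_step[OF _ 1 runs_while_end[where N = 1]]) (use s s' in auto)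
    then show ?thesis
      using True by (auto intro: runs_mono)
  next
    case False
    let ?s = "s(Mis := replicate k Sep)"
    have 0: "runs (clear Mis) (settab L (rw # T) ?s) (settab L (rw # T) s) (2 * k + 1)"
      using clear[of Mis "settab L (rw # T) ?s"] s(2) by (simp add: settab_upd fun_upd_idem)
    have 1: "runs (clear Mis ;; advance) (settab L (rw # T) ?s) (settab (rw # L) T s) (2 * k + 2 + adv_cost b)"
      by (rule runs_seq[OF 0 advance]) (use Cons.prems s in auto)
    have 2: "runs (test_empty Mis (Pop Flg) (clear Mis ;; advance)) (settab L (rw # T) ?s) (settab (rw # L) T s) (2 * k + 3 + adv_cost b)"
      by (rule runs_test[where n = "2 * k + 2 + adv_cost b"])
        (use False k 1 in \<open>auto simp: top_of_def split: list.splits\<close>)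
    have 3: "runs (test_empty Sy (Pop Flg) (tst ;; test_empty Mis (Pop Flg) (clear Mis ;; advance)))
      (settab L (rw # T) s) (settab (rw # L) T s) (N + 2 * k + 5 + adv_cost b)"
      by (rule runs_test[where n = "N + 2 * k + 4 + adv_cost b"]) (use runs_seq[OF k(3) 2] in auto)
    have 4: "runs ?W (settab (rw # L) T s)
     (settab (rev (takeWhile (\<lambda>rw. \<not> Q rw) T) @ rw # L) (dropWhile (\<lambda>rw. \<not> Q rw) T) s')
     (length T * (N + adv_cost b + 2 * A + 8) + N + 10)"
      using Cons by simp
    show ?thesis
      using runs_while_step[OF _ 3 4] s False k(1) by auto
  qed
qed

lemma find_row:
  assumes ok: "\<forall>rw\<in>set L \<union> set T. row_ok b rw" and t: "tests b tst Q (s(Flg := [Sep])) N"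
    and s: "s Scr = []" "s Mis = []" "s Flg = []" and b: "length L + length T \<le> b"
    and T': "T' = rev L @ T"
  shows "runs (find_row tst) (settab L T s)
     (settab (rev (takeWhile (\<lambda>rw. \<not> Q rw) T')) (dropWhile (\<lambda>rw. \<not> Q rw) T') s) (find_cost b N)"
proof -
  have 1: "runs rewind (settab L T s) (settab [] T' s) (b * Suc (adv_cost b) + 1)"
    unfolding T' by (rule runs_mono[OF rewind]) (use ok s b in \<open>auto intro!: add_mono mult_le_mono1\<close>)
  have 2: "runs (Push Flg Sep) (settab [] T' s) (settab [] T' (s(Flg := [Sep]))) 2"
    using s by (intro runs_push) (auto simp: settab_upd)
  have 3: "runs (while_nonempty Flg (test_empty Sy (Pop Flg)
       (tst ;; test_empty Mis (Pop Flg) (clear Mis ;; advance)))) (settab [] T' (s(Flg := [Sep])))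
     (settab (rev (takeWhile (\<lambda>rw. \<not> Q rw) T')) (dropWhile (\<lambda>rw. \<not> Q rw) T') s)
     (b * (N + adv_cost b + 2 * A + 8) + N + 10)"
    by (rule runs_mono[OF find_loop[OF _ t, of T' s "[]", simplified append_Nil2]])
      (use ok s b in \<open>auto simp: T' fun_upd_idem intro!: mult_le_mono1\<close>)
  show ?thesis
    unfolding find_row_def
    by (rule runs_seq[OF 1 runs_seq[OF 2 3 order.refl]]) (simp add: find_cost_def algebra_simps)
qed


section \<open>Frames and appended rows\<close>

definition frame_col :: "nat \<Rightarrow> nat list list \<Rightarrow> 'f letter list" where
  "frame_col j frs = ns (map (\<lambda>fr. fr ! j) frs)"

lemma frame_col_simps [simp]: "frame_col j [] = []" "frame_col j (fr # frs) = num (fr ! j) @ frame_col j frs"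
  by (simp_all add: frame_col_def)

text \<open>The same overlay as \<open>settab\<close>, now for the control part of the interpreter.
  The two are nested, the table outside.\<close>

definition cfg :: "nat \<Rightarrow> 'f letter list \<Rightarrow> nat list \<Rightarrow> nat list list \<Rightarrow> ('v reg \<Rightarrow> 'f letter list) \<Rightarrow> 'v reg \<Rightarrow> 'f letter list" where
  "cfg n ctl vs frs s r = (case r of
     Ctl \<Rightarrow> ctl
   | Vs \<Rightarrow> ns vs
   | Fr j \<Rightarrow> if j < A then frame_col j frs else s r
   | Cnt \<Rightarrow> num n
   | _ \<Rightarrow> s r)"

lemma cfg_simps [simp]:
  "cfg n ctl vs frs s Ctl = ctl" "cfg n ctl vs frs s Vs = ns vs" "cfg n ctl vs frs s Cnt = num n"
  "cfg n ctl vs frs s (Fr j) = (if j < A then frame_col j frs else s (Fr j))"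
  "cfg n ctl vs frs s Sy = s Sy" "cfg n ctl vs frs s Sy2 = s Sy2"
  "cfg n ctl vs frs s (Col j) = s (Col j)" "cfg n ctl vs frs s (Col2 j) = s (Col2 j)"
  "cfg n ctl vs frs s Inp = s Inp" "cfg n ctl vs frs s Outp = s Outp"
  "cfg n ctl vs frs s Pt = s Pt" "cfg n ctl vs frs s (Ev x) = s (Ev x)"
  "cfg n ctl vs frs s Mis = s Mis" "cfg n ctl vs frs s Scr = s Scr" "cfg n ctl vs frs s Flg = s Flg"
  "cfg n ctl vs frs s Mk = s Mk" "cfg n ctl vs frs s Mk2 = s Mk2" "cfg n ctl vs frs s Hit = s Hit"
  by (simp_all add: cfg_def)

definition cfg_reg :: "'v reg \<Rightarrow> bool" where
  "cfg_reg r = (case r of Ctl \<Rightarrow> True | Vs \<Rightarrow> True | Fr j \<Rightarrow> True | Cnt \<Rightarrow> True | _ \<Rightarrow> False)"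

lemma cfg_reg_simps [simp]: "cfg_reg Ctl" "cfg_reg Vs" "cfg_reg (Fr j)" "cfg_reg Cnt"
  "\<not> cfg_reg Sy" "\<not> cfg_reg Sy2" "\<not> cfg_reg (Col j)" "\<not> cfg_reg (Col2 j)"
  "\<not> cfg_reg Inp" "\<not> cfg_reg Outp" "\<not> cfg_reg Pt" "\<not> cfg_reg (Ev x)" "\<not> cfg_reg Mis" "\<not> cfg_reg Scr"
  "\<not> cfg_reg Flg" "\<not> cfg_reg Mk" "\<not> cfg_reg Mk2" "\<not> cfg_reg Hit"
  by (simp_all add: cfg_reg_def)

lemma cfg_upd: "\<not> cfg_reg r \<Longrightarrow> (cfg n ctl vs frs s)(r := x) = cfg n ctl vs frs (s(r := x))"
  by (rule ext, rename_tac q, case_tac q) (auto simp: cfg_def cfg_reg_def)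

lemma cfg_upd_own:
  "(cfg n ctl vs frs s)(Ctl := ctl') = cfg n ctl' vs frs s"
  "(cfg n ctl vs frs s)(Vs := ns vs') = cfg n ctl vs' frs s"
  "(cfg n ctl vs frs s)(Cnt := num n') = cfg n' ctl vs frs s"
  by (rule ext, rename_tac q, case_tac q; simp)+

text \<open>Every frame occupies all stacks \<open>Fr j\<close>, whatever the arity of its symbol,
  so the stacks stay aligned. The padding causes no confusion in look-ups because the symbol is
  compared too and fixes the arity (\<open>pad_inj\<close>).\<close>

definition pad :: "nat list \<Rightarrow> nat list" where
  "pad xs = xs @ replicate (A - length xs) 0"

definition pop_args :: "nat list \<Rightarrow> ('v reg, 'f letter) com" where
  "pop_args js = seqs (map (\<lambda>j. movetop Vs (Fr j)) js)"

definition push_frame :: "nat set \<Rightarrow> (nat \<Rightarrow> nat) \<Rightarrow> ('v reg \<Rightarrow> 'f letter list) \<Rightarrow> 'v reg \<Rightarrow> 'f letter list" where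
  "push_frame S a s r = (case r of Fr j \<Rightarrow> if j \<in> S then num (a j) @ s r else s r | _ \<Rightarrow> s r)"

lemma pop_args:
  assumes "distinct js" "s Vs = ns (map a js @ vs)" "s Scr = []" "\<forall>j\<in>set js. a j \<le> b"
  shows "runs (pop_args js) s (push_frame (set js) a (s(Vs := ns vs))) (length js * Suc (unit_cost b) + 1)"
  using assms
proof (induction js arbitrary: s)
  case Nil
  have "push_frame {} a (s(Vs := ns vs)) = s"
    using Nil by (auto simp: push_frame_def fun_eq_iff split: reg.split)
  then show ?case by (simp add: pop_args_def runs_skip del: fun_upd_apply)
next
  case (Cons j js)
  let ?s = "s(Vs := ns (map a js @ vs), Fr j := num (a j) @ s (Fr j))"
  have "runs (movetop Vs (Fr j)) s ?s (11 * a j + 10)"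
    using Cons.prems by (intro movetop) auto
  then have 1: "runs (movetop Vs (Fr j)) s ?s (unit_cost b)"
    by (rule runs_mono) (use Cons.prems in \<open>auto simp: unit_cost_def\<close>)
  have 2: "runs (pop_args js) ?s (push_frame (set js) a (?s(Vs := ns vs))) (length js * Suc (unit_cost b) + 1)"
    using Cons.prems by (intro Cons.IH) auto
  have 3: "push_frame (set js) a (?s(Vs := ns vs)) = push_frame (set (j # js)) a (s(Vs := ns vs))"
    using Cons.prems(1) by (auto simp: push_frame_def fun_eq_iff split: reg.split)
  show ?case
    using runs_seq[OF 1 2 order.refl] unfolding 3 by (simp add: pop_args_def algebra_simps del: fun_upd_apply)
qed

definition pad_args :: "nat \<Rightarrow> ('v reg, 'f letter) com" where
  "pad_args k = seqs (map (\<lambda>j. Push (Fr j) Sep) [k..<A])"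

lemma pad_args:
  "runs (pad_args k) s (push_frame {k..<A} (\<lambda>_. 0) s) (A * 3 + 1)"
  unfolding pad_args_def
proof (rule runs_par[where X = "\<lambda>j. {Fr j}" and t = "push_frame {k..<A} (\<lambda>_. 0) s" and N = 2])
  fix i u
  assume "i \<in> set [k..<A]" and u: "\<And>r. r \<in> {Fr i} \<or> r \<notin> (\<Union>j\<in>set [k..<A]. {Fr j}) \<Longrightarrow> u r = s r"
  then show "runs (Push (Fr i) Sep) u (\<lambda>r. if r \<in> {Fr i} then push_frame {k..<A} (\<lambda>_. 0) s r else u r) 2"
    using u[of "Fr i"] by (intro runs_push) (auto simp: fun_eq_iff push_frame_def num_0)
qed (auto simp: fun_eq_iff push_frame_def split: reg.split)

lemma push_frame_cfg:
  assumes "length ids \<le> A" "\<And>j. j < length ids \<Longrightarrow> a j = ids ! j"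
  shows "push_frame {length ids..<A} (\<lambda>_. 0) (push_frame {..<length ids} a (settab L T (cfg n ctl vs frs s))) =
    settab L T (cfg n ctl vs (pad ids # frs) s)"
proof
  fix r
  show "push_frame {length ids..<A} (\<lambda>_. 0) (push_frame {..<length ids} a (settab L T (cfg n ctl vs frs s))) r =
    settab L T (cfg n ctl vs (pad ids # frs) s) r"
    using assms by (cases r) (auto simp: push_frame_def pad_def nth_append)
qed

definition enter_cost :: "nat \<Rightarrow> nat" where
  "enter_cost b = A * Suc (unit_cost b) + A * 3 + 3"

text \<open>The order \<open>js\<close> of filling the columns is the only difference between
  \<open>TRev\<close> and \<open>TApp\<close>: the top of the value stack is the first argument for
  one and the last for the other.\<close>

lemma enter:
  assumes js: "distinct js" "set js = {..<length ids}" "map ((!) ids) js = xs"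
    and ids: "length ids \<le> A" "\<forall>x\<in>set ids. x \<le> b" and s: "s Scr = []"
  shows "runs (pop_args js ;; pad_args (length ids)) (settab L T (cfg n ctl (xs @ vs) frs s))
    (settab L T (cfg n ctl vs (pad ids # frs) s)) (enter_cost b)"
proof -
  have "length js = length ids"
    using js distinct_card by fastforce
  have "runs (pop_args js) (settab L T (cfg n ctl (xs @ vs) frs s))
     (push_frame (set js) ((!) ids) ((settab L T (cfg n ctl (xs @ vs) frs s))(Vs := ns vs)))
     (length js * Suc (unit_cost b) + 1)"
    using js ids s by (intro pop_args) auto
  moreover have "(settab L T (cfg n ctl (xs @ vs) frs s))(Vs := ns vs) = settab L T (cfg n ctl vs frs s)"
    by (simp add: settab_upd cfg_upd_own)
  moreover have "length js * Suc (unit_cost b) \<le> A * Suc (unit_cost b)"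
    using \<open>length js = length ids\<close> ids by (intro mult_le_mono1) simp
  ultimately have 1: "runs (pop_args js) (settab L T (cfg n ctl (xs @ vs) frs s))
     (push_frame {..<length ids} ((!) ids) (settab L T (cfg n ctl vs frs s)))
     (A * Suc (unit_cost b) + 1)"
    by (auto simp only: js(2) intro: runs_mono)
  show ?thesis
    using runs_seq[OF 1 pad_args[of "length ids"], of "enter_cost b"] ids
    by (simp add: push_frame_cfg enter_cost_def)
qed

lemma enter_forward:
  assumes "length ids \<le> A" "\<forall>x\<in>set ids. x \<le> b" "s Scr = []" "k = length ids"
  shows "runs (pop_args [0..<k] ;; pad_args k) (settab L T (cfg n ctl (ids @ vs) frs s))
    (settab L T (cfg n ctl vs (pad ids # frs) s)) (enter_cost b)"
  unfolding assms(4) by (rule enter) (use assms in \<open>auto simp: map_nth\<close>)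

lemma enter_backward:
  assumes "length ids \<le> A" "\<forall>x\<in>set ids. x \<le> b" "s Scr = []" "k = length ids"
  shows "runs (pop_args (rev [0..<k]) ;; pad_args k) (settab L T (cfg n ctl (rev ids @ vs) frs s))
    (settab L T (cfg n ctl vs (pad ids # frs) s)) (enter_cost b)"
  unfolding assms(4) by (rule enter) (use assms in \<open>auto simp: map_nth rev_map[symmetric]\<close>)

definition pop_frame :: "('v reg, 'f letter) com" where
  "pop_frame = seqs (map (\<lambda>j. poptop (Fr j)) [0..<A])"

lemma pop_frame:
  assumes "\<forall>x\<in>set fr. x \<le> b" "length fr = A"
  shows "runs pop_frame (settab L T (cfg n ctl vs (fr # frs) s)) (settab L T (cfg n ctl vs frs s)) (A * Suc (unit_cost b) + 1)"
  unfolding pop_frame_def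
proof (rule runs_par[where X = "\<lambda>j. {Fr j}" and t = "settab L T (cfg n ctl vs frs s)" and N = "unit_cost b"])
  fix i u
  assume i: "i \<in> set [0..<A]" and u: "\<And>r. r \<in> {Fr i} \<or> r \<notin> (\<Union>j\<in>set [0..<A]. {Fr j}) \<Longrightarrow>
      u r = settab L T (cfg n ctl vs (fr # frs) s) r"
  have "runs (poptop (Fr i)) u (u(Fr i := frame_col i frs)) (2 * (fr ! i) + 3)"
    using u[of "Fr i"] i by (intro poptop) auto
  moreover have "u(Fr i := frame_col i frs) = (\<lambda>r. if r \<in> {Fr i} then settab L T (cfg n ctl vs frs s) r else u r)"
    using i by (auto simp: fun_eq_iff)
  moreover have "2 * (fr ! i) + 3 \<le> unit_cost b"
    using assms i nth_mem[of i fr] by (fastforce simp: unit_cost_def)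
  ultimately show "runs (poptop (Fr i)) u (\<lambda>r. if r \<in> {Fr i} then settab L T (cfg n ctl vs frs s) r else u r) (unit_cost b)"
    by (auto intro: runs_mono)
qed (auto simp: fun_eq_iff cfg_def settab_def split: reg.split)

definition append_row :: "'f \<Rightarrow> ('v reg, 'f letter) com" where
  "append_row s = copytop Cnt (Col2 0) ;; copytop Vs (Col2 1) ;;
     seqs (map (\<lambda>j. movetop (Fr j) (Col2 (j + 2))) [0..<A]) ;; Push Sy2 (Sym s) ;; Push Cnt stroke"

definition append_cost :: "nat \<Rightarrow> nat" where
  "append_cost b = (A + 2) * Suc (unit_cost b) + 7"

text \<open>With the cursor at the end of the table the newest row is on top of the stacks on the
  left, so appending a row is just pushing.\<close>

lemma append_row:
  assumes s: "s Scr = []" and fr: "length fr = A" "\<forall>x\<in>set fr. x \<le> b" and b: "n \<le> b" "v \<le> b"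
  shows "runs (append_row f) (settab L [] (cfg n ctl (v # vs) (fr # frs) s))
    (settab ((f, n # v # fr) # L) [] (cfg (Suc n) ctl (v # vs) frs s)) (append_cost b)"
proof -
  let ?s = "settab L [] (cfg n ctl (v # vs) (fr # frs) s)"
  let ?s1 = "?s(Col2 0 := num n @ column 0 L)" let ?s2 = "?s1(Col2 1 := num v @ column 1 L)"
  let ?t = "settab ((f, n # v # fr) # L) [] (cfg (Suc n) ctl (v # vs) frs s)"
  let ?s4 = "?t(Cnt := num n)" let ?s3 = "?s4(Sy2 := map (Sym \<circ> fst) L)"
  have W: "0 < W" "1 < W" "\<And>j. j + 2 < W \<longleftrightarrow> j < A" by (auto simp: W_def)
  have "runs (copytop Cnt (Col2 0)) ?s (?s(Col2 0 := num n @ ?s (Col2 0))) (9 * n + 6)"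
    using s by (intro copytop[where xs = "[]"]) auto
  then have 1: "runs (copytop Cnt (Col2 0)) ?s ?s1 (unit_cost b)"
    using b W by (auto simp: unit_cost_def intro: runs_mono)
  have "runs (copytop Vs (Col2 1)) ?s1 (?s1(Col2 1 := num v @ ?s1 (Col2 1))) (9 * v + 6)"
    using s by (intro copytop[where xs = "ns vs"]) auto
  then have 2: "runs (copytop Vs (Col2 1)) ?s1 ?s2 (unit_cost b)"
    using b W by (auto simp: unit_cost_def intro: runs_mono)
  have 3: "runs (seqs (map (\<lambda>j. movetop (Fr j) (Col2 (j + 2))) [0..<A])) ?s2 ?s3 (A * Suc (unit_cost b) + 1)"
  proof (rule runs_par[where X = "\<lambda>j. {Fr j, Col2 (j + 2)}" and t = ?s3 and N = "unit_cost b"])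
    fix i u
    assume i: "i \<in> set [0..<A]" and u: "\<And>r. r \<in> {Fr i, Col2 (i + 2)} \<or>
      r \<notin> (\<Union>j\<in>set [0..<A]. {Fr j, Col2 (j + 2)}) \<Longrightarrow> u r = ?s2 r"
    have "u Scr = []" "u (Fr i) = num (fr ! i) @ frame_col i frs" "u (Col2 (i + 2)) = column (i + 2) L"
      using u[of Scr] u[of "Fr i"] u[of "Col2 (i + 2)"] s i W by auto
    then have "runs (movetop (Fr i) (Col2 (i + 2))) u
        (u(Fr i := frame_col i frs, Col2 (i + 2) := num (fr ! i) @ column (i + 2) L)) (11 * (fr ! i) + 10)"
      using movetop[of u "Fr i" "fr ! i" "frame_col i frs" "Col2 (i + 2)"] by simp
    moreover have "u(Fr i := frame_col i frs, Col2 (i + 2) := num (fr ! i) @ column (i + 2) L) =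
        (\<lambda>r. if r \<in> {Fr i, Col2 (i + 2)} then ?s3 r else u r)"
      using i W by (auto simp: fun_eq_iff)
    moreover have "11 * (fr ! i) + 10 \<le> unit_cost b"
      using fr i nth_mem[of i fr] by (fastforce simp: unit_cost_def)
    ultimately show "runs (movetop (Fr i) (Col2 (i + 2))) u
        (\<lambda>r. if r \<in> {Fr i, Col2 (i + 2)} then ?s3 r else u r) (unit_cost b)"
      by (auto intro: runs_mono)
  next
    have "(\<forall>i\<in>{0..<A}. j \<noteq> Suc (Suc i)) \<longleftrightarrow> j = 0 \<or> j = 1 \<or> \<not> j < W" for j
      by (cases j; cases "j - 1") (auto simp: W_def)
    then show "?s3 = (\<lambda>r. if r \<in> \<Union> ((\<lambda>j. {Fr j, Col2 (j + 2)}) ` set [0..<A]) then ?s3 r else ?s2 r)"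
      using W by (auto simp: fun_eq_iff settab_def cfg_def split: reg.split)
  qed auto
  have 4: "runs (Push Sy2 (Sym f)) ?s3 ?s4 2"
    by (rule runs_push) (auto simp: fun_eq_iff)
  have 5: "runs (Push Cnt stroke) ?s4 ?t 2"
    by (rule runs_push) (auto simp: fun_eq_iff num_Suc)
  show ?thesis
    unfolding append_row_def
    by (rule runs_seq[OF 1 runs_seq[OF 2 runs_seq[OF 3 runs_seq[OF 4 5 order.refl] order.refl] order.refl]])
      (simp add: append_cost_def)
qed

section \<open>The two search criteria: a symbol with its arguments, and a row number\<close>

definition key_test :: "'f \<Rightarrow> ('v reg, 'f letter) com" where
  "key_test s = test_top Sy (Sym s) Skip (Push Mis Sep) ;;
     seqs (map (\<lambda>j. eqtest (Col (j + 2)) (Fr j)) [0..<A])"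

definition key_cost :: "nat \<Rightarrow> nat" where
  "key_cost b = A * Suc (unit_cost b) + 5"

lemma key_test:
  assumes fr: "length fr = A" and s: "s Scr = []" "s Mis = []"
  shows "tests b (key_test f) (\<lambda>rw. fst rw = f \<and> drop 2 (snd rw) = fr) (cfg n ctl vs (fr # frs) s) (key_cost b)"
  unfolding tests_def
proof (intro allI impI)
  fix L T and rw :: "'f row"
  assume ok: "row_ok b rw"
  let ?s = "settab L (rw # T) (cfg n ctl vs (fr # frs) s)"
  define k0 where "k0 = (if fst rw = f then 0 else 1 :: nat)"
  \<comment> \<open>The number of letters on \<open>Mis\<close> after the symbol and the first
    \<open>i\<close> argument columns have been compared.\<close>
  define kk where "kk i = k0 + length (filter (\<lambda>j. snd rw ! (j + 2) \<noteq> fr ! j) [0..<i])" for i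
  have 1: "runs (test_top Sy (Sym f) Skip (Push Mis Sep)) ?s (?s(Mis := replicate k0 Sep)) 3"
    by (rule runs_test[where n = 2])
      (use s in \<open>auto simp: k0_def fun_eq_iff intro!: runs_skip runs_push\<close>)
  have 2: "runs (seqs (map (\<lambda>j. eqtest (Col (j + 2)) (Fr j)) [0..<A])) (?s(Mis := replicate k0 Sep))
      (?s(Mis := replicate (kk A) Sep)) (A * Suc (unit_cost b) + 1)"
  proof (rule runs_seqs[where st = "\<lambda>i. ?s(Mis := replicate (kk i) Sep)" and N = "unit_cost b"])
    fix i assume "i < length (map (\<lambda>j. eqtest (Col (j + 2)) (Fr j)) [0..<A])"
    then have i: "i < A" "i + 2 < W" by (auto simp: W_def)
    let ?u = "?s(Mis := replicate (kk i) Sep)"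
    have "runs (eqtest (Col (i + 2)) (Fr i)) ?u
       (?u(Mis := if snd rw ! (i + 2) = fr ! i then ?u Mis else Sep # ?u Mis)) (11 * (snd rw ! (i + 2)) + 7)"
      by (rule eqtest) (use i s in auto)
    moreover have "?u(Mis := if snd rw ! (i + 2) = fr ! i then ?u Mis else Sep # ?u Mis) = ?s(Mis := replicate (kk (Suc i)) Sep)"
      by (auto simp: kk_def replicate_append_same[symmetric])
    moreover have "11 * (snd rw ! (i + 2)) + 7 \<le> unit_cost b"
      using row_ok_nth[OF ok i(2)] by (simp add: unit_cost_def)
    ultimately show "runs (map (\<lambda>j. eqtest (Col (j + 2)) (Fr j)) [0..<A] ! i) ?u
        (?s(Mis := replicate (kk (Suc i)) Sep)) (unit_cost b)"
      using i by (auto intro: runs_mono)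
  qed (auto simp: kk_def)
  have "length (snd rw) = A + 2" using ok by (simp add: row_ok_def W_def)
  then have "drop 2 (snd rw) = fr \<longleftrightarrow> (\<forall>j<A. snd rw ! (j + 2) = fr ! j)"
    using fr by (auto simp: list_eq_iff_nth_eq add.commute)
  then have "kk A = 0 \<longleftrightarrow> fst rw = f \<and> drop 2 (snd rw) = fr"
    by (auto simp: kk_def k0_def filter_empty_conv)
  moreover have "kk A \<le> A + 1"
    using length_filter_le[of _ "[0..<A]"] by (auto simp: kk_def k0_def intro: le_SucI)
  moreover have "runs (key_test f) ?s (settab L (rw # T) ((cfg n ctl vs (fr # frs) s)(Mis := replicate (kk A) Sep))) (key_cost b)"
    unfolding key_test_def settab_upd[OF table_reg_simps(12), symmetric]
    by (rule runs_seq[OF 1 2]) (simp add: key_cost_def)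
  ultimately show "\<exists>k\<le>A + 1. (k = 0) = (fst rw = f \<and> drop 2 (snd rw) = fr) \<and>
    runs (key_test f) ?s (settab L (rw # T) ((cfg n ctl vs (fr # frs) s)(Mis := replicate k Sep))) (key_cost b)"
    by (intro exI[of _ "kk A"] conjI)
qed

text \<open>Following a pointer is also a search, for the row that contains the given number as its
  own. Column \<open>0\<close> exists for this, and it later supplies the node names.\<close>

definition own_test :: "('v reg, 'f letter) com" where
  "own_test = eqtest (Col 0) Pt"

lemma own_test:
  assumes s: "s Scr = []" "s Mis = []" "s Pt = num i @ ps"
  shows "tests b own_test (\<lambda>rw. snd rw ! 0 = i) s (unit_cost b)"
  unfolding tests_def
proof (intro allI impI)
  fix L T and rw :: "'f row"
  assume ok: "row_ok b rw"
  let ?s = "settab L (rw # T) s" let ?k = "if snd rw ! 0 = i then 0 else 1 :: nat"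
  have W: "0 < W" by (simp add: W_def)
  have "runs own_test ?s (?s(Mis := if snd rw ! 0 = i then ?s Mis else Sep # ?s Mis)) (11 * (snd rw ! 0) + 7)"
    unfolding own_test_def by (rule eqtest) (use s W in auto)
  moreover have "11 * (snd rw ! 0) + 7 \<le> unit_cost b"
    using row_ok_nth[OF ok W] by (simp add: unit_cost_def)
  moreover have "?s(Mis := if snd rw ! 0 = i then ?s Mis else Sep # ?s Mis) = settab L (rw # T) (s(Mis := replicate ?k Sep))"
    using s by (auto simp: settab_upd)
  ultimately have "runs own_test ?s (settab L (rw # T) (s(Mis := replicate ?k Sep))) (unit_cost b)"
    by (auto intro: runs_mono)
  then show "\<exists>k\<le>A + 1. (k = 0) = (snd rw ! 0 = i) \<and>
    runs own_test ?s (settab L (rw # T) (s(Mis := replicate k Sep))) (unit_cost b)"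
    by (intro exI[of _ ?k]) auto
qed


section \<open>Matching\<close>

text \<open>A specification of \<open>match_com\<close> on lists, with \<open>xs\<close> the
  contents of \<open>Pt\<close>. A failing match returns the remaining numbers and bindings too, as
  these are what has to be cleared afterwards. The second equation is a default: the two lists
  always have equal length.\<close>

function pmatch :: "'f row list \<Rightarrow> ('f, 'v) trm list \<Rightarrow> nat list \<Rightarrow> ('v \<Rightarrow> nat list) \<Rightarrow> bool \<times> nat list \<times> ('v \<Rightarrow> nat list)" where
  "pmatch T [] xs \<rho> = (True, xs, \<rho>)"
| "pmatch T (p # ps) [] \<rho> = (False, [], \<rho>)"
| "pmatch T (Var x # ps) (i # xs) \<rho> = pmatch T ps xs (\<rho>(x := i # \<rho> x))"
| "pmatch T (Fun c qs # ps) (i # xs) \<rho> =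
    (if i < length T \<and> fst (T ! i) = c
     then pmatch T (qs @ ps) (map (\<lambda>j. snd (T ! i) ! (j + 2)) [0..<length qs] @ xs) \<rho>
     else (False, i # xs, \<rho>))"
  by pat_completeness auto
termination by (relation "measure (\<lambda>(T, ps, _). sum_list (map trm_size ps))") (auto simp: trm_size_pos)

lemma sub_terms:
  "Fun c qs \<in> terms ar F V \<Longrightarrow> c \<in> F \<and> length qs = ar c \<and> set qs \<subseteq> terms ar F V"
  by (auto elim: terms.cases)

definition rows_ok :: "nat \<Rightarrow> 'f row list \<Rightarrow> bool" where
  "rows_ok b T \<longleftrightarrow> length T \<le> b \<and> (\<forall>rw\<in>set T. row_ok b rw) \<and> (\<forall>i<length T. snd (T ! i) ! 0 = i)"

text \<open>The bounds on the lengths pay for clearing \<open>Pt\<close> and \<open>Ev\<close>, so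
  they have to cover failing matches as well.\<close>

lemma pmatch_bounds:
  assumes "rows_ok b T" "set ps \<subseteq> terms ar C UNIV" "length xs = length ps" "\<forall>i\<in>set xs. i \<le> b"
    "\<forall>x. \<forall>i\<in>set (\<rho> x). i \<le> b" "pmatch T ps xs \<rho> = (ok, xs', \<rho>')"
  shows "(\<forall>i\<in>set xs'. i \<le> b) \<and> (\<forall>x. \<forall>i\<in>set (\<rho>' x). i \<le> b) \<and>
    length xs' \<le> sum_list (map trm_size ps) \<and> (\<forall>x. length (\<rho>' x) \<le> length (\<rho> x) + sum_list (map trm_size ps))"
  using assms
proof (induction T ps xs \<rho> rule: pmatch.induct)
  case (3 T x ps i xs \<rho>)
  note p = "3.prems"
  have IH: "(\<forall>i\<in>set xs'. i \<le> b) \<and> (\<forall>x. \<forall>i\<in>set (\<rho>' x). i \<le> b) \<and>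
    length xs' \<le> sum_list (map trm_size ps) \<and>
    (\<forall>y. length (\<rho>' y) \<le> length ((\<rho>(x := i # \<rho> x)) y) + sum_list (map trm_size ps))"
    by (rule "3.IH"[OF p(1) _ _ _ _ p(6)[unfolded pmatch.simps]]) (use p in auto)
  have "length (\<rho>' y) \<le> length (\<rho> y) + sum_list (map trm_size (Var x # ps))" for y
    using IH[THEN conjunct2, THEN conjunct2, THEN conjunct2, THEN spec, of y] by (simp split: if_splits)
  with IH show ?case by simp
next
  case (4 T c qs ps i xs \<rho>)
  note p = "4.prems"
  show ?case
  proof (cases "i < length T \<and> fst (T ! i) = c")
    case True
    have qs: "length qs \<le> A" "set qs \<subseteq> terms ar C UNIV" using sub_terms p(2) ar_le by fastforce+
    have "row_ok b (T ! i)" using p(1) True by (simp add: rows_ok_def)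
    then have le: "snd (T ! i) ! (j + 2) \<le> b" if "j < length qs" for j
      using row_ok_nth[of b "T ! i" "j + 2"] that qs(1) by (simp add: W_def)
    have "(\<forall>i\<in>set xs'. i \<le> b) \<and> (\<forall>x. \<forall>i\<in>set (\<rho>' x). i \<le> b) \<and>
      length xs' \<le> sum_list (map trm_size (qs @ ps)) \<and>
      (\<forall>y. length (\<rho>' y) \<le> length (\<rho> y) + sum_list (map trm_size (qs @ ps)))"
      by (rule "4.IH"[OF True]) (use p True qs le in auto)
    then show ?thesis by (auto intro: le_SucI)
  next
    case False
    then show ?thesis using p length_le_sizes[of ps] by auto
  qed
qed auto

text \<open>That other variables keep their bindings has two uses: only variables of the left-hand
  side have to be cleared, and in a linear pattern a binding is not overwritten later.\<close>

lemma pmatch_vars: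
  assumes "pmatch T ps xs \<rho> = (ok, xs', \<rho>')" "length xs = length ps"
  shows "(ok \<longrightarrow> xs' = [] \<and> (\<forall>x. \<rho> x \<noteq> [] \<or> x \<in> \<Union> (vars_trm ` set ps) \<longrightarrow> \<rho>' x \<noteq> [])) \<and>
    (\<forall>x. x \<notin> \<Union> (vars_trm ` set ps) \<longrightarrow> \<rho>' x = \<rho> x)"
  using assms
proof (induction T ps xs \<rho> rule: pmatch.induct)
  case (4 T c qs ps i xs \<rho>)
  show ?case
  proof (cases "i < length T \<and> fst (T ! i) = c")
    case True
    have "(ok \<longrightarrow> xs' = [] \<and> (\<forall>x. \<rho> x \<noteq> [] \<or> x \<in> \<Union> (vars_trm ` set (qs @ ps)) \<longrightarrow> \<rho>' x \<noteq> [])) \<and>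
      (\<forall>x. x \<notin> \<Union> (vars_trm ` set (qs @ ps)) \<longrightarrow> \<rho>' x = \<rho> x)"
      by (rule "4.IH"[OF True]) (use "4.prems" True in simp_all)
    then show ?thesis by simp
  next
    case False
    then show ?thesis using "4.prems" by auto
  qed
qed (auto split: if_splits)

text \<open>The command \<open>k\<close> is the success continuation; a failing match falls through to the end and
  leaves \<open>Pt\<close> and \<open>Ev\<close> to be cleared.\<close>

function match_com :: "('f, 'v) trm list \<Rightarrow> ('v reg, 'f letter) com \<Rightarrow> ('v reg, 'f letter) com" where
  "match_com [] k = k"
| "match_com (Var x # ps) k = movetop Pt (Ev x) ;; match_com ps k"
| "match_com (Fun c qs # ps) k = find_row own_test ;; test_top Sy (Sym c)
     (poptop Pt ;; seqs (map (\<lambda>j. copytop (Col (j + 2)) Pt) (rev [0..<length qs])) ;; match_com (qs @ ps) k) Skip"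
  by pat_completeness auto
termination by (relation "measure (\<lambda>(ps, _). sum_list (map trm_size ps))") (auto simp: trm_size_pos)

definition binds :: "nat list \<Rightarrow> ('v \<Rightarrow> nat list) \<Rightarrow> 'v reg \<Rightarrow> 'f letter list" where
  "binds xs \<rho> r = (case r of Pt \<Rightarrow> ns xs | Ev x \<Rightarrow> ns (\<rho> x) | _ \<Rightarrow> [])"

lemma binds_simps [simp]: "binds xs \<rho> Pt = ns xs" "binds xs \<rho> (Ev x) = ns (\<rho> x)"
  "binds xs \<rho> Scr = []" "binds xs \<rho> Mis = []" "binds xs \<rho> Flg = []"
  by (simp_all add: binds_def)

lemma binds_upd: "(binds xs \<rho>)(Pt := ns ys) = binds ys \<rho>"
  "(binds xs \<rho>)(Ev x := ns zs) = binds xs (\<rho>(x := zs))"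
  by (auto simp: binds_def fun_eq_iff split: reg.split)

lemma binds_empty: "binds [] (\<lambda>_. []) = (\<lambda>_. [])"
  by (auto simp: binds_def fun_eq_iff split: reg.split)

lemma copies:
  assumes "\<forall>j\<in>set js. q j \<noteq> p \<and> q j \<noteq> Scr \<and> (\<exists>zs. s (q j) = num (a j) @ zs) \<and> a j \<le> b"
    "s Scr = []" "p \<noteq> Scr" "t = s(p := ns (map a (rev js)) @ s p)"
  shows "runs (seqs (map (\<lambda>j. copytop (q j) p) js)) s t (length js * Suc (unit_cost b) + 1)"
  using assms
proof (induction js arbitrary: s t)
  case Nil
  then show ?case by (simp add: runs_skip)
next
  case (Cons j js)
  let ?s = "s(p := num (a j) @ s p)"
  obtain zs where zs: "s (q j) = num (a j) @ zs" using Cons.prems by auto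
  have "runs (copytop (q j) p) s ?s (9 * a j + 6)"
    using Cons.prems zs by (intro copytop) auto
  then have 1: "runs (copytop (q j) p) s ?s (unit_cost b)"
    by (rule runs_mono) (use Cons.prems in \<open>auto simp: unit_cost_def\<close>)
  have 2: "runs (seqs (map (\<lambda>j. copytop (q j) p) js)) ?s t (length js * Suc (unit_cost b) + 1)"
    using Cons.prems by (intro Cons.IH) auto
  show ?case
    using runs_seq[OF 1 2 order.refl] by (simp add: algebra_simps)
qed

definition match_cost :: "nat \<Rightarrow> nat" where
  "match_cost b = find_cost b (unit_cost b) + (A + 2) * Suc (unit_cost b) + 6"

lemma find_own:
  assumes T: "rows_ok b T" "rev L @ T0 = T" and s: "s Scr = []" "s Mis = []" "s Flg = []" "s Pt = num i @ ps"
  shows "runs (find_row own_test) (settab L T0 s) (settab (rev (take i T)) (drop i T) s) (find_cost b (unit_cost b))"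
proof -
  have "takeWhile (\<lambda>rw. snd rw ! 0 \<noteq> i) T = take i T"
    using T by (intro takeWhile_eq_take_P_nth) (auto simp: rows_ok_def)
  moreover have "dropWhile (\<lambda>rw. snd rw ! 0 \<noteq> i) T = drop i T"
    unfolding dropWhile_eq_drop calculation by (cases "i \<le> length T") auto
  moreover have "runs (find_row own_test) (settab L T0 s) (settab (rev (takeWhile (\<lambda>rw. snd rw ! 0 \<noteq> i) T))
      (dropWhile (\<lambda>rw. snd rw ! 0 \<noteq> i) T) s) (find_cost b (unit_cost b))"
  proof (rule find_row)
    show "tests b own_test (\<lambda>rw. snd rw ! 0 = i) (s(Flg := [Sep])) (unit_cost b)"
      using s by (intro own_test[where ps = ps]) auto
  qed (use T s in \<open>auto simp: rows_ok_def\<close>)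
  ultimately show ?thesis by simp
qed

text \<open>The searches leave the cursor anywhere, so the final split of the table is quantified
  existentially and \<open>k\<close> has to work for every split. The cost \<open>N\<close> counts
  once because \<open>k\<close> occurs once, behind all tests.\<close>

lemma match_com:
  assumes "rows_ok b T" "set ps \<subseteq> terms ar C UNIV" "length xs = length ps" "\<forall>i\<in>set xs. i \<le> b"
    "rev L @ T0 = T" "pmatch T ps xs \<rho> = (ok, xs', \<rho>')"
    and "\<And>L T0. rev L @ T0 = T \<Longrightarrow> ok \<Longrightarrow> runs k (settab L T0 (cfg n ctl vs frs (binds xs' \<rho>')))
      (settab L T0 (cfg n ctl' vs frs (binds xs' \<rho>'))) N"
  shows "\<exists>L' T'. rev L' @ T' = T \<and> runs (match_com ps k) (settab L T0 (cfg n ctl vs frs (binds xs \<rho>)))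
    (settab L' T' (cfg n (if ok then ctl' else ctl) vs frs (binds xs' \<rho>')))
    (sum_list (map trm_size ps) * match_cost b + N)"
  using assms
proof (induction T ps xs \<rho> arbitrary: L T0 rule: pmatch.induct)
  case (1 T xs \<rho>)
  then show ?case by (intro exI[of _ L] exI[of _ T0]) auto
next
  case (2 T p ps \<rho>)
  then show ?case by simp
next
  case (3 T x ps i xs \<rho>)
  note p = "3.prems"
  let ?s = "settab L T0 (cfg n ctl vs frs (binds (i # xs) \<rho>))"
  let ?t = "settab L T0 (cfg n ctl vs frs (binds xs (\<rho>(x := i # \<rho> x))))"
  have "\<exists>L' T'. rev L' @ T' = T \<and> runs (match_com ps k) ?t
    (settab L' T' (cfg n (if ok then ctl' else ctl) vs frs (binds xs' \<rho>')))
    (sum_list (map trm_size ps) * match_cost b + N)"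
    by (rule "3.IH"[OF p(1) _ _ _ p(5) p(6)[unfolded pmatch.simps] p(7)]) (use p(2-4) in auto)
  then obtain L' T' where LT: "rev L' @ T' = T" and 2: "runs (match_com ps k) ?t
    (settab L' T' (cfg n (if ok then ctl' else ctl) vs frs (binds xs' \<rho>')))
    (sum_list (map trm_size ps) * match_cost b + N)"
    by (elim exE conjE)
  have 0: "runs (movetop Pt (Ev x)) ?s (?s(Pt := ns xs, Ev x := num i @ ?s (Ev x))) (11 * i + 10)"
    by (intro movetop) auto
  have "num i @ ?s (Ev x) = ns (i # \<rho> x)" by simp
  then have eq: "?s(Pt := ns xs, Ev x := num i @ ?s (Ev x)) = ?t"
    by (simp only: settab_upd cfg_upd binds_upd table_reg_simps cfg_reg_simps not_False_eq_True)
  have 1: "runs (movetop Pt (Ev x)) ?s ?t (unit_cost b)"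
    by (rule runs_mono[OF 0[unfolded eq]]) (use p(4) in \<open>simp add: unit_cost_def\<close>)
  have "runs (match_com (Var x # ps) k) ?s (settab L' T' (cfg n (if ok then ctl' else ctl) vs frs (binds xs' \<rho>')))
    (sum_list (map trm_size (Var x # ps)) * match_cost b + N)"
    unfolding match_com.simps by (rule runs_seq[OF 1 2]) (simp add: match_cost_def)
  with LT show ?case by (intro exI[of _ L'] exI[of _ T'] conjI)
next
  case (4 T c qs ps i xs \<rho>)
  note p = "4.prems"
  let ?S = "\<lambda>L T0. settab L T0 (cfg n ctl vs frs (binds (i # xs) \<rho>))"
  let ?L = "rev (take i T)" and ?T = "drop i T"
  have 1: "runs (find_row own_test) (?S L T0) (?S ?L ?T) (find_cost b (unit_cost b))"
    by (rule find_own[OF p(1) p(5)]) auto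
  have LT: "rev ?L @ ?T = T" by simp
  show ?case
  proof (cases "i < length T \<and> fst (T ! i) = c")
    case True
    let ?ys = "map (\<lambda>j. snd (T ! i) ! (j + 2)) [0..<length qs]"
    let ?t = "settab ?L ?T (cfg n ctl vs frs (binds xs \<rho>))"
    let ?u = "settab ?L ?T (cfg n ctl vs frs (binds (?ys @ xs) \<rho>))"
    have qs: "length qs \<le> A" "set qs \<subseteq> terms ar C UNIV"
      using sub_terms p(2) ar_le by fastforce+
    have dr: "?T = T ! i # drop (Suc i) T"
      using True by (simp add: Cons_nth_drop_Suc)
    have ok: "row_ok b (T ! i)" using True p(1) by (auto simp: rows_ok_def)
    have le: "snd (T ! i) ! (j + 2) \<le> b" if "j < length qs" for j
      using row_ok_nth[OF ok, of "j + 2"] that qs(1) by (simp add: W_def)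
    have "\<exists>L' T'. rev L' @ T' = T \<and> runs (match_com (qs @ ps) k) ?u
      (settab L' T' (cfg n (if ok then ctl' else ctl) vs frs (binds xs' \<rho>')))
      (sum_list (map trm_size (qs @ ps)) * match_cost b + N)"
      by (rule "4.IH"[OF True p(1) _ _ _ LT _ p(7)]) (use p(2-4,6) qs le True in auto)
    then obtain L' T' where LT': "rev L' @ T' = T" and 4: "runs (match_com (qs @ ps) k) ?u
      (settab L' T' (cfg n (if ok then ctl' else ctl) vs frs (binds xs' \<rho>')))
      (sum_list (map trm_size (qs @ ps)) * match_cost b + N)"
      by (elim exE conjE)
    have 0: "runs (poptop Pt) (?S ?L ?T) ((?S ?L ?T)(Pt := ns xs)) (2 * i + 3)"
      by (intro poptop) simp
    have eq: "(?S ?L ?T)(Pt := ns xs) = ?t"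
      by (simp only: settab_upd cfg_upd binds_upd table_reg_simps cfg_reg_simps not_False_eq_True)
    have 2: "runs (poptop Pt) (?S ?L ?T) ?t (unit_cost b)"
      by (rule runs_mono[OF 0[unfolded eq]]) (use p(4) in \<open>simp add: unit_cost_def\<close>)
    have "ns (map (\<lambda>j. snd (T ! i) ! (j + 2)) (rev (rev [0..<length qs]))) @ ?t Pt = ns (?ys @ xs)"
      by simp
    then have eq: "?u = ?t(Pt := ns (map (\<lambda>j. snd (T ! i) ! (j + 2)) (rev (rev [0..<length qs]))) @ ?t Pt)"
      by (simp only: settab_upd cfg_upd binds_upd table_reg_simps cfg_reg_simps not_False_eq_True)
    have "runs (seqs (map (\<lambda>j. copytop (Col (j + 2)) Pt) (rev [0..<length qs]))) ?t ?u
       (length (rev [0..<length qs]) * Suc (unit_cost b) + 1)"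
      by (rule copies[OF _ _ _ eq]) (use le qs in \<open>auto simp: dr W_def\<close>)
    then have 3: "runs (seqs (map (\<lambda>j. copytop (Col (j + 2)) Pt) (rev [0..<length qs]))) ?t ?u
        (A * Suc (unit_cost b) + 1)"
      by (rule runs_mono) (use qs(1) mult_le_mono1[of "length qs" A "Suc (unit_cost b)"] in simp)
    note 5 = runs_seq[OF 2 runs_seq[OF 3 4 order.refl] order.refl]
    have 6: "runs (test_top Sy (Sym c) (poptop Pt ;; seqs (map (\<lambda>j. copytop (Col (j + 2)) Pt) (rev [0..<length qs])) ;;
        match_com (qs @ ps) k) Skip) (?S ?L ?T) (settab L' T' (cfg n (if ok then ctl' else ctl) vs frs (binds xs' \<rho>')))
       (Suc (Suc (unit_cost b + Suc (A * Suc (unit_cost b) + 1 + (sum_list (map trm_size (qs @ ps)) * match_cost b + N)))))"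
      by (rule runs_test[OF 5 _ order.refl]) (use True in \<open>simp add: dr\<close>)
    have "runs (match_com (Fun c qs # ps) k) (?S L T0) (settab L' T' (cfg n (if ok then ctl' else ctl) vs frs (binds xs' \<rho>')))
      (sum_list (map trm_size (Fun c qs # ps)) * match_cost b + N)"
      unfolding match_com.simps by (rule runs_seq[OF 1 6]) (simp add: match_cost_def algebra_simps)
    with LT' show ?thesis by (intro exI[of _ L'] exI[of _ T'] conjI)
  next
    case False
    then have eq: "ok = False" "xs' = i # xs" "\<rho>' = \<rho>" using p(6) by auto
    have "top_of (map (Sym \<circ> fst) ?T) \<noteq> Some (Sym c)"
      using False by (cases "i < length T") (auto simp: Cons_nth_drop_Suc[symmetric])
    then have 2: "runs (test_top Sy (Sym c) (poptop Pt ;; seqs (map (\<lambda>j. copytop (Col (j + 2)) Pt) (rev [0..<length qs])) ;;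
        match_com (qs @ ps) k) Skip) (?S ?L ?T) (?S ?L ?T) 2"
      by (intro runs_test[where n = 1] runs_skip) auto
    have "runs (match_com (Fun c qs # ps) k) (?S L T0) (?S ?L ?T) (sum_list (map trm_size (Fun c qs # ps)) * match_cost b + N)"
      unfolding match_com.simps by (rule runs_seq[OF 1 2]) (simp add: match_cost_def)
    then show ?thesis
      using LT eq by (intro exI[of _ ?L] exI[of _ ?T]) simp
  qed
qed


section \<open>Rules\<close>

text \<open>\<open>TRev s\<close> is the input letter itself, so the input word already is a
  program. Applications and memo tokens are the even and the odd work letters, which keeps all
  tokens apart as \<open>e\<close> is injective.\<close>

definition letters_of :: "'f tok \<Rightarrow> 'f letter list" where
  "letters_of k = (case k of TPush i \<Rightarrow> num i | TApp s \<Rightarrow> [Aux (2 * e s)] | TRev s \<Rightarrow> [Sym s] | TMemo s \<Rightarrow> [Aux (2 * e s + 1)])"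

definition toks :: "'f tok list \<Rightarrow> 'f letter list" where
  "toks ks = concat (map letters_of ks)"

lemma toks_simps [simp]: "toks [] = []" "toks (TPush i # ks) = num i @ toks ks"
  "toks (TApp s # ks) = Aux (2 * e s) # toks ks" "toks (TRev s # ks) = Sym s # toks ks"
  "toks (TMemo s # ks) = Aux (2 * e s + 1) # toks ks" "toks (ks @ ks') = toks ks @ toks ks'"
  by (simp_all add: toks_def letters_of_def)

text \<open>The code goes onto a stack and is therefore produced from its last token to its
  first.\<close>

primrec push_term :: "('f, 'v) trm \<Rightarrow> ('v reg, 'f letter) com" where
  "push_term (Var x) = copytop (Ev x) Ctl"
| "push_term (Fun s ts) = Push Ctl (Aux (2 * e s)) ;; seqs (rev (map push_term ts))"

definition push_cost :: "nat \<Rightarrow> nat" where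
  "push_cost b = unit_cost b + 6"

lemma push_terms:
  assumes "\<And>t ctl. t \<in> set ts \<Longrightarrow> runs (push_term t) (settab L T (cfg n ctl vs frs (binds xs \<rho>)))
      (settab L T (cfg n (toks (code (ren \<rho> t)) @ ctl) vs frs (binds xs \<rho>))) (trm_size t * push_cost b - 1)"
  shows "runs (seqs (rev (map push_term ts))) (settab L T (cfg n ctl vs frs (binds xs \<rho>)))
      (settab L T (cfg n (toks (concat (map (\<lambda>t. code (ren \<rho> t)) ts)) @ ctl) vs frs (binds xs \<rho>)))
      (sum_list (map trm_size ts) * push_cost b + 1)"
  using assms
proof (induction ts arbitrary: ctl rule: rev_induct)
  case Nil
  then show ?case by (simp add: runs_skip)
next
  case (snoc t ts)
  have 1: "runs (push_term t) (settab L T (cfg n ctl vs frs (binds xs \<rho>)))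
      (settab L T (cfg n (toks (code (ren \<rho> t)) @ ctl) vs frs (binds xs \<rho>))) (trm_size t * push_cost b - 1)"
    using snoc.prems by simp
  have 2: "runs (seqs (rev (map push_term ts))) (settab L T (cfg n (toks (code (ren \<rho> t)) @ ctl) vs frs (binds xs \<rho>)))
      (settab L T (cfg n (toks (concat (map (\<lambda>t. code (ren \<rho> t)) ts)) @ toks (code (ren \<rho> t)) @ ctl) vs frs (binds xs \<rho>)))
      (sum_list (map trm_size ts) * push_cost b + 1)"
    using snoc.prems by (intro snoc.IH) simp
  have "trm_size t * push_cost b > 0"
    using trm_size_pos[of t] by (simp add: push_cost_def)
  \<comment> \<open>The \<open>- 1\<close> in the bound for each subterm pays for the sequencing
    step added by \<open>runs_seq\<close>.\<close>
  then have "Suc (trm_size t * push_cost b - 1 + (sum_list (map trm_size ts) * push_cost b + 1))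
    \<le> sum_list (map trm_size (ts @ [t])) * push_cost b + 1"
    by (simp add: algebra_simps)
  from runs_seq[OF 1 2 this] show ?case by simp
qed

lemma push_term:
  assumes "\<forall>x\<in>vars_trm r. \<rho> x \<noteq> [] \<and> hd (\<rho> x) \<le> b"
  shows "runs (push_term r) (settab L T (cfg n ctl vs frs (binds xs \<rho>)))
      (settab L T (cfg n (toks (code (ren \<rho> r)) @ ctl) vs frs (binds xs \<rho>))) (trm_size r * push_cost b - 1)"
  using assms
proof (induction r arbitrary: ctl)
  case (Var x)
  let ?s = "settab L T (cfg n ctl vs frs (binds xs \<rho>))"
  obtain i zs where i: "\<rho> x = i # zs" "i \<le> b" using Var by (cases "\<rho> x") auto
  have 1: "runs (copytop (Ev x) Ctl) ?s (?s(Ctl := num i @ ?s Ctl)) (9 * i + 6)"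
    by (intro copytop[where xs = "ns zs"]) (use i in auto)
  have eq: "?s(Ctl := num i @ ?s Ctl) = settab L T (cfg n (toks (code (ren \<rho> (Var x))) @ ctl) vs frs (binds xs \<rho>))"
    using i by (simp add: settab_upd cfg_upd_own)
  show ?case
    unfolding push_term.simps
    by (rule runs_mono[OF 1[unfolded eq]]) (use i in \<open>simp add: unit_cost_def push_cost_def\<close>)
next
  case (Fun s ts)
  let ?s = "settab L T (cfg n ctl vs frs (binds xs \<rho>))"
  let ?t = "settab L T (cfg n (Aux (2 * e s) # ctl) vs frs (binds xs \<rho>))"
  have 1: "runs (Push Ctl (Aux (2 * e s))) ?s ?t 2"
    by (intro runs_push) (simp_all add: settab_upd cfg_upd_own)
  have 2: "runs (seqs (rev (map push_term ts))) ?t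
      (settab L T (cfg n (toks (concat (map (\<lambda>t. code (ren \<rho> t)) ts)) @ Aux (2 * e s) # ctl) vs frs (binds xs \<rho>)))
      (sum_list (map trm_size ts) * push_cost b + 1)"
    using Fun by (intro push_terms) auto
  have "Suc (2 + (sum_list (map trm_size ts) * push_cost b + 1)) \<le> trm_size (Fun s ts) * push_cost b - 1"
    by (simp add: push_cost_def)
  from runs_seq[OF 1 2 this] show ?case by (simp add: comp_def)
qed

text \<open>The frame is only copied, as later rules and \<open>TMemo\<close> still need it. The
  final clearing takes place whether or not the match succeeded, so each rule starts with empty
  \<open>Pt\<close> and \<open>Ev\<close>.\<close>

definition try_rule :: "('f, 'v) trm \<times> ('f, 'v) trm \<Rightarrow> ('v reg, 'f letter) com" where
  "try_rule lr = (case lr of (l, r) \<Rightarrow> (case l of Var x \<Rightarrow> Skip | Fun f ps \<Rightarrow>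
     seqs (map (\<lambda>j. copytop (Fr j) Pt) (rev [0..<length ps])) ;;
     match_com ps (push_term r) ;; clear Pt ;; seqs (map (\<lambda>x. clear (Ev x)) vl)))"

definition hits :: "'f row list \<Rightarrow> nat list \<Rightarrow> ('f, 'v) trm \<times> ('f, 'v) trm \<Rightarrow> ('f, nat) trm option" where
  "hits T fr lr = (case lr of (l, r) \<Rightarrow> (case l of Var x \<Rightarrow> None | Fun f ps \<Rightarrow>
     (case pmatch T ps (take (length ps) fr) (\<lambda>_. []) of (ok, xs, \<rho>) \<Rightarrow> if ok then Some (ren \<rho> r) else None)))"

text \<open>Bounds for any rule both its patterns, which determine the time of matching, and its
  right-hand side, which determines the number of tokens that one (Update) adds.\<close>

definition rules_size :: nat where
  "rules_size = sum_list (map (\<lambda>(l, r). trm_size l + trm_size r) rl)"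

lemma rules_size: "(l, r) \<in> R \<Longrightarrow> trm_size l + trm_size r \<le> rules_size"
  using sum_list_le[of "(l, r)" rl "\<lambda>(l, r). trm_size l + trm_size r"] rl by (simp add: rules_size_def)

definition try_cost :: "nat \<Rightarrow> nat" where
  "try_cost b = A * Suc (unit_cost b) + rules_size * match_cost b + rules_size * push_cost b +
     (length vl + 1) * (2 * (rules_size * (b + 1)) + 2) + 5"

lemma length_ns: "\<forall>i\<in>set xs. i \<le> b \<Longrightarrow> length (ns xs) \<le> length xs * (b + 1)"
  by (induction xs) (auto simp: num_def)

lemma rule_shape:
  assumes "(l, r) \<in> R"
  obtains f ps where "l = Fun f ps" "f \<in> D" "length ps = ar f" "set ps \<subseteq> terms ar C UNIV"
    "r \<in> terms ar (D \<union> C) UNIV" "vars_trm r \<subseteq> vars_trm l"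
  using prog assms unfolding program_def by blast

lemma clear_binds:
  assumes "\<forall>x. \<rho> x \<noteq> [] \<longrightarrow> x \<in> set vl" "\<forall>x. length (ns (\<rho> x) :: 'f letter list) \<le> N"
  shows "runs (seqs (map (\<lambda>x. clear (Ev x)) vl)) (settab L T (cfg n ctl vs frs (binds [] \<rho>)))
    (settab L T (cfg n ctl vs frs (\<lambda>_. []))) (length vl * Suc (2 * N + 1) + 1)"
proof (rule runs_par[where X = "\<lambda>x. {Ev x}" and t = "settab L T (cfg n ctl vs frs (\<lambda>_. []))" and N = "2 * N + 1"])
  fix x u
  assume x: "x \<in> set vl" and u: "\<And>r. r \<in> {Ev x} \<or> r \<notin> (\<Union>x\<in>set vl. {Ev x}) \<Longrightarrow>
    u r = settab L T (cfg n ctl vs frs (binds [] \<rho>)) r"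
  have eq: "u(Ev x := []) = (\<lambda>r. if r \<in> {Ev x} then settab L T (cfg n ctl vs frs (\<lambda>_. [])) r else u r)"
    by (auto simp: fun_eq_iff)
  have "length (u (Ev x)) \<le> N" using u[of "Ev x"] assms(2) by simp
  then show "runs (clear (Ev x)) u (\<lambda>r. if r \<in> {Ev x} then settab L T (cfg n ctl vs frs (\<lambda>_. [])) r else u r) (2 * N + 1)"
    using runs_mono[OF clear[of "Ev x" u], of "2 * N + 1"] unfolding eq by simp
next
  have "\<rho> x = []" if "\<forall>y\<in>set vl. x \<noteq> y" for x using assms(1) that by auto
  then show "settab L T (cfg n ctl vs frs (\<lambda>_. [])) = (\<lambda>r. if r \<in> \<Union> ((\<lambda>x. {Ev x}) ` set vl)
      then settab L T (cfg n ctl vs frs (\<lambda>_. [])) r else settab L T (cfg n ctl vs frs (binds [] \<rho>)) r)"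
    by (auto simp: fun_eq_iff settab_def cfg_def binds_def split: reg.split)
qed (use vl in auto)

lemma try_rule:
  assumes T: "rows_ok b T" "rev L @ T0 = T" and lr: "(l, r) \<in> R"
    and fr: "length fr = A" "\<forall>x\<in>set fr. x \<le> b"
    and ctl': "ctl' = (case hits T fr (l, r) of None \<Rightarrow> ctl | Some u \<Rightarrow> toks (code u) @ ctl)"
  shows "\<exists>L' T'. rev L' @ T' = T \<and> runs (try_rule (l, r)) (settab L T0 (cfg n ctl vs (fr # frs) (\<lambda>_. [])))
    (settab L' T' (cfg n ctl' vs (fr # frs) (\<lambda>_. []))) (try_cost b)"
proof -
  obtain f ps where l: "l = Fun f ps" "f \<in> D" "length ps = ar f" "set ps \<subseteq> terms ar C UNIV" "vars_trm r \<subseteq> vars_trm l"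
    using lr by (rule rule_shape)
  have kA: "length ps \<le> A" using l ar_le by simp
  let ?ids = "take (length ps) fr"
  obtain ok xs' \<rho>' where pm: "pmatch T ps ?ids (\<lambda>_. []) = (ok, xs', \<rho>')" by (metis prod_cases3)
  have idlen: "length ?ids = length ps" using kA fr by simp
  have idle: "\<forall>i\<in>set ?ids. i \<le> b" using fr by (auto dest: in_set_takeD)
  define M where "M = sum_list (map trm_size ps)"
  have M: "M + trm_size r + 1 \<le> rules_size" using rules_size[OF lr] by (simp add: l M_def)
  have bd: "\<forall>i\<in>set xs'. i \<le> b" "\<forall>x. \<forall>i\<in>set (\<rho>' x). i \<le> b" "length xs' \<le> M" "\<forall>x. length (\<rho>' x) \<le> M"
    using pmatch_bounds[OF T(1) l(4) idlen idle _ pm] by (auto simp: M_def)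
  have l_vars: "vars_trm l = \<Union> (vars_trm ` set ps)" by (simp add: l(1))
  have vr: "ok \<Longrightarrow> xs' = [] \<and> (\<forall>x\<in>vars_trm r. \<rho>' x \<noteq> [])" "\<forall>x. x \<notin> vars_trm l \<longrightarrow> \<rho>' x = []"
    using pmatch_vars[OF pm idlen] l(5) unfolding l_vars by blast+
  let ?s = "settab L T0 (cfg n ctl vs (fr # frs) (\<lambda>_. []))"
  let ?s1 = "settab L T0 (cfg n ctl vs (fr # frs) (binds ?ids (\<lambda>_. [])))"
  have "map ((!) fr) (rev (rev [0..<length ps])) = ?ids"
    by (rule nth_equalityI) (use kA fr in auto)
  then have eq: "?s1 = ?s(Pt := ns (map ((!) fr) (rev (rev [0..<length ps]))) @ ?s Pt)"
    by (simp add: settab_upd cfg_upd binds_empty[symmetric] binds_upd)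
  have "runs (seqs (map (\<lambda>j. copytop (Fr j) Pt) (rev [0..<length ps]))) ?s ?s1
     (length (rev [0..<length ps]) * Suc (unit_cost b) + 1)"
    by (rule copies[OF _ _ _ eq]) (use fr kA in auto)
  then have 1: "runs (seqs (map (\<lambda>j. copytop (Fr j) Pt) (rev [0..<length ps]))) ?s ?s1 (A * Suc (unit_cost b) + 1)"
    by (rule runs_mono) (use kA mult_le_mono1[of "length ps" A "Suc (unit_cost b)"] in simp)
  have c': "ctl' = (if ok then toks (code (ren \<rho>' r)) @ ctl else ctl)"
    unfolding ctl' hits_def using pm l by simp
  have "\<exists>L' T'. rev L' @ T' = T \<and> runs (match_com ps (push_term r)) ?s1
    (settab L' T' (cfg n (if ok then toks (code (ren \<rho>' r)) @ ctl else ctl) vs (fr # frs) (binds xs' \<rho>')))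
    (sum_list (map trm_size ps) * match_cost b + (trm_size r * push_cost b - 1))"
  proof (rule match_com[OF T(1) l(4) idlen idle T(2) pm])
    fix L T0 assume "rev L @ T0 = T" ok
    then have "\<forall>x\<in>vars_trm r. \<rho>' x \<noteq> [] \<and> hd (\<rho>' x) \<le> b"
      using vr bd(2) hd_in_set by metis
    then show "runs (push_term r) (settab L T0 (cfg n ctl vs (fr # frs) (binds xs' \<rho>')))
      (settab L T0 (cfg n (toks (code (ren \<rho>' r)) @ ctl) vs (fr # frs) (binds xs' \<rho>'))) (trm_size r * push_cost b - 1)"
      by (rule push_term)
  qed
  then obtain L' T' where LT': "rev L' @ T' = T" and 2: "runs (match_com ps (push_term r)) ?s1
    (settab L' T' (cfg n ctl' vs (fr # frs) (binds xs' \<rho>'))) (M * match_cost b + (trm_size r * push_cost b - 1))"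
    unfolding c' M_def by (elim exE conjE)
  let ?u = "settab L' T' (cfg n ctl' vs (fr # frs) (binds xs' \<rho>'))"
  have sz: "length (ns zs :: 'f letter list) \<le> rules_size * (b + 1)" if "\<forall>i\<in>set zs. i \<le> b" "length zs \<le> M" for zs
    using length_ns[OF that(1), where ?'a = 'f] mult_le_mono1[of "length zs" rules_size "b + 1"] that(2) M by linarith
  have eq: "?u(Pt := []) = settab L' T' (cfg n ctl' vs (fr # frs) (binds [] \<rho>'))"
    using binds_upd(1)[of xs' \<rho>' "[]"] by (simp add: settab_upd cfg_upd)
  have 3: "runs (clear Pt) ?u (settab L' T' (cfg n ctl' vs (fr # frs) (binds [] \<rho>'))) (2 * (rules_size * (b + 1)) + 1)"
    by (rule runs_mono[OF clear[of Pt ?u, unfolded eq]]) (use sz[of xs'] bd in simp)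
  have 4: "runs (seqs (map (\<lambda>x. clear (Ev x)) vl)) (settab L' T' (cfg n ctl' vs (fr # frs) (binds [] \<rho>')))
    (settab L' T' (cfg n ctl' vs (fr # frs) (\<lambda>_. []))) (length vl * Suc (2 * (rules_size * (b + 1)) + 1) + 1)"
    by (rule clear_binds) (use vr(2) vl(1)[OF lr] sz bd in auto)
  have "M * match_cost b \<le> rules_size * match_cost b" "trm_size r * push_cost b \<le> rules_size * push_cost b"
    using M by (auto intro!: mult_le_mono1)
  then have le: "M * match_cost b + (trm_size r * push_cost b - 1) \<le> rules_size * match_cost b + rules_size * push_cost b"
    by linarith
  have cost: "try_cost b = A * Suc (unit_cost b) + rules_size * match_cost b + rules_size * push_cost b +
      length vl * Suc (2 * Y + 1) + 2 * Y + 7" if "Y = rules_size * (b + 1)" for Y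
    unfolding try_cost_def that[symmetric] by simp
  have "runs (try_rule (l, r)) ?s (settab L' T' (cfg n ctl' vs (fr # frs) (\<lambda>_. []))) (try_cost b)"
    unfolding try_rule_def l(1) prod.case trm.case
    by (intro runs_seq[OF 1 runs_seq[OF 2 runs_seq[OF 3 4 order.refl] order.refl]])
      (use le cost[OF refl] in linarith)
  with LT' show ?thesis by (intro exI[of _ L'] exI[of _ T'] conjI)
qed

definition rules_for :: "'f \<Rightarrow> (('f, 'v) trm \<times> ('f, 'v) trm) list" where
  "rules_for f = filter (\<lambda>(l, r). \<exists>ps. l = Fun f ps) rl"

definition rules_com :: "'f \<Rightarrow> ('v reg, 'f letter) com" where
  "rules_com f = seqs (map try_rule (rules_for f))"

lemma try_rules:
  assumes T: "rows_ok b T" "rev L @ T0 = T" and rs: "set rs \<subseteq> R"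
    and fr: "length fr = A" "\<forall>x\<in>set fr. x \<le> b"
    and ctl': "ctl' = fold (\<lambda>lr ctl. case hits T fr lr of None \<Rightarrow> ctl | Some u \<Rightarrow> toks (code u) @ ctl) rs ctl"
  shows "\<exists>L' T'. rev L' @ T' = T \<and> runs (seqs (map try_rule rs)) (settab L T0 (cfg n ctl vs (fr # frs) (\<lambda>_. [])))
    (settab L' T' (cfg n ctl' vs (fr # frs) (\<lambda>_. []))) (length rs * Suc (try_cost b) + 1)"
  using T(2) rs ctl'
proof (induction rs arbitrary: L T0 ctl)
  case Nil
  then show ?case by (intro exI[of _ L] exI[of _ T0]) (simp add: runs_skip)
next
  case (Cons lr rs)
  obtain l r where lr: "lr = (l, r)" by fastforce
  let ?c = "case hits T fr (l, r) of None \<Rightarrow> ctl | Some u \<Rightarrow> toks (code u) @ ctl"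
  have "(l, r) \<in> R" using Cons.prems lr by simp
  then obtain L1 T1 where 1: "rev L1 @ T1 = T" "runs (try_rule (l, r)) (settab L T0 (cfg n ctl vs (fr # frs) (\<lambda>_. [])))
    (settab L1 T1 (cfg n ?c vs (fr # frs) (\<lambda>_. []))) (try_cost b)"
    using try_rule[OF T(1) Cons.prems(1) _ fr refl] by meson
  have "\<exists>L' T'. rev L' @ T' = T \<and> runs (seqs (map try_rule rs)) (settab L1 T1 (cfg n ?c vs (fr # frs) (\<lambda>_. [])))
    (settab L' T' (cfg n ctl' vs (fr # frs) (\<lambda>_. []))) (length rs * Suc (try_cost b) + 1)"
    using Cons.prems lr by (intro Cons.IH[OF 1(1)]) auto
  then obtain L2 T2 where 2: "rev L2 @ T2 = T" "runs (seqs (map try_rule rs)) (settab L1 T1 (cfg n ?c vs (fr # frs) (\<lambda>_. [])))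
    (settab L2 T2 (cfg n ctl' vs (fr # frs) (\<lambda>_. []))) (length rs * Suc (try_cost b) + 1)"
    by (elim exE conjE)
  have "runs (seqs (map try_rule (lr # rs))) (settab L T0 (cfg n ctl vs (fr # frs) (\<lambda>_. [])))
    (settab L2 T2 (cfg n ctl' vs (fr # frs) (\<lambda>_. []))) (length (lr # rs) * Suc (try_cost b) + 1)"
    unfolding list.map seqs.simps lr by (rule runs_seq[OF 1(2) 2(2)]) simp
  with 2(1) show ?case by (intro exI[of _ L2] exI[of _ T2] conjI)
qed

text \<open>There is no early exit: all rules for \<open>f\<close> are tried in turn. Orthogonality
  provides \<open>miss\<close>, so exactly one right-hand side is pushed.\<close>

lemma rules_com:
  assumes T: "rows_ok b T" "rev L @ T0 = T" and fr: "length fr = A" "\<forall>x\<in>set fr. x \<le> b"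
    and hit: "(Fun f ps, r) \<in> R" "hits T fr (Fun f ps, r) = Some u"
    and miss: "\<And>qs r'. (Fun f qs, r') \<in> R \<Longrightarrow> (Fun f qs, r') \<noteq> (Fun f ps, r) \<Longrightarrow> hits T fr (Fun f qs, r') = None"
  shows "\<exists>L' T'. rev L' @ T' = T \<and> runs (rules_com f) (settab L T0 (cfg n ctl vs (fr # frs) (\<lambda>_. [])))
    (settab L' T' (cfg n (toks (code u) @ ctl) vs (fr # frs) (\<lambda>_. []))) (length rl * Suc (try_cost b) + 1)"
proof -
  let ?step = "\<lambda>lr ctl. case hits T fr lr of None \<Rightarrow> ctl | Some u \<Rightarrow> toks (code u) @ ctl"
  have none: "fold ?step rs ctl = ctl" if "\<forall>lr\<in>set rs. hits T fr lr = None" for rs ctl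
    using that by (induction rs) auto
  have one: "fold ?step rs ctl = toks (code u) @ ctl" if "lr0 \<in> set rs" "distinct rs" "hits T fr lr0 = Some u"
    "\<forall>lr\<in>set rs. lr \<noteq> lr0 \<longrightarrow> hits T fr lr = None" for rs lr0
    using that
  proof (induction rs)
    case (Cons lr rs)
    show ?case
    proof (cases "lr = lr0")
      case True
      have "\<forall>lr\<in>set rs. hits T fr lr = None" using Cons.prems True by auto
      from none[OF this] show ?thesis using True Cons.prems by simp
    next
      case False
      then show ?thesis using Cons by simp
    qed
  qed simp
  have "\<forall>lr\<in>set (rules_for f). lr \<noteq> (Fun f ps, r) \<longrightarrow> hits T fr lr = None"
  proof (intro ballI impI)
    fix lr assume "lr \<in> set (rules_for f)" and ne: "lr \<noteq> (Fun f ps, r)"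
    then obtain qs r' where "lr = (Fun f qs, r')" "(Fun f qs, r') \<in> R"
      by (auto simp: rules_for_def rl)
    with ne show "hits T fr lr = None" using miss[of qs r'] by simp
  qed
  then have f: "toks (code u) @ ctl = fold ?step (rules_for f) ctl"
    using one[of "(Fun f ps, r)" "rules_for f"] rl hit by (auto simp: rules_for_def)
  have "set (rules_for f) \<subseteq> R" using rl by (auto simp: rules_for_def)
  from try_rules[OF T this fr f, where n = n and vs = vs and frs = frs]
  obtain L' T' where LT': "rev L' @ T' = T" and 1: "runs (rules_com f) (settab L T0 (cfg n ctl vs (fr # frs) (\<lambda>_. [])))
    (settab L' T' (cfg n (toks (code u) @ ctl) vs (fr # frs) (\<lambda>_. []))) (length (rules_for f) * Suc (try_cost b) + 1)"
    unfolding rules_com_def by (elim exE conjE)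
  have "length (rules_for f) * Suc (try_cost b) + 1 \<le> length rl * Suc (try_cost b) + 1"
    unfolding rules_for_def by (intro add_mono mult_le_mono1 length_filter_le) simp
  from runs_mono[OF 1 this] LT' show ?thesis by (intro exI[of _ L'] exI[of _ T'] conjI)
qed


section \<open>The evaluation loop\<close>

text \<open>Rows of constructors and rows of operations share the table, so this is at the same time
  hash consing and the access to the cache.\<close>

definition lookup :: "'f row list \<Rightarrow> 'f \<Rightarrow> nat list \<Rightarrow> nat option" where
  "lookup T s fr = (case dropWhile (\<lambda>rw. \<not> (fst rw = s \<and> drop 2 (snd rw) = fr)) T of
     [] \<Rightarrow> None | rw # _ \<Rightarrow> Some (snd rw ! 1))"

text \<open>\<open>ids\<close> lists the arguments from left to right, \<open>xs\<close> lists them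
  as they lie on the value stack, top first.\<close>

definition enters :: "'f tok \<Rightarrow> 'f \<Rightarrow> nat list \<Rightarrow> nat list \<Rightarrow> bool" where
  "enters k s ids xs \<longleftrightarrow> (k = TRev s \<and> xs = ids) \<or> (k = TApp s \<and> xs = rev ids)"

type_synonym 'a config = "'a tok list \<times> nat list \<times> nat list list \<times> 'a row list"

text \<open>An abstract machine between the semantics and the stack program: one step is one
  execution of \<open>body\<close>. A constructor row has itself as its result, so
  \<open>hit\<close> serves nodes and cached calls alike. The frame of a call stays on
  \<open>frs\<close> until its \<open>TMemo\<close>, which finds the result on top of the value
  stack.\<close>

inductive astep :: "'f config \<Rightarrow> 'f config \<Rightarrow> bool" where
  push: "astep (TPush i # ks, vs, frs, T) (ks, i # vs, frs, T)"
| hit: "\<lbrakk>enters k s ids xs; s \<in> D \<union> C; length ids = ar s; lookup T s (pad ids) = Some v\<rbrakk>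
    \<Longrightarrow> astep (k # ks, xs @ vs, frs, T) (ks, v # vs, frs, T)"
| new: "\<lbrakk>enters k s ids xs; s \<in> C; length ids = ar s; lookup T s (pad ids) = None; n = length T\<rbrakk>
    \<Longrightarrow> astep (k # ks, xs @ vs, frs, T) (ks, n # vs, frs, T @ [(s, n # n # pad ids)])"
| call: "\<lbrakk>enters k s ids xs; s \<in> D; length ids = ar s; lookup T s (pad ids) = None;
      (Fun s ps, r) \<in> R; hits T (pad ids) (Fun s ps, r) = Some u;
      \<forall>qs r'. (Fun s qs, r') \<in> R \<longrightarrow> (Fun s qs, r') \<noteq> (Fun s ps, r) \<longrightarrow> hits T (pad ids) (Fun s qs, r') = None\<rbrakk>
    \<Longrightarrow> astep (k # ks, xs @ vs, frs, T) (code u @ TMemo s # ks, vs, pad ids # frs, T)"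
| memo: "\<lbrakk>s \<in> D; n = length T\<rbrakk>
    \<Longrightarrow> astep (TMemo s # ks, v # vs, fr # frs, T) (ks, v # vs, frs, T @ [(s, n # v # fr)])"

text \<open>The bound \<open>b\<close> is chosen once for a whole run, so that every execution of
  \<open>body\<close> costs at most the same \<open>body_cost b\<close>.\<close>

definition conf_ok :: "nat \<Rightarrow> 'f config \<Rightarrow> bool" where
  "conf_ok b c \<longleftrightarrow> (case c of (ks, vs, frs, T) \<Rightarrow> rows_ok b T \<and> (\<forall>i\<in>set vs. i \<le> b) \<and>
     (\<forall>fr\<in>set frs. length fr = A \<and> (\<forall>i\<in>set fr. i \<le> b)) \<and> (\<forall>i. TPush i \<in> set ks \<longrightarrow> i \<le> b))"

abbreviation state :: "'f letter list \<Rightarrow> nat list \<Rightarrow> nat list list \<Rightarrow> 'f row list \<Rightarrow> 'f row list \<Rightarrow> 'v reg \<Rightarrow> 'f letter list" where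
  "state ctl vs frs L T \<equiv> settab L T (cfg (length L + length T) ctl vs frs (\<lambda>_. []))"

text \<open>A failed search leaves the cursor at the end of the table. This is how the failure is
  recognized, and it is the position that \<open>append_row\<close> needs. For an operation the memo
  token is pushed first, so that it lies below the code of the right-hand side.\<close>

definition app :: "'f \<Rightarrow> ('v reg, 'f letter) com" where
  "app s = find_row (key_test s) ;; test_empty Sy
     (if s \<in> C then copytop Cnt Vs ;; append_row s else Push Ctl (Aux (2 * e s + 1)) ;; rules_com s)
     (copytop (Col 1) Vs ;; pop_frame)"

definition app_cost :: "nat \<Rightarrow> nat" where
  "app_cost b = find_cost b (key_cost b) + unit_cost b + A * Suc (unit_cost b) + append_cost b +
     length rl * Suc (try_cost b) + 10"

lemma find_key:
  assumes T: "rows_ok b T" "rev L @ T0 = T" and fr: "length fr = A"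
  shows "runs (find_row (key_test s)) (settab L T0 (cfg n ctl vs (fr # frs) (\<lambda>_. [])))
    (settab (rev (takeWhile (\<lambda>rw. \<not> (fst rw = s \<and> drop 2 (snd rw) = fr)) T))
       (dropWhile (\<lambda>rw. \<not> (fst rw = s \<and> drop 2 (snd rw) = fr)) T)
       (cfg n ctl vs (fr # frs) (\<lambda>_. []))) (find_cost b (key_cost b))"
proof (rule find_row)
  show "tests b (key_test s) (\<lambda>rw. fst rw = s \<and> drop 2 (snd rw) = fr)
     ((cfg n ctl vs (fr # frs) (\<lambda>_. []))(Flg := [Sep])) (key_cost b)"
    unfolding cfg_upd[OF cfg_reg_simps(15)] by (rule key_test) (use fr in auto)
qed (use T in \<open>auto simp: rows_ok_def\<close>)

lemma app_hit:
  assumes T: "rows_ok b T" "rev L @ T0 = T" and fr: "length fr = A" "\<forall>i\<in>set fr. i \<le> b"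
    and v: "lookup T s fr = Some v"
  shows "\<exists>L' T'. rev L' @ T' = T \<and> runs (app s) (state ctl vs (fr # frs) L T0) (state ctl (v # vs) frs L' T') (app_cost b)"
proof -
  let ?P = "\<lambda>rw. \<not> (fst rw = s \<and> drop 2 (snd rw) = fr)"
  let ?L = "rev (takeWhile ?P T)"
  obtain rw T1 where dw: "dropWhile ?P T = rw # T1" and v': "v = snd rw ! 1"
    using v by (auto simp: lookup_def split: list.splits)
  have LT: "rev ?L @ rw # T1 = T"
    using takeWhile_dropWhile_id[of ?P T] by (simp only: dw rev_rev_ident)
  have n: "length L + length T0 = length T" "length ?L + length (rw # T1) = length T"
    using arg_cong[OF T(2), of length] arg_cong[OF LT, of length] by (simp_all only: length_append length_rev)
  have "rw \<in> set (rev ?L @ rw # T1)" by simp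
  then have "rw \<in> set T" by (simp only: LT)
  then have "row_ok b rw" using T by (simp add: rows_ok_def)
  then have vb: "v \<le> b" using row_ok_nth[of b rw 1] by (simp add: v' W_def)
  let ?s = "settab ?L (rw # T1) (cfg (length T) ctl vs (fr # frs) (\<lambda>_. []))"
  have 1: "runs (find_row (key_test s)) (state ctl vs (fr # frs) L T0) ?s (find_cost b (key_cost b))"
    using find_key[OF T fr(1), of s "length T" ctl vs frs] unfolding dw n .
  have 0: "runs (copytop (Col 1) Vs) ?s (?s(Vs := num v @ ?s Vs)) (9 * v + 6)"
    by (rule copytop) (auto simp: v' W_def)
  have eq: "?s(Vs := num v @ ?s Vs) = settab ?L (rw # T1) (cfg (length T) ctl (v # vs) (fr # frs) (\<lambda>_. []))"
    by (simp add: settab_upd cfg_upd_own(2)[where vs' = "v # vs", simplified])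
  have 2: "runs (copytop (Col 1) Vs) ?s (settab ?L (rw # T1) (cfg (length T) ctl (v # vs) (fr # frs) (\<lambda>_. []))) (unit_cost b)"
    by (rule runs_mono[OF 0[unfolded eq]]) (use vb in \<open>simp add: unit_cost_def\<close>)
  have 3: "runs (test_empty Sy (if s \<in> C then copytop Cnt Vs ;; append_row s else Push Ctl (Aux (2 * e s + 1)) ;; rules_com s)
     (copytop (Col 1) Vs ;; pop_frame)) ?s (settab ?L (rw # T1) (cfg (length T) ctl (v # vs) frs (\<lambda>_. [])))
     (Suc (Suc (unit_cost b + (A * Suc (unit_cost b) + 1))))"
    by (rule runs_test[OF _ runs_seq[OF 2 pop_frame[OF fr(2,1)] order.refl] order.refl]) simp
  have "runs (app s) (state ctl vs (fr # frs) L T0) (state ctl (v # vs) frs ?L (rw # T1)) (app_cost b)"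
    unfolding app_def n by (rule runs_seq[OF 1[unfolded n] 3]) (simp add: app_cost_def)
  with LT show ?thesis by (intro exI[of _ ?L] exI[of _ "rw # T1"] conjI)
qed

lemma app_miss:
  assumes T: "rows_ok b T" "rev L @ T0 = T" and fr: "length fr = A"
    and v: "lookup T s fr = None"
    and k: "runs (if s \<in> C then copytop Cnt Vs ;; append_row s else Push Ctl (Aux (2 * e s + 1)) ;; rules_com s)
      (settab (rev T) [] (cfg (length T) ctl vs (fr # frs) (\<lambda>_. []))) t N"
    and N: "N + find_cost b (key_cost b) + 2 \<le> app_cost b"
  shows "runs (app s) (state ctl vs (fr # frs) L T0) t (app_cost b)"
proof -
  let ?P = "\<lambda>rw. \<not> (fst rw = s \<and> drop 2 (snd rw) = fr)"
  have dw: "dropWhile ?P T = []"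
    using v unfolding lookup_def by (cases "dropWhile ?P T") (simp_all only: list.case option.distinct)
  have tw: "takeWhile ?P T = T"
    using takeWhile_dropWhile_id[of ?P T] by (simp only: dw append_Nil2)
  have n: "length L + length T0 = length T" using T(2) by (metis length_append length_rev)
  have 1: "runs (find_row (key_test s)) (state ctl vs (fr # frs) L T0)
     (settab (rev T) [] (cfg (length T) ctl vs (fr # frs) (\<lambda>_. []))) (find_cost b (key_cost b))"
    using find_key[OF T fr(1), of s "length T" ctl vs frs] unfolding dw tw n .
  have 2: "runs (test_empty Sy (if s \<in> C then copytop Cnt Vs ;; append_row s else Push Ctl (Aux (2 * e s + 1)) ;; rules_com s)
     (copytop (Col 1) Vs ;; pop_frame)) (settab (rev T) [] (cfg (length T) ctl vs (fr # frs) (\<lambda>_. []))) t (Suc N)"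
    by (rule runs_test[OF k _ order.refl]) simp
  show ?thesis
    unfolding app_def by (rule runs_seq[OF 1 2]) (use N in simp)
qed

lemma app_new:
  assumes T: "rows_ok b T" "rev L @ T0 = T" and fr: "length fr = A" "\<forall>i\<in>set fr. i \<le> b"
    and v: "lookup T s fr = None" and s: "s \<in> C"
  shows "runs (app s) (state ctl vs (fr # frs) L T0)
    (state ctl (length T # vs) frs (rev (T @ [(s, length T # length T # fr)])) []) (app_cost b)"
proof (rule app_miss[OF T fr(1) v])
  let ?s = "settab (rev T) [] (cfg (length T) ctl vs (fr # frs) (\<lambda>_. []))"
  let ?t = "settab (rev T) [] (cfg (length T) ctl (length T # vs) (fr # frs) (\<lambda>_. []))"
  have nb: "length T \<le> b" using T by (simp add: rows_ok_def)
  have 0: "runs (copytop Cnt Vs) ?s (?s(Vs := num (length T) @ ?s Vs)) (9 * length T + 6)"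
    by (rule copytop[where xs = "[]"]) auto
  have eq: "?s(Vs := num (length T) @ ?s Vs) = ?t"
    by (simp add: settab_upd cfg_upd_own(2)[where vs' = "length T # vs", simplified])
  have 1: "runs (copytop Cnt Vs) ?s ?t (unit_cost b)"
    by (rule runs_mono[OF 0[unfolded eq]]) (use nb in \<open>simp add: unit_cost_def\<close>)
  have 2: "runs (append_row s) ?t (state ctl (length T # vs) frs (rev (T @ [(s, length T # length T # fr)])) []) (append_cost b)"
    using append_row[where s = "\<lambda>_. []" and fr = fr and n = "length T" and v = "length T" and b = b and f = s
      and ctl = ctl and vs = vs and frs = frs and L = "rev T"] fr nb by simp
  show "runs (if s \<in> C then copytop Cnt Vs ;; append_row s else Push Ctl (Aux (2 * e s + 1)) ;; rules_com s)
      ?s (state ctl (length T # vs) frs (rev (T @ [(s, length T # length T # fr)])) []) (unit_cost b + append_cost b + 1)"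
    unfolding if_P[OF s] by (rule runs_seq[OF 1 2]) simp
qed (simp add: app_cost_def)

lemma app_call:
  assumes T: "rows_ok b T" "rev L @ T0 = T" and fr: "length fr = A" "\<forall>i\<in>set fr. i \<le> b"
    and v: "lookup T s fr = None" and s: "s \<in> D"
    and hit: "(Fun s ps, r) \<in> R" "hits T fr (Fun s ps, r) = Some u"
    and miss: "\<And>qs r'. (Fun s qs, r') \<in> R \<Longrightarrow> (Fun s qs, r') \<noteq> (Fun s ps, r) \<Longrightarrow> hits T fr (Fun s qs, r') = None"
  shows "\<exists>L' T'. rev L' @ T' = T \<and> runs (app s) (state ctl vs (fr # frs) L T0)
    (state (toks (code u) @ Aux (2 * e s + 1) # ctl) vs (fr # frs) L' T') (app_cost b)"
proof -
  have sC: "s \<notin> C" using s prog by (auto simp: program_def)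
  let ?s = "settab (rev T) [] (cfg (length T) ctl vs (fr # frs) (\<lambda>_. []))"
  let ?t = "settab (rev T) [] (cfg (length T) (Aux (2 * e s + 1) # ctl) vs (fr # frs) (\<lambda>_. []))"
  have 1: "runs (Push Ctl (Aux (2 * e s + 1))) ?s ?t 2"
    by (rule runs_push) (simp_all add: settab_upd cfg_upd_own)
  have "rev (rev T) @ [] = T" by simp
  have "\<exists>L' T'. rev L' @ T' = T \<and> runs (rules_com s) ?t
    (settab L' T' (cfg (length T) (toks (code u) @ Aux (2 * e s + 1) # ctl) vs (fr # frs) (\<lambda>_. [])))
    (length rl * Suc (try_cost b) + 1)"
    by (rule rules_com[OF T(1) \<open>rev (rev T) @ [] = T\<close> fr hit]) (rule miss)
  then obtain L' T' where LT': "rev L' @ T' = T" and 2: "runs (rules_com s) ?t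
    (settab L' T' (cfg (length T) (toks (code u) @ Aux (2 * e s + 1) # ctl) vs (fr # frs) (\<lambda>_. [])))
    (length rl * Suc (try_cost b) + 1)" by (elim exE conjE)
  have n: "length L' + length T' = length T" using LT' by (metis length_append length_rev)
  have "runs (app s) (state ctl vs (fr # frs) L T0)
    (state (toks (code u) @ Aux (2 * e s + 1) # ctl) vs (fr # frs) L' T') (app_cost b)"
  proof (rule app_miss[OF T fr(1) v])
    show "runs (if s \<in> C then copytop Cnt Vs ;; append_row s else Push Ctl (Aux (2 * e s + 1)) ;; rules_com s)
      ?s (state (toks (code u) @ Aux (2 * e s + 1) # ctl) vs (fr # frs) L' T') (length rl * Suc (try_cost b) + 4)"
      unfolding if_not_P[OF sC] n by (rule runs_seq[OF 1 2]) simp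
  qed (simp add: app_cost_def)
  with LT' show ?thesis by (intro exI[of _ L'] exI[of _ T'] conjI)
qed

section \<open>One step of the interpreter\<close>

fun act_com :: "'f tok \<Rightarrow> ('v reg, 'f letter) com" where
  "act_com (TRev s) = Pop Ctl ;; (pop_args [0..<ar s] ;; pad_args (ar s)) ;; app s"
| "act_com (TApp s) = Pop Ctl ;; (pop_args (rev [0..<ar s]) ;; pad_args (ar s)) ;; app s"
| "act_com (TMemo s) = Pop Ctl ;; to_end ;; append_row s"
| "act_com (TPush i) = Skip"

primrec dispatch :: "'f list \<Rightarrow> ('v reg, 'f letter) com" where
  "dispatch [] = Skip"
| "dispatch (s # ss) = test_top Ctl (Sym s) (act_com (TRev s)) (test_top Ctl (Aux (2 * e s)) (act_com (TApp s))
    (test_top Ctl (Aux (2 * e s + 1)) (act_com (TMemo s)) (dispatch ss)))"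

text \<open>A pending number is recognized by its unary letters and never reaches
  \<open>dispatch\<close>; the clause of \<open>act_com\<close> for \<open>TPush\<close> is a
  dummy.\<close>

definition body :: "('v reg, 'f letter) com" where
  "body = Test Ctl Ctl (\<lambda>x _. x = Some stroke \<or> x = Some Sep) (movetop Ctl Vs) (dispatch sl)"

definition body_cost :: "nat \<Rightarrow> nat" where
  "body_cost b = unit_cost b + enter_cost b + app_cost b + b * Suc (adv_cost b) + append_cost b + 3 * length sl + 10"

lemma dispatch:
  assumes "k \<in> {TRev s, TApp s, TMemo s}" "s \<in> set ss" "set ss \<subseteq> D \<union> C" "u Ctl = letters_of k @ xs"
    "runs (act_com k) u t N"
  shows "runs (dispatch ss) u t (N + 3 * length ss)"
  using assms(2,3)
proof (induction ss)
  case (Cons s' ss)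
  show ?case
  proof (cases "s' = s")
    case True
    let ?c3 = "test_top Ctl (Aux (2 * e s + 1)) (act_com (TMemo s)) (dispatch ss)"
    let ?c2 = "test_top Ctl (Aux (2 * e s)) (act_com (TApp s)) ?c3"
    have 3: "runs ?c3 u t (N + 1)" if "k = TMemo s"
      by (rule runs_test[where n = N]) (use that assms(4,5) in \<open>simp_all add: letters_of_def del: act_com.simps\<close>)
    have 2: "runs ?c2 u t (N + 2)" if "k = TMemo s \<or> k = TApp s"
    proof (rule runs_test[where n = "N + 1"])
      assume "top_of (u Ctl) = Some (Aux (2 * e s))"
      then have "k = TApp s" using that assms(4) by (auto simp: letters_of_def)
      then show "runs (act_com (TApp s)) u t (N + 1)" using runs_mono[OF assms(5)] by simp
    next
      assume "top_of (u Ctl) \<noteq> Some (Aux (2 * e s))"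
      then have "k = TMemo s" using that assms(4) by (auto simp: letters_of_def)
      then show "runs ?c3 u t (N + 1)" by (rule 3)
    qed simp
    have "runs (dispatch (s # ss)) u t (N + 3)"
      unfolding dispatch.simps
    proof (rule runs_test[where n = "N + 2"])
      assume "top_of (u Ctl) = Some (Sym s)"
      then have "k = TRev s" using assms(1,4) by (auto simp: letters_of_def)
      then show "runs (act_com (TRev s)) u t (N + 2)" using runs_mono[OF assms(5)] by simp
    next
      assume "top_of (u Ctl) \<noteq> Some (Sym s)"
      then have "k = TMemo s \<or> k = TApp s" using assms(1,4) by (auto simp: letters_of_def)
      then show "runs ?c2 u t (N + 2)" by (rule 2)
    qed simp
    then show ?thesis unfolding True by (rule runs_mono) simp
  next
    case False
    then have 1: "runs (dispatch ss) u t (N + 3 * length ss)" using Cons by simp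
    have "e s' \<noteq> e s" using False Cons.prems e_inj by (auto simp: inj_on_def)
    moreover have "2 * e s' \<noteq> 2 * e s + 1" "2 * e s' + 1 \<noteq> 2 * e s" by presburger+
    ultimately have "top_of (u Ctl) \<notin> {Some (Sym s'), Some (Aux (2 * e s')), Some (Aux (2 * e s' + 1))}"
      using assms(1,4) False by (auto simp: letters_of_def)
    then show ?thesis
      unfolding dispatch.simps using 1
      by (intro runs_test[where n = "N + 3 * length ss + 2"] runs_test[where n = "N + 3 * length ss + 1"]
          runs_test[where n = "N + 3 * length ss"]) auto
  qed
qed simp

lemma pad_ok: "length ids \<le> A \<Longrightarrow> \<forall>i\<in>set ids. i \<le> b \<Longrightarrow> length (pad ids) = A \<and> (\<forall>i\<in>set (pad ids). i \<le> b)"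
  by (auto simp: pad_def)

lemma act_enters:
  assumes k: "enters k s ids xs" "length ids = ar s" "s \<in> D \<union> C" and ids: "\<forall>i\<in>set ids. i \<le> b"
    and a: "runs (app s) (state ctl vs (pad ids # frs) L T0) t (app_cost b)"
  shows "runs body (state (letters_of k @ ctl) (xs @ vs) frs L T0) t (body_cost b)"
proof -
  let ?n = "length L + length T0"
  let ?s = "state (letters_of k @ ctl) (xs @ vs) frs L T0"
  have A: "length ids \<le> A" using k ar_le by simp
  obtain l where l: "letters_of k = [l]" "l \<noteq> stroke" "l \<noteq> Sep"
    using k(1) by (auto simp: enters_def letters_of_def)
  have 1: "runs (Pop Ctl) ?s (state ctl (xs @ vs) frs L T0) 1"
    by (rule runs_pop) (simp_all add: settab_upd cfg_upd_own l)
  have "runs (act_com k) ?s t (enter_cost b + app_cost b + 3)"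
  proof (cases "k = TRev s")
    case True
    then have xs: "xs = ids" using k by (simp add: enters_def)
    have 2: "runs (pop_args [0..<ar s] ;; pad_args (ar s)) (state ctl (xs @ vs) frs L T0)
       (state ctl vs (pad ids # frs) L T0) (enter_cost b)"
      unfolding xs by (rule enter_forward) (use A ids k in auto)
    show ?thesis
      unfolding True act_com.simps
      by (rule runs_seq[OF 1[unfolded True] runs_seq[OF 2 a order.refl]]) simp
  next
    case False
    then have xs: "k = TApp s" "xs = rev ids" using k by (auto simp: enters_def)
    have 2: "runs (pop_args (rev [0..<ar s]) ;; pad_args (ar s)) (state ctl (xs @ vs) frs L T0)
       (state ctl vs (pad ids # frs) L T0) (enter_cost b)"
      unfolding xs by (rule enter_backward) (use A ids k in auto)
    show ?thesis
      unfolding xs(1) act_com.simps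
      by (rule runs_seq[OF 1[unfolded xs(1)] runs_seq[OF 2 a order.refl]]) simp
  qed
  then have 3: "runs (dispatch sl) ?s t (enter_cost b + app_cost b + 3 + 3 * length sl)"
    by (intro dispatch[of k s _ _ ctl]) (use k sl in \<open>auto simp: enters_def\<close>)
  show ?thesis
    unfolding body_def by (rule runs_test[OF _ 3]) (use l in \<open>auto simp: body_cost_def\<close>)
qed

lemma rows_ok_snoc:
  assumes "rows_ok b T" "length fr = A" "\<forall>i\<in>set fr. i \<le> b" "v \<le> b" "length T + 1 \<le> b"
  shows "rows_ok b (T @ [(s, length T # v # fr)])"
proof -
  have "row_ok b (s, length T # v # fr)"
    using assms(2-5) by (simp add: row_ok_def W_def)
  moreover have "snd ((T @ [(s, length T # v # fr)]) ! i) ! 0 = i" if "i < length T + 1" for i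
    using assms(1) that by (cases "i < length T") (simp_all add: rows_ok_def nth_append)
  ultimately show ?thesis
    using assms(1,5) unfolding rows_ok_def by simp
qed

lemma lookup_le:
  assumes "rows_ok b T" "lookup T s fr = Some v"
  shows "v \<le> b"
proof -
  let ?T = "dropWhile (\<lambda>rw. \<not> (fst rw = s \<and> drop 2 (snd rw) = fr)) T"
  obtain rw T1 where dw: "?T = rw # T1" and v: "v = snd rw ! 1"
    using assms(2) by (auto simp: lookup_def split: list.splits)
  have "rw \<in> set ?T" by (simp only: dw list.set_intros)
  then have "rw \<in> set T" by (rule set_dropWhileD)
  then have "row_ok b rw" using assms(1) by (simp add: rows_ok_def)
  then show ?thesis using row_ok_nth[of b rw 1] by (simp add: v W_def)
qed

lemma code_push: "TPush i \<in> set (code u) \<Longrightarrow> i \<in> vars_trm u"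
  by (induction u) auto

lemma hits_vars:
  assumes "rows_ok b T" "(l, r) \<in> R" "hits T fr (l, r) = Some u" "length fr = A" "\<forall>i\<in>set fr. i \<le> b" "i \<in> vars_trm u"
  shows "i \<le> b"
proof -
  obtain f ps where l: "l = Fun f ps" "f \<in> D" "length ps = ar f" "set ps \<subseteq> terms ar C UNIV" "vars_trm r \<subseteq> vars_trm l"
    using assms(2) by (rule rule_shape)
  obtain xs \<rho> where pm: "pmatch T ps (take (length ps) fr) (\<lambda>_. []) = (True, xs, \<rho>)" "u = ren \<rho> r"
    using assms(3) by (auto simp: hits_def l(1) split: prod.splits if_splits)
  have len: "length (take (length ps) fr) = length ps" using l ar_le assms(4) by auto
  have "\<forall>i\<in>set (take (length ps) fr). i \<le> b" using assms(5) by (auto dest: in_set_takeD)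
  from pmatch_bounds[OF assms(1) l(4) len this _ pm(1)]
  have 1: "\<forall>x. \<forall>i\<in>set (\<rho> x). i \<le> b" by simp
  obtain x where x: "x \<in> vars_trm r" "i = hd (\<rho> x)"
    using assms(6) by (auto simp: pm(2) ren_def trm.set_map)
  have "x \<in> \<Union> (vars_trm ` set ps)" using x(1) l(5) by (auto simp: l(1))
  with pmatch_vars[OF pm(1) len] have "\<rho> x \<noteq> []" by simp
  then show ?thesis using 1 x(2) by (meson hd_in_set)
qed

lemma astep_mono: "astep (ks, vs, frs, T) (ks', vs', frs', T') \<Longrightarrow> length T \<le> length T'"
  by (erule astep.cases) auto

text \<open>The position of the cursor is not part of a configuration, hence the quantified splits
  of the table before and after the step. The bound on \<open>T'\<close> provides room for the row
  that the step may append.\<close>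

lemma body:
  assumes "astep (ks, vs, frs, T) (ks', vs', frs', T')" "conf_ok b (ks, vs, frs, T)" "length T' \<le> b"
    and L: "rev L @ T0 = T"
  shows "conf_ok b (ks', vs', frs', T') \<and> (\<exists>L' T0'. rev L' @ T0' = T' \<and>
    runs body (state (toks ks) vs frs L T0) (state (toks ks') vs' frs' L' T0') (body_cost b))"
  using assms(1)
proof cases
  case (push i)
  let ?s = "state (toks ks) vs frs L T0"
  have i: "i \<le> b" using assms(2) push by (auto simp: conf_ok_def)
  have 0: "runs (movetop Ctl Vs) ?s (?s(Ctl := toks ks', Vs := num i @ ?s Vs)) (11 * i + 10)"
    by (rule movetop) (auto simp: push)
  have eq: "?s(Ctl := toks ks', Vs := num i @ ?s Vs) = state (toks ks') vs' frs' L T0"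
    using cfg_upd_own(2)[where vs' = "i # vs"] by (simp add: push settab_upd cfg_upd_own(1))
  have 1: "runs (movetop Ctl Vs) ?s (state (toks ks') vs' frs' L T0) (unit_cost b)"
    by (rule runs_mono[OF 0[unfolded eq]]) (use i in \<open>simp add: unit_cost_def\<close>)
  have "runs body ?s (state (toks ks') vs' frs' L T0) (body_cost b)"
    unfolding body_def by (rule runs_test[OF 1]) (auto simp: push top_num body_cost_def split: if_splits)
  then show ?thesis
    using assms(2) push L by (auto simp: conf_ok_def)
next
  case (hit k s ids xs v vs0)
  have ids: "\<forall>i\<in>set ids. i \<le> b" "rows_ok b T"
    using assms(2) hit by (auto simp: conf_ok_def enters_def)
  have A: "length ids \<le> A" using hit ar_le by simp
  obtain L' T0' where LT: "rev L' @ T0' = T" and 1: "runs (app s) (state (toks ks') vs0 (pad ids # frs) L T0)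
    (state (toks ks') (v # vs0) frs L' T0') (app_cost b)"
    using app_hit[OF ids(2) L _ _ hit(9)] pad_ok[OF A ids(1)] by meson
  have "toks ks = letters_of k @ toks ks'" by (simp add: hit toks_def)
  then have "runs body (state (toks ks) vs frs L T0) (state (toks ks') vs' frs' L' T0') (body_cost b)"
    using act_enters[OF hit(6,8,7) ids(1) 1] by (simp add: hit)
  moreover have "conf_ok b (ks', vs', frs', T')"
    using assms(2) hit lookup_le[OF ids(2) hit(9)] by (auto simp: conf_ok_def)
  ultimately show ?thesis using LT hit by auto
next
  case (new k s ids xs n vs0)
  have ids: "\<forall>i\<in>set ids. i \<le> b" "rows_ok b T"
    using assms(2) new by (auto simp: conf_ok_def enters_def)
  have A: "length ids \<le> A" using new ar_le by simp
  have s: "s \<in> D \<union> C" using new by simp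
  note p = pad_ok[OF A ids(1)]
  have 1: "runs (app s) (state (toks ks') vs0 (pad ids # frs) L T0) (state (toks ks') vs' frs' (rev T') []) (app_cost b)"
    using app_new[OF ids(2) L _ _ _ new(7), of "pad ids" "toks ks'" vs0 frs] p new by simp
  have "toks ks = letters_of k @ toks ks'" by (simp add: new toks_def)
  then have "runs body (state (toks ks) vs frs L T0) (state (toks ks') vs' frs' (rev T') []) (body_cost b)"
    using act_enters[OF new(6,8) s ids(1) 1] by (simp add: new)
  moreover have "conf_ok b (ks', vs', frs', T')"
    using assms(2,3) new rows_ok_snoc[OF ids(2), of "pad ids" "length T" s] p by (auto simp: conf_ok_def)
  ultimately show ?thesis by (metis append_Nil2 rev_rev_ident)
next
  case (call k s ids xs ps r u ks0)
  have ids: "\<forall>i\<in>set ids. i \<le> b" "rows_ok b T"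
    using assms(2) call by (auto simp: conf_ok_def enters_def)
  have A: "length ids \<le> A" using call ar_le by simp
  have s: "s \<in> D \<union> C" using call by simp
  note p = pad_ok[OF A ids(1)]
  have "\<exists>L' T0'. rev L' @ T0' = T \<and> runs (app s) (state (toks ks0) vs' (pad ids # frs) L T0)
    (state (toks (code u) @ Aux (2 * e s + 1) # toks ks0) vs' (pad ids # frs) L' T0') (app_cost b)"
    using p call by (intro app_call[OF ids(2) L]) auto
  then obtain L' T0' where LT: "rev L' @ T0' = T" and 1: "runs (app s) (state (toks ks0) vs' (pad ids # frs) L T0)
    (state (toks (code u) @ Aux (2 * e s + 1) # toks ks0) vs' (pad ids # frs) L' T0') (app_cost b)"
    by (elim exE conjE)
  have "toks ks = letters_of k @ toks ks0" by (simp add: call toks_def)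
  then have "runs body (state (toks ks) vs frs L T0) (state (toks ks') vs' frs' L' T0') (body_cost b)"
    using act_enters[OF call(6,8) s ids(1) 1] by (simp add: call)
  moreover have "\<forall>i. TPush i \<in> set (code u) \<longrightarrow> i \<le> b"
    using hits_vars[OF ids(2) call(10,11)] p code_push by blast
  then have "conf_ok b (ks', vs', frs', T')"
    using assms(2) call p by (auto simp: conf_ok_def)
  ultimately show ?thesis using LT call by auto
next
  case (memo s n v vs0 fr)
  have fr: "length fr = A" "\<forall>i\<in>set fr. i \<le> b" "v \<le> b" "rows_ok b T"
    using assms(2) memo by (auto simp: conf_ok_def)
  let ?s = "state (toks ks) vs frs L T0"
  have nL: "length L + length T0 = length T" using L by (metis length_append length_rev)
  have 1: "runs (Pop Ctl) ?s (state (toks ks') vs frs L T0) 1"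
    by (rule runs_pop) (simp_all add: settab_upd cfg_upd_own memo)
  have to_end: "runs to_end (state (toks ks') vs frs L T0) (settab (rev T0 @ L) [] (cfg (length T) (toks ks') vs frs (\<lambda>_. [])))
    (length T0 * Suc (adv_cost b) + 1)"
    unfolding nL by (rule to_end) (use fr(4) L in \<open>auto simp: rows_ok_def\<close>)
  have eq: "rev T0 @ L = rev T" using L by auto
  have "length T0 * Suc (adv_cost b) + 1 \<le> b * Suc (adv_cost b) + 1"
    using nL fr(4) mult_le_mono1[of "length T0" b "Suc (adv_cost b)"] by (simp add: rows_ok_def)
  from runs_mono[OF to_end[unfolded eq] this] have 2: "runs to_end (state (toks ks') vs frs L T0) (settab (rev T) [] (cfg (length T) (toks ks') vs frs (\<lambda>_. [])))
    (b * Suc (adv_cost b) + 1)" .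
  have 3: "runs (append_row s) (settab (rev T) [] (cfg (length T) (toks ks') vs frs (\<lambda>_. [])))
    (state (toks ks') vs' frs' (rev T') []) (append_cost b)"
    using append_row[where s = "\<lambda>_. []" and fr = fr and n = "length T" and v = v and b = b and f = s
      and ctl = "toks ks'" and vs = vs0 and frs = frs' and L = "rev T"] fr by (simp add: memo rows_ok_def)
  have 4: "runs (act_com (TMemo s)) ?s (state (toks ks') vs' frs' (rev T') []) (b * Suc (adv_cost b) + append_cost b + 4)"
    unfolding act_com.simps by (rule runs_seq[OF 1 runs_seq[OF 2 3 order.refl]]) simp
  have 5: "runs (dispatch sl) ?s (state (toks ks') vs' frs' (rev T') []) (b * Suc (adv_cost b) + append_cost b + 4 + 3 * length sl)"
    by (rule dispatch[OF _ _ _ _ 4]) (use memo sl in \<open>auto simp: letters_of_def\<close>)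
  have "runs body ?s (state (toks ks') vs' frs' (rev T') []) (body_cost b)"
    unfolding body_def by (rule runs_test[OF _ 5]) (auto simp: memo body_cost_def)
  moreover have "conf_ok b (ks', vs', frs', T')"
    using assms(2,3) memo rows_ok_snoc[OF fr(4,1,2,3)] by (auto simp: conf_ok_def)
  ultimately show ?thesis by (metis append_Nil2 rev_rev_ident)
qed

lemma loop:
  assumes "(astep ^^ k) (ks, vs, frs, T) ([], vs', frs', T')" "conf_ok b (ks, vs, frs, T)" "length T' \<le> b"
    and L: "rev L @ T0 = T"
  shows "conf_ok b ([], vs', frs', T') \<and> (\<exists>L' T0'. rev L' @ T0' = T' \<and>
    runs (while_nonempty Ctl body) (state (toks ks) vs frs L T0) (state [] vs' frs' L' T0') (k * Suc (body_cost b) + 1))"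
  using assms
proof (induction k arbitrary: ks vs frs T L T0)
  case 0
  then show ?case by (intro conjI exI[of _ L] exI[of _ T0]) (simp_all add: runs_while_end)
next
  case (Suc k)
  obtain ks1 vs1 frs1 T1 where 1: "astep (ks, vs, frs, T) (ks1, vs1, frs1, T1)"
    "(astep ^^ k) (ks1, vs1, frs1, T1) ([], vs', frs', T')"
    using Suc.prems(1) by (metis prod_cases4 relpowp_Suc_D2)
  \<comment> \<open>The table only grows, so the bound on the final table covers all intermediate
    ones.\<close>
  have mono: "length T1 \<le> length T'" if "(astep ^^ k) (ks1, vs1, frs1, T1) (ks', vs', frs', T')"
    for k ks1 vs1 frs1 T1 ks' using that
  proof (induction k arbitrary: ks1 vs1 frs1 T1)
    case (Suc k)
    then obtain ks2 vs2 frs2 T2 where "astep (ks1, vs1, frs1, T1) (ks2, vs2, frs2, T2)"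
      "(astep ^^ k) (ks2, vs2, frs2, T2) (ks', vs', frs', T')"
      by (metis prod_cases4 relpowp_Suc_D2)
    with Suc.IH astep_mono show ?case by (meson order_trans)
  qed simp
  have "length T1 \<le> b" using mono[OF 1(2)] Suc.prems(3) by simp
  from body[OF 1(1) Suc.prems(2) this Suc.prems(4)]
  obtain L1 T2 where 2: "conf_ok b (ks1, vs1, frs1, T1)" "rev L1 @ T2 = T1"
    and 3: "runs body (state (toks ks) vs frs L T0) (state (toks ks1) vs1 frs1 L1 T2) (body_cost b)"
    by (elim exE conjE)
  from Suc.IH[OF 1(2) 2(1) Suc.prems(3) 2(2)]
  obtain L' T0' where 4: "conf_ok b ([], vs', frs', T')" "rev L' @ T0' = T'"
    and 5: "runs (while_nonempty Ctl body) (state (toks ks1) vs1 frs1 L1 T2) (state [] vs' frs' L' T0') (k * Suc (body_cost b) + 1)"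
    by (elim exE conjE)
  have "toks ks \<noteq> []"
    using 1(1) by (cases rule: astep.cases) (auto simp: enters_def num_def)
  then have "top_of (toks ks) \<noteq> None" by (cases "toks ks") auto
  then have "runs (while_nonempty Ctl body) (state (toks ks) vs frs L T0) (state [] vs' frs' L' T0') (Suc k * Suc (body_cost b) + 1)"
    by (intro runs_while_step[OF _ 3 5]) auto
  with 4 show ?case by blast
qed


section \<open>Garbage collection and output\<close>

definition gst :: "nat \<Rightarrow> nat list \<Rightarrow> nat list \<Rightarrow> nat \<Rightarrow> 'f letter list \<Rightarrow> 'v reg \<Rightarrow> 'f letter list" where
  "gst n ms ms2 h w r = (case r of Mk \<Rightarrow> ns ms | Mk2 \<Rightarrow> ns ms2 | Hit \<Rightarrow> replicate h Sep | Outp \<Rightarrow> w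
     | Cnt \<Rightarrow> num n | _ \<Rightarrow> [])"

lemma gst_simps [simp]:
  "gst n ms ms2 h w Mk = ns ms" "gst n ms ms2 h w Mk2 = ns ms2" "gst n ms ms2 h w Hit = replicate h Sep"
  "gst n ms ms2 h w Outp = w" "gst n ms ms2 h w Scr = []" "gst n ms ms2 h w Mis = []"
  by (simp_all add: gst_def)

lemma gst_upd:
  "(gst n ms ms2 h w)(Mk := ns ms') = gst n ms' ms2 h w"
  "(gst n ms ms2 h w)(Mk2 := ns ms') = gst n ms ms' h w"
  "(gst n ms ms2 h w)(Hit := replicate h' Sep) = gst n ms ms2 h' w"
  "(gst n ms ms2 h w)(Outp := w') = gst n ms ms2 h w'"
  by (rule ext, rename_tac q, case_tac q; simp add: gst_def)+

text \<open>Marks are never removed or made distinct, so a number may occur several times;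
  \<open>Hit\<close> counts its occurrences. Scanning reverses the marks onto \<open>Mk2\<close>,
  and the second loop restores them.\<close>

definition member :: "('v reg, 'f letter) com" where
  "member = while_nonempty Mk (eqtest (Col2 0) Mk ;; test_empty Mis (Push Hit Sep) (clear Mis) ;; movetop Mk Mk2) ;;
     while_nonempty Mk2 (movetop Mk2 Mk)"

lemma member_scan:
  assumes ok: "row_ok b rw" and ms: "\<forall>i\<in>set ms. i \<le> b"
    and h: "h' = h + length (filter (\<lambda>i. snd rw ! 0 = i) ms)"
  shows "runs (while_nonempty Mk (eqtest (Col2 0) Mk ;; test_empty Mis (Push Hit Sep) (clear Mis) ;; movetop Mk Mk2))
    (settab (rw # L) [] (gst n ms ms2 h w)) (settab (rw # L) [] (gst n [] (rev ms @ ms2) h' w))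
    (length ms * (2 * unit_cost b + 8) + 1)" (is "runs (while_nonempty Mk ?c) _ _ _")
  using ms h
proof (induction ms arbitrary: ms2 h)
  case Nil
  then show ?case by (simp add: runs_while_end)
next
  case (Cons i ms)
  have W: "0 < W" by (simp add: W_def)
  let ?d = "if snd rw ! 0 = i then 1 else 0 :: nat"
  let ?s = "settab (rw # L) [] (gst n (i # ms) ms2 h w)"
  let ?s1 = "?s(Mis := if snd rw ! 0 = i then ?s Mis else Sep # ?s Mis)"
  let ?s2 = "settab (rw # L) [] (gst n (i # ms) ms2 (h + ?d) w)"
  let ?s3 = "settab (rw # L) [] (gst n ms (i # ms2) (h + ?d) w)"
  have 1: "runs (eqtest (Col2 0) Mk) ?s ?s1 (unit_cost b)"
    by (rule runs_mono[OF eqtest[where n = "snd rw ! 0" and k = i]])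
      (use W row_ok_nth[OF ok W] in \<open>auto simp: unit_cost_def\<close>)
  have eq1: "?s(Hit := Sep # ?s Hit) = settab (rw # L) [] (gst n (i # ms) ms2 (Suc h) w)"
    using gst_upd(3)[where h' = "Suc h"] by (simp add: settab_upd)
  have eq2: "(?s(Mis := [Sep]))(Mis := []) = ?s"
    by (auto simp: fun_eq_iff)
  have 2: "runs (test_empty Mis (Push Hit Sep) (clear Mis)) ?s1 ?s2 4"
  proof (cases "snd rw ! 0 = i")
    case True
    then have "?s1 = ?s" by (auto simp: fun_eq_iff)
    then show ?thesis
      using True eq1 by (intro runs_test[where n = 3]) (auto intro!: runs_push)
  next
    case False
    then have eq3: "?s1 = ?s(Mis := [Sep])" by auto
    have "runs (clear Mis) (?s(Mis := [Sep])) ?s 3"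
      using clear[of Mis "?s(Mis := [Sep])"] unfolding eq2 by (simp add: numeral_3_eq_3)
    then show ?thesis
      unfolding eq3 using False by (intro runs_test[where n = 3]) auto
  qed
  have 0: "runs (movetop Mk Mk2) ?s2 (?s2(Mk := ns ms, Mk2 := num i @ ?s2 Mk2)) (11 * i + 10)"
    by (rule movetop) auto
  have eq4: "?s2(Mk := ns ms, Mk2 := num i @ ?s2 Mk2) = ?s3"
    using gst_upd(2)[where ms' = "i # ms2"] by (simp add: settab_upd gst_upd(1))
  have 3: "runs (movetop Mk Mk2) ?s2 ?s3 (unit_cost b)"
    by (rule runs_mono[OF 0[unfolded eq4]]) (use Cons.prems in \<open>simp add: unit_cost_def\<close>)
  have 4: "runs (while_nonempty Mk ?c) ?s3 (settab (rw # L) [] (gst n [] (rev ms @ i # ms2) h' w))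
    (length ms * (2 * unit_cost b + 8) + 1)"
    by (rule Cons.IH) (use Cons.prems in auto)
  have "top_of (?s Mk) \<noteq> None" by (simp add: top_num)
  then have "runs (while_nonempty Mk ?c) ?s (settab (rw # L) [] (gst n [] (rev ms @ i # ms2) h' w))
    (length (i # ms) * (2 * unit_cost b + 8) + 1)"
    by (intro runs_while_step[OF _ runs_seq[OF 1 runs_seq[OF 2 3 order.refl] order.refl] 4]) simp_all
  then show ?case by simp
qed

lemma member_restore:
  assumes "\<forall>i\<in>set ms2. i \<le> b"
  shows "runs (while_nonempty Mk2 (movetop Mk2 Mk)) (settab L [] (gst n ms ms2 h w))
    (settab L [] (gst n (rev ms2 @ ms) [] h w)) (length ms2 * Suc (unit_cost b) + 1)"
  using assms
proof (induction ms2 arbitrary: ms)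
  case Nil
  then show ?case by (simp add: runs_while_end)
next
  case (Cons i ms2)
  let ?s = "settab L [] (gst n ms (i # ms2) h w)" and ?t = "settab L [] (gst n (i # ms) ms2 h w)"
  have 0: "runs (movetop Mk2 Mk) ?s (?s(Mk2 := ns ms2, Mk := num i @ ?s Mk)) (11 * i + 10)"
    by (rule movetop) auto
  have eq: "?s(Mk2 := ns ms2, Mk := num i @ ?s Mk) = ?t"
    using gst_upd(1)[where ms' = "i # ms"] by (simp add: settab_upd gst_upd(2))
  have 1: "runs (movetop Mk2 Mk) ?s ?t (unit_cost b)"
    by (rule runs_mono[OF 0[unfolded eq]]) (use Cons.prems in \<open>simp add: unit_cost_def\<close>)
  have 2: "runs (while_nonempty Mk2 (movetop Mk2 Mk)) ?t (settab L [] (gst n (rev ms2 @ i # ms) [] h w))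
    (length ms2 * Suc (unit_cost b) + 1)"
    by (rule Cons.IH) (use Cons.prems in auto)
  have "top_of (?s Mk2) \<noteq> None" by (simp add: top_num)
  then have "runs (while_nonempty Mk2 (movetop Mk2 Mk)) ?s (settab L [] (gst n (rev ms2 @ i # ms) [] h w))
    (length (i # ms2) * Suc (unit_cost b) + 1)"
    by (intro runs_while_step[OF _ 1 2]) simp_all
  then show ?case by simp
qed

definition member_cost :: "nat \<Rightarrow> nat \<Rightarrow> nat" where
  "member_cost b N = N * (3 * unit_cost b + 9) + 3"

lemma member:
  assumes "row_ok b rw" "\<forall>i\<in>set ms. i \<le> b" "length ms \<le> N"
  shows "runs member (settab (rw # L) [] (gst n ms [] 0 w))
    (settab (rw # L) [] (gst n ms [] (length (filter (\<lambda>i. snd rw ! 0 = i) ms)) w)) (member_cost b N)"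
proof -
  have 2: "runs (while_nonempty Mk2 (movetop Mk2 Mk)) (settab (rw # L) [] (gst n [] (rev ms @ []) h w))
    (settab (rw # L) [] (gst n ms [] h w)) (length ms * Suc (unit_cost b) + 1)" for h
    using member_restore[of "rev ms" b "rw # L" n "[]" h w] assms(2) by simp
  let ?h = "length (filter (\<lambda>i. snd rw ! 0 = i) ms)"
  have 1: "runs (while_nonempty Mk (eqtest (Col2 0) Mk ;; test_empty Mis (Push Hit Sep) (clear Mis) ;; movetop Mk Mk2))
    (settab (rw # L) [] (gst n ms [] 0 w)) (settab (rw # L) [] (gst n [] (rev ms @ []) ?h w))
    (length ms * (2 * unit_cost b + 8) + 1)"
    by (rule member_scan[OF assms(1,2)]) simp
  have "length ms * (2 * unit_cost b + 8) + length ms * Suc (unit_cost b) = length ms * (3 * unit_cost b + 9)"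
    by (simp add: algebra_simps)
  also have "\<dots> \<le> N * (3 * unit_cost b + 9)"
    using assms(3) by (intro mult_le_mono1)
  finally show ?thesis
    unfolding member_def by (intro runs_seq[OF 1 2]) (simp add: member_cost_def)
qed

text \<open>The state in the middle of removing the row \<open>rw\<close>: its symbol and its first
  \<open>k\<close> columns are gone already.\<close>

definition part :: "nat \<Rightarrow> 'f row \<Rightarrow> 'f row list \<Rightarrow> ('v reg \<Rightarrow> 'f letter list) \<Rightarrow> 'v reg \<Rightarrow> 'f letter list" where
  "part k rw L s r = (case r of Col2 j \<Rightarrow> if j < k then settab L [] s r else settab (rw # L) [] s r
     | _ \<Rightarrow> settab L [] s r)"

lemma part_0: "(settab (rw # L) [] s)(Sy2 := map (Sym \<circ> fst) L) = part 0 rw L s"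
  by (rule ext, rename_tac q, case_tac q) (auto simp: part_def)

lemma part_W: "part W rw L s = settab L [] s"
  by (rule ext, rename_tac q, case_tac q) (auto simp: part_def)

lemma part_upd: "\<not> table_reg q \<Longrightarrow> (part k rw L s)(q := x) = part k rw L (s(q := x))"
  by (rule ext, rename_tac r, case_tac r) (auto simp: part_def)

lemma part_Suc: "k < W \<Longrightarrow> (part k rw L s)(Col2 k := column k L) = part (Suc k) rw L s"
  by (rule ext, rename_tac r, case_tac r) (auto simp: part_def less_Suc_eq)

lemma part_simps: "part k rw L s Outp = s Outp" "part k rw L s Mk = s Mk" "part k rw L s Scr = s Scr"
  "k < W \<Longrightarrow> part k rw L s (Col2 k) = num (snd rw ! k) @ column k L"
  by (auto simp: part_def)

lemma part_pop:
  assumes "row_ok b rw" "k < W"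
  shows "runs (poptop (Col2 k)) (part k rw L s) (part (Suc k) rw L s) (unit_cost b)"
proof -
  have "runs (poptop (Col2 k)) (part k rw L s) ((part k rw L s)(Col2 k := column k L)) (2 * (snd rw ! k) + 3)"
    by (rule poptop) (use assms in \<open>auto simp: part_simps\<close>)
  then have "runs (poptop (Col2 k)) (part k rw L s) (part (Suc k) rw L s) (2 * (snd rw ! k) + 3)"
    by (simp only: part_Suc[OF assms(2)])
  then show ?thesis
    by (rule runs_mono) (use row_ok_nth[OF assms] in \<open>simp add: unit_cost_def\<close>)
qed

lemma part_emit:
  assumes "row_ok b rw" "k < W"
  shows "runs (emittop (Col2 k)) (part k rw L s) (part (Suc k) rw L (s(Outp := s Outp @ num (snd rw ! k)))) (unit_cost b)"
proof -
  have "runs (emittop (Col2 k)) (part k rw L s)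
    ((part k rw L s)(Col2 k := column k L, Outp := part k rw L s Outp @ num (snd rw ! k))) (2 * (snd rw ! k) + 3)"
    by (rule emittop) (use assms in \<open>auto simp: part_simps\<close>)
  then have "runs (emittop (Col2 k)) (part k rw L s)
    (part (Suc k) rw L (s(Outp := s Outp @ num (snd rw ! k)))) (2 * (snd rw ! k) + 3)"
    by (simp only: part_Suc[OF assms(2)] part_simps part_upd table_reg_simps not_False_eq_True)
  then show ?thesis
    by (rule runs_mono) (use row_ok_nth[OF assms] in \<open>simp add: unit_cost_def\<close>)
qed

lemma part_copy:
  assumes "row_ok b rw" "k < W" "s Scr = []"
  shows "runs (copytop (Col2 k) Mk) (part k rw L s) (part k rw L (s(Mk := num (snd rw ! k) @ s Mk))) (unit_cost b)"
proof -
  have "runs (copytop (Col2 k) Mk) (part k rw L s)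
    ((part k rw L s)(Mk := num (snd rw ! k) @ part k rw L s Mk)) (9 * (snd rw ! k) + 6)"
    by (rule copytop) (use assms in \<open>auto simp: part_simps\<close>)
  then have "runs (copytop (Col2 k) Mk) (part k rw L s)
    (part k rw L (s(Mk := num (snd rw ! k) @ s Mk))) (9 * (snd rw ! k) + 6)"
    by (simp only: part_simps part_upd table_reg_simps not_False_eq_True)
  then show ?thesis
    by (rule runs_mono) (use row_ok_nth[OF assms(1,2)] in \<open>simp add: unit_cost_def\<close>)
qed

definition drop_row :: "('v reg, 'f letter) com" where
  "drop_row = Pop Sy2 ;; seqs (map (\<lambda>j. poptop (Col2 j)) [0..<W])"

lemma drop_row:
  assumes "row_ok b rw"
  shows "runs drop_row (settab (rw # L) [] s) (settab L [] s) (W * Suc (unit_cost b) + 3)"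
proof -
  have 1: "runs (Pop Sy2) (settab (rw # L) [] s) (part 0 rw L s) 1"
    by (rule runs_pop) (simp_all add: part_0[symmetric])
  have 2: "runs (seqs (map (\<lambda>j. poptop (Col2 j)) [0..<W])) (part 0 rw L s) (part W rw L s) (W * Suc (unit_cost b) + 1)"
    by (rule runs_seqs[where st = "\<lambda>i. part i rw L s" and N = "unit_cost b"]) (use part_pop[OF assms] in auto)
  show ?thesis
    unfolding drop_row_def by (rule runs_seq[OF 1 2[unfolded part_W]]) simp
qed

text \<open>The letter written is taken from \<open>Sy2\<close>, so \<open>s\<close> matters only
  through its arity: that many columns are arguments, to be marked and written, and the others are
  padding. The result column is dropped.\<close>

definition out_row :: "'f \<Rightarrow> ('v reg, 'f letter) com" where
  "out_row s = Out Sy2 Outp ;; emittop (Col2 0) ;; poptop (Col2 1) ;;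
     seqs (map (\<lambda>j. copytop (Col2 (j + 2)) Mk ;; emittop (Col2 (j + 2))) [0..<ar s]) ;;
     seqs (map (\<lambda>j. poptop (Col2 (j + 2))) [ar s..<A])"

definition row_args :: "'f row \<Rightarrow> nat list" where
  "row_args rw = take (ar (fst rw)) (drop 2 (snd rw))"

definition row_string :: "'f row \<Rightarrow> 'f letter list" where
  "row_string rw = Sym (fst rw) # num (snd rw ! 0) @ ns (row_args rw)"

lemma out_row:
  assumes ok: "row_ok b rw" and s: "fst rw \<in> D \<union> C"
  shows "runs (out_row (fst rw)) (settab (rw # L) [] (gst n ms [] 0 w))
    (settab L [] (gst n (rev (row_args rw) @ ms) [] 0 (w @ row_string rw))) (W * (2 * unit_cost b + 3) + 7)"
proof -
  let ?k = "ar (fst rw)" and ?g = "\<lambda>ms w. gst n ms [] 0 w"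
  let ?w = "w @ [Sym (fst rw)]" let ?w1 = "?w @ num (snd rw ! 0)"
  have k: "?k \<le> A" using s by (rule ar_le)
  have W: "0 < W" "1 < W" "\<And>j. j < A \<Longrightarrow> j + 2 < W" by (auto simp: W_def)
  have len: "length (snd rw) = A + 2" using ok by (simp add: row_ok_def W_def)
  define as where "as = row_args rw"
  have as: "length as = ?k" "\<And>j. j < ?k \<Longrightarrow> as ! j = snd rw ! (j + 2)"
    using len k by (auto simp: as_def row_args_def add.commute)
  have 1: "runs (Out Sy2 Outp) (settab (rw # L) [] (?g ms w)) (part 0 rw L (?g ms ?w)) 1"
    using part_upd[of Outp 0 rw L "?g ms w"]
    by (intro runs_out) (auto simp: part_0 gst_upd)
  have 2: "runs (emittop (Col2 0)) (part 0 rw L (?g ms ?w)) (part 1 rw L (?g ms ?w1)) (unit_cost b)"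
    using part_emit[OF ok W(1), of L "?g ms ?w"] by (simp add: gst_upd)
  have 3: "runs (poptop (Col2 1)) (part 1 rw L (?g ms ?w1)) (part 2 rw L (?g ms ?w1)) (unit_cost b)"
    using part_pop[OF ok W(2), of L "?g ms ?w1"] by (simp add: numeral_2_eq_2)
  let ?st = "\<lambda>i. part (i + 2) rw L (?g (rev (take i as) @ ms) (?w1 @ ns (take i as)))"
  have 4: "runs (seqs (map (\<lambda>j. copytop (Col2 (j + 2)) Mk ;; emittop (Col2 (j + 2))) [0..<?k])) (part 2 rw L (?g ms ?w1))
    (part (?k + 2) rw L (?g (rev as @ ms) (?w1 @ ns as))) (?k * Suc (2 * unit_cost b + 1) + 1)"
  proof (rule runs_seqs[where st = ?st and N = "2 * unit_cost b + 1"])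
    fix i assume "i < length (map (\<lambda>j. copytop (Col2 (j + 2)) Mk ;; emittop (Col2 (j + 2))) [0..<?k])"
    then have i: "i < ?k" "i < A" using k by auto
    have tk: "take (Suc i) as = take i as @ [snd rw ! (i + 2)]"
      using i as by (simp add: take_Suc_conv_app_nth)
    let ?t = "part (i + 2) rw L (?g (rev (take (Suc i) as) @ ms) (?w1 @ ns (take i as)))"
    have eq: "num (snd rw ! (i + 2)) @ ns (rev (take i as) @ ms) = ns (rev (take (Suc i) as) @ ms)"
      by (simp add: tk)
    have "runs (copytop (Col2 (i + 2)) Mk) (?st i) ?t (unit_cost b)"
      using part_copy[OF ok W(3)[OF i(2)], of "?g (rev (take i as) @ ms) (?w1 @ ns (take i as))" L]
      by (simp only: eq gst_simps gst_upd simp_thms)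
    moreover have "runs (emittop (Col2 (i + 2))) ?t (?st (Suc i)) (unit_cost b)"
      using part_emit[OF ok W(3)[OF i(2)], of L "?g (rev (take (Suc i) as) @ ms) (?w1 @ ns (take i as))"]
      by (simp add: gst_upd tk)
    ultimately show "runs (map (\<lambda>j. copytop (Col2 (j + 2)) Mk ;; emittop (Col2 (j + 2))) [0..<?k] ! i)
        (?st i) (?st (Suc i)) (2 * unit_cost b + 1)"
      using i by (simp add: runs_seq)
  qed (use as in \<open>auto simp: numeral_2_eq_2\<close>)
  let ?h = "?g (rev as @ ms) (?w1 @ ns as)"
  have 5: "runs (seqs (map (\<lambda>j. poptop (Col2 (j + 2))) [?k..<A])) (part (?k + 2) rw L ?h) (part W rw L ?h)
    ((A - ?k) * Suc (unit_cost b) + 1)"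
    by (rule runs_seqs[where st = "\<lambda>i. part (i + ?k + 2) rw L ?h" and N = "unit_cost b"])
      (use part_pop[OF ok] W k in \<open>auto simp: W_def add.commute add.left_commute\<close>)
  have "?k * Suc (2 * unit_cost b + 1) + (A - ?k) * Suc (unit_cost b) \<le>
      ?k * (2 * unit_cost b + 3) + (A - ?k) * (2 * unit_cost b + 3)"
    by (intro add_mono mult_le_mono2) auto
  also have "\<dots> = A * (2 * unit_cost b + 3)"
    using k by (metis add_mult_distrib le_add_diff_inverse)
  finally have cost: "Suc (1 + Suc (unit_cost b + Suc (unit_cost b + Suc (?k * Suc (2 * unit_cost b + 1) + 1 +
      ((A - ?k) * Suc (unit_cost b) + 1))))) \<le> W * (2 * unit_cost b + 3) + 7"
    by (simp add: W_def)
  have "?w1 @ ns as = w @ row_string rw" by (simp add: row_string_def as_def)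
  then show ?thesis
    unfolding out_row_def as_def[symmetric] using 5[unfolded part_W]
    by (intro runs_seq[OF 1 runs_seq[OF 2 runs_seq[OF 3 runs_seq[OF 4 _ order.refl] order.refl] order.refl] cost]) simp
qed

primrec out_dispatch :: "'f list \<Rightarrow> ('v reg, 'f letter) com" where
  "out_dispatch [] = Skip"
| "out_dispatch (s # ss) = test_top Sy2 (Sym s) (out_row s) (out_dispatch ss)"

lemma out_dispatch:
  assumes "s \<in> set ss" "u Sy2 = Sym s # xs" "runs (out_row s) u t N"
  shows "runs (out_dispatch ss) u t (N + length ss)"
  using assms(1)
proof (induction ss)
  case (Cons s' ss)
  show ?case
    unfolding out_dispatch.simps
  proof (rule runs_test[where n = "N + length ss"])
    assume "top_of (u Sy2) = Some (Sym s')"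
    then show "runs (out_row s') u t (N + length ss)"
      using assms(2) runs_mono[OF assms(3)] by simp
  next
    assume "top_of (u Sy2) \<noteq> Some (Sym s')"
    then show "runs (out_dispatch ss) u t (N + length ss)"
      using assms(2) Cons by auto
  qed simp
qed simp

section \<open>The pass from the newest to the oldest row\<close>

definition collect :: "('v reg, 'f letter) com" where
  "collect = while_nonempty Sy2 (member ;; test_empty Hit drop_row (clear Hit ;; out_dispatch sl))"

text \<open>Rows of operations are discarded by the same test. Only the root and arguments of nodes
  are ever marked, and in a correct heap these are numbers of constructor rows.\<close>

fun gc_out :: "'f row list \<Rightarrow> nat list \<Rightarrow> 'f letter list" where
  "gc_out [] ms = []"
| "gc_out (rw # L) ms = (if snd rw ! 0 \<in> set ms then row_string rw @ gc_out L (rev (row_args rw) @ ms) else gc_out L ms)"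

definition collect_cost :: "nat \<Rightarrow> nat \<Rightarrow> nat" where
  "collect_cost b N = member_cost b N + 2 * N + W * (2 * unit_cost b + 3) + length sl + 15"

text \<open>The sum \<open>length ms + A * length L\<close> never increases: a row that is written
  adds at most \<open>A\<close> marks and is removed from \<open>L\<close>. So \<open>N\<close>
  bounds the number of marks throughout.\<close>

lemma collect:
  assumes "\<forall>rw\<in>set L. row_ok b rw \<and> fst rw \<in> D \<union> C" "\<forall>i\<in>set ms. i \<le> b" "length ms + A * length L \<le> N"
  shows "\<exists>t. t Outp = w @ gc_out L ms \<and> runs collect (settab L [] (gst n ms [] 0 w)) t (length L * collect_cost b N + 1)"
  using assms
proof (induction L arbitrary: ms w)
  case Nil
  then show ?case
    by (intro exI[of _ "settab [] [] (gst n ms [] 0 w)"]) (simp add: collect_def runs_while_end)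
next
  case (Cons rw L)
  have ok: "row_ok b rw" "fst rw \<in> D \<union> C" using Cons.prems by auto
  define h where "h = length (filter (\<lambda>i. snd rw ! 0 = i) ms)"
  have hN: "h \<le> N" using Cons.prems(3) length_filter_le[of _ ms] unfolding h_def by (meson add_leD1 order_trans)
  have h0: "h = 0 \<longleftrightarrow> snd rw ! 0 \<notin> set ms" by (auto simp: h_def filter_empty_conv)
  let ?s = "settab (rw # L) [] (gst n ms [] 0 w)" and ?s1 = "settab (rw # L) [] (gst n ms [] h w)"
  have 1: "runs member ?s ?s1 (member_cost b N)"
    unfolding h_def by (rule member) (use Cons.prems in auto)
  define ms' where "ms' = (if h = 0 then ms else rev (row_args rw) @ ms)"
  define w' where "w' = (if h = 0 then w else w @ row_string rw)"
  let ?t = "settab L [] (gst n ms' [] 0 w')"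
  have 2: "runs (test_empty Hit drop_row (clear Hit ;; out_dispatch sl)) ?s1 ?t
    (2 * N + W * (2 * unit_cost b + 3) + length sl + 12)"
  proof (cases "h = 0")
    case True
    have "W * Suc (unit_cost b) + 3 \<le> 2 * N + W * (2 * unit_cost b + 3) + length sl + 11"
      using mult_le_mono2[of "Suc (unit_cost b)" "2 * unit_cost b + 3" W] by linarith
    from runs_mono[OF drop_row[OF ok(1)] this]
    show ?thesis by (intro runs_test[where n = "2 * N + W * (2 * unit_cost b + 3) + length sl + 11"])
        (simp_all add: ms'_def w'_def True)
  next
    case False
    have "?s1(Hit := []) = ?s" using gst_upd(3)[where h' = 0] by (simp add: settab_upd)
    then have 3: "runs (clear Hit) ?s1 ?s (2 * h + 1)" using clear[of Hit ?s1] by simp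
    have 5: "runs (out_row (fst rw)) ?s ?t (W * (2 * unit_cost b + 3) + 7)"
      unfolding ms'_def w'_def if_not_P[OF False] by (rule out_row[OF ok])
    have 4: "runs (out_dispatch sl) ?s ?t (W * (2 * unit_cost b + 3) + 7 + length sl)"
      by (rule out_dispatch[OF _ _ 5]) (use ok sl in auto)
    have "runs (clear Hit ;; out_dispatch sl) ?s1 ?t (2 * N + W * (2 * unit_cost b + 3) + length sl + 11)"
      by (rule runs_seq[OF 3 4]) (use hN in simp)
    then show ?thesis
      by (intro runs_test[where n = "2 * N + W * (2 * unit_cost b + 3) + length sl + 11"])
        (use False in \<open>auto simp: top_of_def split: list.splits\<close>)
  qed
  have args: "set (row_args rw) \<subseteq> set (snd rw)" "length (row_args rw) \<le> A"
    using ok ar_le[of "fst rw"] by (auto simp: row_args_def row_ok_def W_def dest!: in_set_takeD in_set_dropD)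
  have "\<exists>t. t Outp = w' @ gc_out L ms' \<and> runs collect ?t t (length L * collect_cost b N + 1)"
    by (rule Cons.IH) (use Cons.prems args ok in \<open>auto simp: ms'_def row_ok_def\<close>)
  then obtain t where t: "t Outp = w' @ gc_out L ms'" and 3: "runs collect ?t t (length L * collect_cost b N + 1)"
    by blast
  have "runs collect ?s t (length (rw # L) * collect_cost b N + 1)"
    unfolding collect_def
    by (rule runs_while_step[OF _ runs_seq[OF 1 2 order.refl] 3[unfolded collect_def]])
      (auto simp: collect_cost_def)
  moreover have "w' @ gc_out L ms' = w @ gc_out (rw # L) ms"
    using h0 by (auto simp: w'_def ms'_def)
  ultimately show ?case using t by metis
qed

section \<open>The complete stack program\<close>

definition start_up :: "('v reg, 'f letter) com" where
  "start_up = Push Cnt Sep ;; while_nonempty Inp (Mov Inp Ctl)"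

lemma start_up:
  "runs start_up (\<lambda>r. if r = Inp then x else []) (state (rev x) [] [] [] []) (3 * length x + 4)"
proof -
  let ?st = "\<lambda>i. (\<lambda>_. [])(Cnt := [Sep], Inp := drop i x, Ctl := rev (take i x))"
  have 1: "runs (Push Cnt Sep) (\<lambda>r. if r = Inp then x else []) (?st 0) 2"
    by (rule runs_push) (auto simp: fun_eq_iff)
  have eq: "?st (length x) = state (rev x) [] [] [] []"
    by (rule ext, rename_tac r, case_tac r) (auto simp: num_0)
  have 2: "runs (while_nonempty Inp (Mov Inp Ctl)) (?st 0) (?st (length x)) (3 * length x + 1)"
  proof (rule runs_while[where st = ?st and n = "length x" and N = 2])
    fix i assume i: "i < length x"
    then have d: "drop i x = x ! i # drop (Suc i) x" by (simp add: Cons_nth_drop_Suc)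
    have "runs (Mov Inp Ctl) (?st i) (?st (Suc i)) 2"
      by (rule runs_mov) (use i d in \<open>auto simp: fun_eq_iff take_Suc_conv_app_nth\<close>)
    then show "top_of (?st i Inp) \<noteq> None \<and> runs (Mov Inp Ctl) (?st i) (?st (Suc i)) 2"
      by (simp add: d)
  qed auto
  show ?thesis
    unfolding start_up_def eq[symmetric] by (rule runs_seq[OF 1 2]) simp
qed

definition finish :: "('v reg, 'f letter) com" where
  "finish = to_end ;; copytop Vs Mk ;; emittop Vs ;; collect"

lemma finish:
  assumes T: "rows_ok b T" "rev L @ T0 = T" "\<forall>rw\<in>set T. fst rw \<in> D \<union> C" and v: "v \<le> b"
  shows "\<exists>t. t Outp = num v @ gc_out (rev T) [v] \<and>
    runs finish (state [] [v] [] L T0) t (b * Suc (adv_cost b) + 2 * unit_cost b + b * collect_cost b (A * b + 1) + 5)"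
proof -
  let ?n = "length T"
  have n: "length L + length T0 = ?n" using T(2) by (metis length_append length_rev)
  have b: "?n \<le> b" using T by (simp add: rows_ok_def)
  let ?s = "settab (rev T) [] (cfg ?n [] [v] [] (\<lambda>_. []))"
  have eq: "rev T0 @ L = rev T" using T(2) by auto
  have "runs to_end (state [] [v] [] L T0) (settab (rev T0 @ L) [] (cfg ?n [] [v] [] (\<lambda>_. [])))
    (length T0 * Suc (adv_cost b) + 1)"
    unfolding n by (rule to_end) (use T in \<open>auto simp: rows_ok_def\<close>)
  then have 1: "runs to_end (state [] [v] [] L T0) ?s (b * Suc (adv_cost b) + 1)"
    unfolding eq by (rule runs_mono) (use n b mult_le_mono1[of "length T0" b "Suc (adv_cost b)"] in simp)
  have 0: "runs (copytop Vs Mk) ?s (?s(Mk := num v @ ?s Mk)) (9 * v + 6)"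
    by (rule copytop[where xs = "[]"]) auto
  have 2: "runs (copytop Vs Mk) ?s (?s(Mk := num v)) (unit_cost b)"
    using runs_mono[OF 0, of "unit_cost b"] v by (simp add: unit_cost_def)
  have "runs (emittop Vs) (?s(Mk := num v)) ((?s(Mk := num v))(Vs := [], Outp := (?s(Mk := num v)) Outp @ num v)) (2 * v + 3)"
    by (rule emittop) auto
  moreover have "(?s(Mk := num v))(Vs := [], Outp := (?s(Mk := num v)) Outp @ num v) =
      settab (rev T) [] (gst ?n [v] [] 0 (num v))"
    by (rule ext, rename_tac r, case_tac r) (auto simp: gst_def)
  ultimately have 3: "runs (emittop Vs) (?s(Mk := num v)) (settab (rev T) [] (gst ?n [v] [] 0 (num v))) (unit_cost b)"
    using v by (auto simp: unit_cost_def intro: runs_mono)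
  \<comment> \<open>\<open>A * b + 1\<close> counts the mark of the root and at most
    \<open>A\<close> further marks for each of at most \<open>b\<close> rows.\<close>
  have "\<exists>t. t Outp = num v @ gc_out (rev T) [v] \<and>
      runs collect (settab (rev T) [] (gst ?n [v] [] 0 (num v))) t (length (rev T) * collect_cost b (A * b + 1) + 1)"
    by (rule collect) (use T v b in \<open>auto simp: rows_ok_def\<close>)
  then obtain t where t: "t Outp = num v @ gc_out (rev T) [v]"
    and "runs collect (settab (rev T) [] (gst ?n [v] [] 0 (num v))) t (length (rev T) * collect_cost b (A * b + 1) + 1)"
    by blast
  from runs_mono[OF this(2), of "b * collect_cost b (A * b + 1) + 1"] b
  have 4: "runs collect (settab (rev T) [] (gst ?n [v] [] 0 (num v))) t (b * collect_cost b (A * b + 1) + 1)"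
    by (simp add: mult_le_mono1)
  have "runs finish (state [] [v] [] L T0) t (b * Suc (adv_cost b) + 2 * unit_cost b + b * collect_cost b (A * b + 1) + 5)"
    unfolding finish_def
    by (rule runs_seq[OF 1 runs_seq[OF 2 runs_seq[OF 3 4 order.refl] order.refl]]) simp
  with t show ?thesis by blast
qed

definition whole :: "('v reg, 'f letter) com" where
  "whole = start_up ;; while_nonempty Ctl body ;; finish"

definition whole_cost :: "nat \<Rightarrow> nat" where
  "whole_cost b = 3 * b + b * Suc (body_cost b) + b * Suc (adv_cost b) + 2 * unit_cost b + b * collect_cost b (A * b + 1) + 12"

theorem whole:
  assumes run: "(astep ^^ k) (ks, [], [], []) ([], [v], [], T)" and ks: "rev x = toks ks" "\<forall>i. TPush i \<notin> set ks"
    and b: "length x \<le> b" "k \<le> b" "length T \<le> b" and T: "\<forall>rw\<in>set T. fst rw \<in> D \<union> C"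
  shows "\<exists>t. t Outp = num v @ gc_out (rev T) [v] \<and>
    runs whole (\<lambda>r. if r = Inp then x else []) t (whole_cost b)"
proof -
  have ok: "conf_ok b (ks, [], [], [])"
    using ks by (simp add: conf_ok_def rows_ok_def)
  have "rev [] @ [] = []" by simp
  from loop[OF run ok b(3) this]
  obtain L T0 where 1: "conf_ok b ([], [v], [], T)" "rev L @ T0 = T"
    and 2: "runs (while_nonempty Ctl body) (state (toks ks) [] [] [] []) (state [] [v] [] L T0) (k * Suc (body_cost b) + 1)"
    by (elim exE conjE)
  have "rows_ok b T" "v \<le> b" using 1(1) by (auto simp: conf_ok_def)
  from finish[OF this(1) 1(2) T this(2)]
  obtain t where t: "t Outp = num v @ gc_out (rev T) [v]" and 3: "runs finish (state [] [v] [] L T0) t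
    (b * Suc (adv_cost b) + 2 * unit_cost b + b * collect_cost b (A * b + 1) + 5)" by blast
  have "k * Suc (body_cost b) \<le> b * Suc (body_cost b)" using b(2) by (rule mult_le_mono1)
  then have "runs whole (\<lambda>r. if r = Inp then x else []) t (whole_cost b)"
    unfolding whole_def
    by (intro runs_seq[OF start_up[of x, unfolded ks(1)] runs_seq[OF 2 3 order.refl]])
      (use b(1) in \<open>simp add: whole_cost_def\<close>)
  with t show ?thesis by blast
qed


section \<open>Correctness of the evaluation\<close>

lemma D_C: "s \<in> D \<Longrightarrow> s \<notin> C"
  using prog by (auto simp: program_def)

text \<open>The semantics without cache. It is deterministic by orthogonality, so a cache never holds two
  different values for the same call.\<close>

inductive sem :: "('f, 'v) trm \<Rightarrow> ('f, 'v) trm \<Rightarrow> bool" where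
  con: "\<lbrakk>c \<in> C; list_all2 sem ts vs\<rbrakk> \<Longrightarrow> sem (Fun c ts) (Fun c vs)"
| op: "\<lbrakk>f \<in> D; list_all2 sem ts vs; (Fun f ps, r) \<in> R; map (subst \<sigma>) ps = vs; sem (subst \<sigma> r) v\<rbrakk>
    \<Longrightarrow> sem (Fun f ts) v"

lemma sem_val: "v \<in> vals ar C \<Longrightarrow> sem v w \<longleftrightarrow> w = v"
proof (induction v arbitrary: w)
  case (Fun c ts)
  have ts: "c \<in> C" "set ts \<subseteq> vals ar C"
    using Fun.prems by (auto elim: terms.cases)
  have "list_all2 sem ts vs \<longleftrightarrow> vs = ts" for vs
    using Fun.IH ts(2) unfolding list_all2_conv_all_nth list_eq_iff_nth_eq by (metis nth_mem subsetD)
  then show ?case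
    using ts(1) D_C by (auto elim: sem.cases intro: sem.con)
qed (auto elim: terms.cases)

text \<open>Two different rules that match the same call overlap at the root.\<close>

lemma rule_unique:
  assumes "(Fun f ps, r) \<in> R" "(Fun f qs, r') \<in> R" "map (subst \<sigma>) ps = map (subst \<tau>) qs"
  shows "ps = qs \<and> r = r'"
proof (rule ccontr)
  assume "\<not> (ps = qs \<and> r = r')"
  then have "\<not> overlap (Fun f ps) (Fun f qs)"
    using orth assms(1,2) unfolding orthogonal_def by fast
  moreover have "subst \<sigma> (Fun f ps) = subst \<tau> (Fun f qs)" using assms(3) by simp
  moreover have "Fun f ps \<in> subterms (Fun f ps)" "\<forall>x. Fun f ps \<noteq> Var x" by simp_all
  ultimately show False unfolding overlap_def by blast
qed

lemma rhs_unique: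
  assumes "(Fun f ps, r) \<in> R" "map (subst \<sigma>) ps = map (subst \<tau>) ps"
  shows "subst \<sigma> r = subst \<tau> r"
proof -
  have "vars_trm r \<subseteq> vars_trm (Fun f ps)"
    using assms(1) by (rule rule_shape)
  moreover have "subst \<sigma> (Fun f ps) = subst \<tau> (Fun f ps)" using assms(2) by simp
  ultimately show ?thesis unfolding subst_eq_iff by blast
qed

lemma sem_opE:
  assumes "sem (Fun f ts) v" "f \<in> D"
  obtains vs ps r \<sigma> where "list_all2 sem ts vs" "(Fun f ps, r) \<in> R" "map (subst \<sigma>) ps = vs" "sem (subst \<sigma> r) v"
  using assms(1)
proof (cases rule: sem.cases)
  case (con vs)
  then show ?thesis using assms(2) D_C by blast
qed (use that in blast)

text \<open>The arguments have the same values by induction, these select the same rule, and the two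
  matching substitutions agree on the right-hand side because its variables occur on the
  left.\<close>

lemma sem_det: "sem t v \<Longrightarrow> sem t w \<Longrightarrow> v = w"
proof (induction arbitrary: w rule: sem.induct)
  case (con c ts vs)
  from con.prems obtain ws where ws: "w = Fun c ws" "list_all2 sem ts ws"
    using con.hyps D_C by (auto elim: sem.cases)
  have "vs = ws"
    using con.IH ws(2) unfolding list_all2_conv_all_nth list_eq_iff_nth_eq by metis
  then show ?case by (simp add: ws)
next
  case (op f ts vs ps r \<sigma> v)
  from op.prems obtain ws qs r' \<tau> where ws: "list_all2 sem ts ws" "(Fun f qs, r') \<in> R"
    "map (subst \<tau>) qs = ws" "sem (subst \<tau> r') w"
    using op.hyps(1) by (rule sem_opE)
  have "vs = ws"
    using op.IH ws(1) unfolding list_all2_conv_all_nth list_eq_iff_nth_eq by metis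
  then have eq: "map (subst \<sigma>) ps = map (subst \<tau>) qs" using op.hyps ws(3) by simp
  then have "ps = qs" "r = r'" using rule_unique op.hyps(2) ws(2) by blast+
  moreover have "subst \<sigma> r = subst \<tau> r"
    using rhs_unique op.hyps(2) eq calculation by blast
  ultimately show ?case using op.IH(2) ws(4) by simp
qed

lemma list_all2_sem_vals: "set vs \<subseteq> vals ar C \<Longrightarrow> list_all2 sem vs ws \<longleftrightarrow> ws = vs"
  using sem_val unfolding list_all2_conv_all_nth list_eq_iff_nth_eq by (metis nth_mem subsetD)

section \<open>Elementary facts about derivations\<close>

lemma rule_head: "(Fun f ps, r) \<in> R \<Longrightarrow> f \<in> D \<and> length ps = ar f"
  by (erule rule_shape) auto

lemma eval_vals:
  "eval ar D C R K t m K' v \<Longrightarrow> v \<in> vals ar C"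
  "evals ar D C R K ts m K' vs \<Longrightarrow> set vs \<subseteq> vals ar C \<and> length vs = length ts"
proof (induction rule: eval_evals.inducts)
  case (Read K f vs v)
  then show ?case by (auto simp: caches_def)
qed (auto intro: terms.Fun)

text \<open>A derivation may descend into values, either by (Con) or through a (Split) of a call
  whose arguments are evaluated already. Such detours cost nothing and leave the cache alone, so the
  machine may skip them.\<close>

lemma eval_of_vals:
  "eval ar D C R K t m K' v \<Longrightarrow> t \<in> vals ar C \<Longrightarrow> m = 0 \<and> K' = K \<and> v = t"
  "evals ar D C R K ts m K' vs \<Longrightarrow> set ts \<subseteq> vals ar C \<Longrightarrow> m = 0 \<and> K' = K \<and> vs = ts"
proof (induction rule: eval_evals.inducts)
  case (Split f ts K n K' vs n' K'' v)
  then show ?case using D_C by (auto elim: terms.cases)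
next
  case (Con c ts K n K' vs)
  then show ?case by (auto elim: terms.cases)
next
  case (Read K f vs v)
  then have "f \<in> D" by (auto simp: caches_def)
  moreover have "f \<in> C" using \<open>Fun f vs \<in> vals ar C\<close> by (auto elim: terms.cases)
  ultimately show ?case using D_C by blast
next
  case (Update vs f v K ps r \<sigma> m K')
  then show ?case using D_C rule_head by (auto elim: terms.cases)
qed auto

text \<open>(Read) is sound only for a sound cache, so soundness of the cache is carried
  along.\<close>

lemma eval_sem:
  "eval ar D C R K t m K' v \<Longrightarrow> (\<forall>(t, v)\<in>K. sem t v) \<Longrightarrow> sem t v \<and> (\<forall>(t, v)\<in>K'. sem t v)"
  "evals ar D C R K ts m K' vs \<Longrightarrow> (\<forall>(t, v)\<in>K. sem t v) \<Longrightarrow> list_all2 sem ts vs \<and> (\<forall>(t, v)\<in>K'. sem t v)"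
proof (induction rule: eval_evals.inducts)
  case (Split f ts K n K' vs n' K'' v)
  have vs: "set vs \<subseteq> vals ar C" using \<open>evals ar D C R K ts n K' vs\<close> eval_vals(2) by blast
  have s: "sem (Fun f vs) v" "list_all2 sem ts vs" "\<forall>(t, v)\<in>K''. sem t v" using Split by auto
  from s(1) obtain ps r \<sigma> where "(Fun f ps, r) \<in> R" "map (subst \<sigma>) ps = vs" "sem (subst \<sigma> r) v"
    using \<open>f \<in> D\<close> list_all2_sem_vals[OF vs] by (metis sem_opE)
  then show ?case using s \<open>f \<in> D\<close> by (blast intro: sem.op)
next
  case (Update vs f v K ps r \<sigma> m K')
  then have "sem (Fun f vs) v"
    using rule_head list_all2_sem_vals by (blast intro: sem.op)
  with Update show ?case by auto
qed (auto intro: sem.con)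

section \<open>The invariant of heap and cache\<close>

primrec inst :: "(nat \<Rightarrow> ('f, 'v) trm) \<Rightarrow> ('f, nat) trm \<Rightarrow> ('f, 'v) trm" where
  "inst V (Var i) = V i"
| "inst V (Fun s us) = Fun s (map (inst V) us)"

text \<open>\<open>V\<close> maps the numbers of the constructor rows to the values they represent.\<close>

definition ids :: "'f row list \<Rightarrow> nat set" where
  "ids T = {i. i < length T \<and> fst (T ! i) \<in> C}"

text \<open>The condition \<open>a < i\<close> makes the heap well-founded: it supports induction
  over nodes, shows that the output is acyclic and justifies collecting in a single pass.\<close>

definition con_row :: "(nat \<Rightarrow> ('f, 'v) trm) \<Rightarrow> 'f row list \<Rightarrow> nat \<Rightarrow> bool" where
  "con_row V T i \<longleftrightarrow> (\<exists>as. snd (T ! i) = i # i # pad as \<and> length as = ar (fst (T ! i)) \<and>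
     (\<forall>a\<in>set as. a < i \<and> fst (T ! a) \<in> C) \<and> V i = Fun (fst (T ! i)) (map V as))"

definition op_row :: "(nat \<Rightarrow> ('f, 'v) trm) \<Rightarrow> 'f row list \<Rightarrow> nat \<Rightarrow> ('f, 'v) trm \<Rightarrow> ('f, 'v) trm \<Rightarrow> bool" where
  "op_row V T i t v \<longleftrightarrow> (\<exists>as r. fst (T ! i) \<in> D \<and> snd (T ! i) = i # r # pad as \<and> length as = ar (fst (T ! i)) \<and>
     set as \<subseteq> ids T \<and> r \<in> ids T \<and> t = Fun (fst (T ! i)) (map V as) \<and> v = V r)"

text \<open>Injectivity of \<open>V\<close> on the nodes is maximal sharing. The rows of operations
  and the cache correspond in both directions, so a look-up succeeds exactly for the calls that the
  cache knows. One pair may have several rows; soundness of the cache makes their results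
  agree.\<close>

definition heap_inv :: "(nat \<Rightarrow> ('f, 'v) trm) \<Rightarrow> 'f row list \<Rightarrow> ('f, 'v) cache \<Rightarrow> bool" where
  "heap_inv V T K \<longleftrightarrow> (\<forall>i\<in>ids T. con_row V T i) \<and> inj_on V (ids T) \<and>
     (\<forall>i<length T. i \<in> ids T \<or> (\<exists>(t, v)\<in>K. op_row V T i t v)) \<and>
     (\<forall>(t, v)\<in>K. \<exists>i<length T. op_row V T i t v) \<and> (\<forall>(t, v)\<in>K. sem t v)"

lemma invD:
  assumes "heap_inv V T K"
  shows "i \<in> ids T \<Longrightarrow> con_row V T i" "inj_on V (ids T)"
    "i < length T \<Longrightarrow> i \<in> ids T \<or> (\<exists>t v. (t, v) \<in> K \<and> op_row V T i t v)"
    "(t, v) \<in> K \<Longrightarrow> \<exists>i<length T. op_row V T i t v" "(t, v) \<in> K \<Longrightarrow> sem t v"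
  using assms unfolding heap_inv_def by blast+

lemma invI:
  assumes "\<And>i. i \<in> ids T \<Longrightarrow> con_row V T i" "inj_on V (ids T)"
    "\<And>i. i < length T \<Longrightarrow> i \<in> ids T \<or> (\<exists>t v. (t, v) \<in> K \<and> op_row V T i t v)"
    "\<And>t v. (t, v) \<in> K \<Longrightarrow> \<exists>i<length T. op_row V T i t v" "\<And>t v. (t, v) \<in> K \<Longrightarrow> sem t v"
  shows "heap_inv V T K"
  using assms unfolding heap_inv_def by blast

text \<open>Guarantees that numbers on the stacks and in pending code keep their meaning while the
  table grows.\<close>

definition ext :: "(nat \<Rightarrow> ('f, 'v) trm) \<Rightarrow> 'f row list \<Rightarrow> (nat \<Rightarrow> ('f, 'v) trm) \<Rightarrow> 'f row list \<Rightarrow> bool" where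
  "ext V T V' T' \<longleftrightarrow> (\<exists>xs. T' = T @ xs) \<and> (\<forall>i\<in>ids T. V' i = V i)"

lemma ids_append: "ids T \<subseteq> ids (T @ xs)"
  by (auto simp: ids_def nth_append)

lemma ext_ids: "ext V T V' T' \<Longrightarrow> ids T \<subseteq> ids T'"
  using ids_append by (auto simp: ext_def)

lemma ext_refl: "ext V T V T"
  by (auto simp: ext_def)

lemma ext_trans: "ext V T V' T' \<Longrightarrow> ext V' T' V'' T'' \<Longrightarrow> ext V T V'' T''"
  using ids_append by (fastforce simp: ext_def)

lemma inst_ext: "ext V T V' T' \<Longrightarrow> vars_trm u \<subseteq> ids T \<Longrightarrow> inst V' u = inst V u"
  by (induction u) (auto simp: ext_def)

lemma map_ext_ids: "ext V T V' T' \<Longrightarrow> set as \<subseteq> ids T \<Longrightarrow> map V' as = map V as"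
  by (auto simp: ext_def)

lemma pad_inj: "length as = length bs \<Longrightarrow> pad as = pad bs \<longleftrightarrow> as = bs"
  by (auto simp: pad_def)

lemma lookup_Some:
  assumes "lookup T s fr = Some v"
  obtains i where "i < length T" "fst (T ! i) = s" "drop 2 (snd (T ! i)) = fr" "snd (T ! i) ! 1 = v"
proof -
  let ?P = "\<lambda>rw. \<not> (fst rw = s \<and> drop 2 (snd rw) = fr)"
  obtain rw T1 where dw: "dropWhile ?P T = rw # T1" and v: "v = snd rw ! 1"
    using assms by (auto simp: lookup_def split: list.splits)
  have "\<not> ?P rw" using hd_dropWhile[of ?P T] unfolding dw list.sel by simp
  moreover have "rw \<in> set (dropWhile ?P T)" by (simp only: dw list.set_intros)
  then have "rw \<in> set T" by (rule set_dropWhileD)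
  ultimately show ?thesis using that v by (auto simp: in_set_conv_nth)
qed

lemma lookup_None:
  "lookup T s fr = None \<Longrightarrow> i < length T \<Longrightarrow> fst (T ! i) = s \<Longrightarrow> drop 2 (snd (T ! i)) \<noteq> fr"
  by (auto simp: lookup_def split: list.splits)

lemma inv_vals: "heap_inv V T K \<Longrightarrow> i \<in> ids T \<Longrightarrow> V i \<in> vals ar C"
proof (induction i rule: less_induct)
  case (less i)
  then have "con_row V T i" by (simp add: invD)
  then obtain as where as: "length as = ar (fst (T ! i))" "\<forall>a\<in>set as. a < i \<and> fst (T ! a) \<in> C"
    "V i = Fun (fst (T ! i)) (map V as)" by (auto simp: con_row_def)
  have "V a \<in> vals ar C" if "a \<in> set as" for a
    using less that as(2) by (auto simp: ids_def)
  then show ?case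
    using as less.prems(2) by (auto simp: ids_def intro!: terms.Fun)
qed

lemma op_row_ext:
  assumes "op_row V T i t v" "i < length T" "ext V T V' T'"
  shows "op_row V' T' i t v"
proof -
  obtain as r where as: "fst (T ! i) \<in> D" "snd (T ! i) = i # r # pad as" "length as = ar (fst (T ! i))"
    "set as \<subseteq> ids T" "r \<in> ids T" "t = Fun (fst (T ! i)) (map V as)" "v = V r"
    using assms(1) unfolding op_row_def by blast
  have "T' ! i = T ! i" using assms(2,3) by (auto simp: ext_def nth_append)
  moreover have "map V' as = map V as" "V' r = V r"
    using as(4,5) assms(3) map_ext_ids by (auto simp: ext_def)
  moreover have "ids T \<subseteq> ids T'" using assms(3) by (rule ext_ids)
  ultimately show ?thesis
    unfolding op_row_def using as by (intro exI[of _ as] exI[of _ r]) auto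
qed

lemma con_row_ext:
  assumes "con_row V T i" "i \<in> ids T" "ext V T V' T'"
  shows "con_row V' T' i"
proof -
  obtain as where as: "snd (T ! i) = i # i # pad as" "length as = ar (fst (T ! i))"
    "\<forall>a\<in>set as. a < i \<and> fst (T ! a) \<in> C" "V i = Fun (fst (T ! i)) (map V as)"
    using assms(1) unfolding con_row_def by blast
  have i: "i < length T" using assms(2) by (simp add: ids_def)
  have T': "T' ! a = T ! a" if "a \<le> i" for a
    using assms(3) i that by (auto simp: ext_def nth_append)
  have "set as \<subseteq> ids T" using as(3) i by (auto simp: ids_def)
  then have "map V' as = map V as" "V' i = V i"
    using assms(2,3) map_ext_ids by (auto simp: ext_def)
  then show ?thesis
    unfolding con_row_def using as T' by (intro exI[of _ as]) auto
qed

lemma inv_new_con: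
  assumes heap_inv: "heap_inv V T K" and c: "c \<in> C" "length as = ar c" "set as \<subseteq> ids T"
    and new: "\<forall>i\<in>ids T. V i \<noteq> Fun c (map V as)"
  shows "heap_inv (V(length T := Fun c (map V as))) (T @ [(c, length T # length T # pad as)]) K"
    (is "heap_inv ?V ?T K")
proof -
  let ?n = "length T"
  have ids: "ids ?T = insert ?n (ids T)"
    using c by (auto simp: ids_def nth_append less_Suc_eq)
  have lt: "i < ?n" if "i \<in> ids T" for i using that by (simp add: ids_def)
  have V: "?V i = V i" if "i \<in> ids T" for i using lt[OF that] by simp
  have ext: "ext V T ?V ?T" unfolding ext_def using V by blast
  show ?thesis
  proof (rule invI)
    fix i assume i: "i \<in> ids ?T"
    show "con_row ?V ?T i"
    proof (cases "i = ?n")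
      case True
      have "map ?V as = map V as" using map_ext_ids[OF ext c(3)] .
      moreover have "a < ?n \<and> fst (?T ! a) \<in> C" if "a \<in> set as" for a
      proof -
        have "a \<in> ids T" using that c(3) by (rule rev_subsetD)
        then show ?thesis by (simp add: ids_def nth_append)
      qed
      moreover have "?T ! ?n = (c, ?n # ?n # pad as)" by simp
      moreover have "?V ?n = Fun c (map V as)" by simp
      ultimately show ?thesis
        unfolding con_row_def True using c(2) by (intro exI[of _ as] conjI ballI) (simp_all only: fst_conv snd_conv)
    next
      case False
      then have "i \<in> ids T" using i unfolding ids by simp
      then show ?thesis by (intro con_row_ext[OF invD(1)[OF heap_inv] _ ext])
    qed
  next
    have "inj_on ?V (ids T)"
      using invD(2)[OF heap_inv] by (rule inj_on_cong[THEN iffD2, rotated]) (rule V)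
    moreover have "?V ?n \<notin> ?V ` ids T"
    proof
      assume "?V ?n \<in> ?V ` ids T"
      then obtain i where i: "i \<in> ids T" "?V ?n = ?V i" by (elim imageE)
      from i(2) have "V i = Fun c (map V as)" unfolding V[OF i(1)] by simp
      then show False using new i(1) by blast
    qed
    moreover have "ids T - {?n} = ids T" using lt by blast
    ultimately show "inj_on ?V (ids ?T)"
      unfolding ids inj_on_insert by simp
  next
    fix i assume "i < length ?T"
    then have "i = ?n \<or> i < ?n" by auto
    then show "i \<in> ids ?T \<or> (\<exists>t v. (t, v) \<in> K \<and> op_row ?V ?T i t v)"
    proof
      assume i: "i < ?n"
      then consider "i \<in> ids T" | t v where "(t, v) \<in> K" "op_row V T i t v"
        using invD(3)[OF heap_inv] by blast
      then show ?thesis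
      proof cases
        case 2
        then show ?thesis using op_row_ext[OF 2(2) i ext] by blast
      qed (simp add: ids)
    qed (simp add: ids)
  next
    fix t v assume "(t, v) \<in> K"
    then obtain i where "i < ?n" "op_row V T i t v" using invD(4)[OF heap_inv] by blast
    then show "\<exists>i<length ?T. op_row ?V ?T i t v"
      using op_row_ext[OF _ _ ext] by (intro exI[of _ i]) simp
  qed (rule invD(5)[OF heap_inv])
qed

lemma inv_new_op:
  assumes heap_inv: "heap_inv V T K" and f: "f \<in> D" "length as = ar f" "set as \<subseteq> ids T" "r \<in> ids T"
    and sem: "sem (Fun f (map V as)) (V r)"
  shows "heap_inv V (T @ [(f, length T # r # pad as)]) (insert (Fun f (map V as), V r) K)"
    (is "heap_inv V ?T ?K")
proof -
  let ?n = "length T"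
  have ids: "ids ?T = ids T"
    using f D_C by (auto simp: ids_def nth_append less_Suc_eq)
  have ext: "ext V T V ?T" unfolding ext_def by blast
  have new: "op_row V ?T ?n (Fun f (map V as)) (V r)"
    unfolding op_row_def ids using f by (intro exI[of _ as] exI[of _ r]) simp
  show ?thesis
  proof (rule invI)
    fix i assume "i \<in> ids ?T"
    then show "con_row V ?T i" using con_row_ext[OF invD(1)[OF heap_inv] _ ext] ids by blast
  next
    show "inj_on V (ids ?T)" unfolding ids by (rule invD(2)[OF heap_inv])
  next
    fix i assume "i < length ?T"
    then have "i = ?n \<or> i < ?n" by auto
    then show "i \<in> ids ?T \<or> (\<exists>t v. (t, v) \<in> ?K \<and> op_row V ?T i t v)"
    proof
      assume "i = ?n"
      then show ?thesis using new by blast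
    next
      assume i: "i < ?n"
      then consider "i \<in> ids T" | t v where "(t, v) \<in> K" "op_row V T i t v"
        using invD(3)[OF heap_inv] by blast
      then show ?thesis
      proof cases
        case 2
        then show ?thesis using op_row_ext[OF 2(2) i ext] by blast
      qed (simp add: ids)
    qed
  next
    fix t v assume "(t, v) \<in> ?K"
    then consider "t = Fun f (map V as)" "v = V r" | "(t, v) \<in> K" by blast
    then show "\<exists>i<length ?T. op_row V ?T i t v"
    proof cases
      case 1
      then show ?thesis using new by (intro exI[of _ ?n]) simp
    next
      case 2
      then obtain i where "i < ?n" "op_row V T i t v" using invD(4)[OF heap_inv] by blast
      then show ?thesis using op_row_ext[OF _ _ ext] by (intro exI[of _ i]) simp
    qed
  next
    fix t v assume "(t, v) \<in> ?K"
    then show "sem t v" using invD(5)[OF heap_inv] sem by blast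
  qed
qed

text \<open>If the search fails, the value is new: an older node with this value would have the same
  argument values, hence by injectivity of \<open>V\<close> the same argument numbers, and the
  search would have found it.\<close>

lemma con_step:
  assumes heap_inv: "heap_inv V T K" and c: "c \<in> C" "length as = ar c" "set as \<subseteq> ids T" and k: "enters k c as xs"
  shows "\<exists>V' T' i. astep (k # ks, xs @ vs, frs, T) (ks, i # vs, frs, T') \<and> heap_inv V' T' K \<and> ext V T V' T' \<and>
    i \<in> ids T' \<and> V' i = Fun c (map V as)"
proof (cases "lookup T c (pad as)")
  case None
  let ?V = "V(length T := Fun c (map V as))" and ?T = "T @ [(c, length T # length T # pad as)]"
  have "V i \<noteq> Fun c (map V as)" if i: "i \<in> ids T" for i
  proof
    assume eq: "V i = Fun c (map V as)"
    from heap_inv i have "con_row V T i" by (simp add: invD)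
    then obtain bs where bs: "snd (T ! i) = i # i # pad bs"
     "\<forall>a\<in>set bs. a < i \<and> fst (T ! a) \<in> C" "V i = Fun (fst (T ! i)) (map V bs)"
      by (auto simp: con_row_def)
    have "set bs \<subseteq> ids T" using bs(2) i by (auto simp: ids_def)
    moreover have "inj_on V (ids T)" using heap_inv by (rule invD)
    ultimately have "bs = as"
      using eq bs(3) c(3) map_injective inj_on_map_eq_map[of V bs as] by (metis inj_on_subset trm.inject(2) Un_subset_iff)
    moreover have "fst (T ! i) = c" using eq bs(3) by simp
    ultimately show False
      using lookup_None[OF None, of i] i bs(1) by (simp add: ids_def)
  qed
  then have "heap_inv ?V ?T K" using inv_new_con[OF heap_inv c] by blast
  moreover have "ext V T ?V ?T" by (auto simp: ext_def ids_def)
  moreover have "length T \<in> ids ?T" using c by (simp add: ids_def)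
  ultimately show ?thesis
    using astep.new[OF k c(1,2) None refl] by (intro exI[of _ ?V] exI[of _ ?T] exI[of _ "length T"]) simp
next
  case (Some v)
  then obtain i where i: "i < length T" "fst (T ! i) = c" "drop 2 (snd (T ! i)) = pad as" "snd (T ! i) ! 1 = v"
    by (rule lookup_Some)
  then have "i \<in> ids T" using c by (simp add: ids_def)
  moreover with heap_inv have "con_row V T i" by (simp add: invD)
  then obtain bs where bs: "snd (T ! i) = i # i # pad bs" "length bs = ar c" "V i = Fun c (map V bs)"
    by (auto simp: con_row_def i)
  then have "bs = as" "v = i" using i c pad_inj[of bs as] by auto
  ultimately show ?thesis
    using astep.hit[OF k _ c(2) Some] heap_inv ext_refl bs c(1)
    by (intro exI[of _ V] exI[of _ T] exI[of _ i]) auto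
qed

section \<open>Simulation of derivations\<close>

definition reach :: "nat \<Rightarrow> 'f config \<Rightarrow> 'f config \<Rightarrow> bool" where
  "reach N c c' \<longleftrightarrow> (\<exists>j\<le>N. (astep ^^ j) c c')"

lemma reach_refl: "reach 0 c c"
  by (auto simp: reach_def)

lemma reach_step: "astep c c' \<Longrightarrow> reach 1 c c'"
  unfolding reach_def by (intro exI[of _ 1]) auto

lemma reach_trans: "reach M c c' \<Longrightarrow> reach N c' c'' \<Longrightarrow> M + N \<le> N' \<Longrightarrow> reach N' c c''"
  unfolding reach_def by (meson add_mono order_trans relpowp_trans)

text \<open>Quantifies over all terms \<open>u\<close> that stand for \<open>t\<close>, where a
  variable of \<open>u\<close> may replace a whole value in \<open>t\<close>. The number of steps
  depends on \<open>u\<close>, so it does not matter how large \<open>t\<close> is.\<close>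

definition sim_trm :: "('f, 'v) cache \<Rightarrow> ('f, 'v) trm \<Rightarrow> nat \<Rightarrow> ('f, 'v) cache \<Rightarrow> ('f, 'v) trm \<Rightarrow> bool" where
  "sim_trm K t m K' v \<longleftrightarrow> (\<forall>V T u ks ss frs. heap_inv V T K \<longrightarrow> inst V u = t \<longrightarrow> vars_trm u \<subseteq> ids T \<longrightarrow>
     (\<exists>V' T' i. reach (trm_size u + m * rules_size) (code u @ ks, ss, frs, T) (ks, i # ss, frs, T') \<and>
        heap_inv V' T' K' \<and> ext V T V' T' \<and> i \<in> ids T' \<and> V' i = v))"

definition sim_list :: "('f, 'v) cache \<Rightarrow> ('f, 'v) trm list \<Rightarrow> nat \<Rightarrow> ('f, 'v) cache \<Rightarrow> ('f, 'v) trm list \<Rightarrow> bool" where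
  "sim_list K ts m K' vs \<longleftrightarrow> (\<forall>V T us ks ss frs. heap_inv V T K \<longrightarrow> map (inst V) us = ts \<longrightarrow> (\<forall>u\<in>set us. vars_trm u \<subseteq> ids T) \<longrightarrow>
     (\<exists>V' T' as. reach (sum_list (map trm_size us) + m * rules_size)
          (concat (map code us) @ ks, ss, frs, T) (ks, rev as @ ss, frs, T') \<and>
        heap_inv V' T' K' \<and> ext V T V' T' \<and> set as \<subseteq> ids T' \<and> map V' as = vs))"

text \<open>The second premise of (Split) evaluates a call on values that the machine does not push
  again. Hence this separate notion for a call whose arguments already lie on the value stack; the
  summand 1 is the token of the call.\<close>

definition sim_app :: "('f, 'v) cache \<Rightarrow> 'f \<Rightarrow> ('f, 'v) trm list \<Rightarrow> nat \<Rightarrow> ('f, 'v) cache \<Rightarrow> ('f, 'v) trm \<Rightarrow> bool" where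
  "sim_app K f vs m K' v \<longleftrightarrow> (\<forall>V T as k xs ks ss frs. heap_inv V T K \<longrightarrow> map V as = vs \<longrightarrow> set as \<subseteq> ids T \<longrightarrow> enters k f as xs \<longrightarrow>
     (\<exists>V' T' i. reach (1 + m * rules_size) (k # ks, xs @ ss, frs, T) (ks, i # ss, frs, T') \<and>
        heap_inv V' T' K' \<and> ext V T V' T' \<and> i \<in> ids T' \<and> V' i = v))"

lemma V_not_op: "heap_inv V T K \<Longrightarrow> i \<in> ids T \<Longrightarrow> V i = Fun f ts \<Longrightarrow> f \<in> C"
  using inv_vals[of V T K i] by (auto elim: terms.cases)

lemma sim_Nil: "sim_list K [] 0 K []"
  unfolding sim_list_def
proof (intro allI impI)
  fix V T and us :: "('f, nat) trm list" and ks :: "'f tok list" and ss frs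
  assume "heap_inv V T K" "map (inst V) us = []"
  then show "\<exists>V' T' as. reach (sum_list (map trm_size us) + 0 * rules_size)
          (concat (map code us) @ ks, ss, frs, T) (ks, rev as @ ss, frs, T') \<and>
        heap_inv V' T' K \<and> ext V T V' T' \<and> set as \<subseteq> ids T' \<and> map V' as = []"
    by (intro exI[of _ V] exI[of _ T] exI[of _ "[]"]) (simp add: reach_refl ext_refl)
qed

lemma sim_Cons:
  assumes "sim_trm K t n K' v" "sim_list K' ts n' K'' vs"
  shows "sim_list K (t # ts) (n + n') K'' (v # vs)"
  unfolding sim_list_def
proof (intro allI impI)
  fix V T and us :: "('f, nat) trm list" and ks :: "'f tok list" and ss frs
  assume heap_inv: "heap_inv V T K" and us: "map (inst V) us = t # ts" "\<forall>u\<in>set us. vars_trm u \<subseteq> ids T"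
  then obtain u us' where u: "us = u # us'" "inst V u = t" "map (inst V) us' = ts" by auto
  obtain V1 T1 i where 1: "reach (trm_size u + n * rules_size) (code u @ concat (map code us') @ ks, ss, frs, T)
      (concat (map code us') @ ks, i # ss, frs, T1)"
    "heap_inv V1 T1 K'" "ext V T V1 T1" "i \<in> ids T1" "V1 i = v"
    using assms(1)[unfolded sim_trm_def, rule_format, OF heap_inv u(2), of "concat (map code us') @ ks" ss frs]
      us(2) u(1) by auto
  have "map (inst V1) us' = ts" using u us(2) inst_ext[OF 1(3)] by auto
  moreover have "\<forall>u\<in>set us'. vars_trm u \<subseteq> ids T1" using us(2) u ext_ids[OF 1(3)] by auto
  ultimately obtain V2 T2 as where 2: "reach (sum_list (map trm_size us') + n' * rules_size)
      (concat (map code us') @ ks, i # ss, frs, T1) (ks, rev as @ i # ss, frs, T2)"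
    "heap_inv V2 T2 K''" "ext V1 T1 V2 T2" "set as \<subseteq> ids T2" "map V2 as = vs"
    using assms(2) 1(2) unfolding sim_list_def by blast
  have "reach (sum_list (map trm_size us) + (n + n') * rules_size)
          (concat (map code us) @ ks, ss, frs, T) (ks, rev (i # as) @ ss, frs, T2)"
    using reach_trans[OF 1(1) 2(1)] by (simp add: u(1) algebra_simps)
  moreover have "map V2 (i # as) = v # vs" "set (i # as) \<subseteq> ids T2"
    using 1 2 ext_ids[OF 2(3)] by (auto simp: ext_def)
  ultimately show "\<exists>V' T' as. reach (sum_list (map trm_size us) + (n + n') * rules_size)
          (concat (map code us) @ ks, ss, frs, T) (ks, rev as @ ss, frs, T') \<and>
        heap_inv V' T' K'' \<and> ext V T V' T' \<and> set as \<subseteq> ids T' \<and> map V' as = v # vs"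
    using 2(2) ext_trans[OF 1(3) 2(3)]
    by (intro exI[of _ V2] exI[of _ T2] exI[of _ "i # as"] conjI)
qed

lemma sim_con:
  assumes "sim_list K ts n K' vs" "c \<in> C" "length ts = ar c" "length vs = length ts"
    and triv: "set ts \<subseteq> vals ar C \<Longrightarrow> n = 0 \<and> K' = K \<and> vs = ts"
  shows "sim_trm K (Fun c ts) n K' (Fun c vs)"
  unfolding sim_trm_def
proof (intro allI impI)
  fix V T u and ks :: "'f tok list" and ss frs
  assume heap_inv: "heap_inv V T K" and u: "inst V u = Fun c ts" "vars_trm u \<subseteq> ids T"
  show "\<exists>V' T' i. reach (trm_size u + n * rules_size) (code u @ ks, ss, frs, T) (ks, i # ss, frs, T') \<and>
        heap_inv V' T' K' \<and> ext V T V' T' \<and> i \<in> ids T' \<and> V' i = Fun c vs"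
  proof (cases u)
    \<comment> \<open>The machine has a row number where the derivation evaluates a whole value once
      more. By \<open>triv\<close> that evaluation changes nothing, so one push suffices.\<close>
    case (Var i)
    then have i: "i \<in> ids T" "V i = Fun c ts" using u by auto
    then have "Fun c ts \<in> vals ar C" using inv_vals[OF heap_inv i(1)] by simp
    then have "set ts \<subseteq> vals ar C" by (auto elim: terms.cases)
    then have "n = 0" "K' = K" "vs = ts" using triv by auto
    then show ?thesis
      using reach_step[OF astep.push] heap_inv i
      by (intro exI[of _ V] exI[of _ T] exI[of _ i]) (simp add: Var ext_refl)
  next
    case (Fun s us)
    with u have us: "s = c" "map (inst V) us = ts" "\<forall>u\<in>set us. vars_trm u \<subseteq> ids T" by auto
    obtain V1 T1 as where 1: "reach (sum_list (map trm_size us) + n * rules_size)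
        (concat (map code us) @ TApp c # ks, ss, frs, T) (TApp c # ks, rev as @ ss, frs, T1)"
      "heap_inv V1 T1 K'" "ext V T V1 T1" "set as \<subseteq> ids T1" "map V1 as = vs"
      using assms(1) heap_inv us unfolding sim_list_def by blast
    have "length as = ar c" using 1(5) assms(3,4) by auto
    moreover have "enters (TApp c) c as (rev as)" by (simp add: enters_def)
    ultimately obtain V2 T2 i where 2: "astep (TApp c # ks, rev as @ ss, frs, T1) (ks, i # ss, frs, T2)"
      "heap_inv V2 T2 K'" "ext V1 T1 V2 T2" "i \<in> ids T2" "V2 i = Fun c (map V1 as)"
      using con_step[OF 1(2) assms(2) _ 1(4)] by meson
    have "reach (trm_size u + n * rules_size) (code u @ ks, ss, frs, T) (ks, i # ss, frs, T2)"
      using reach_trans[OF 1(1) reach_step[OF 2(1)]] by (simp add: Fun us(1))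
    then show ?thesis
      using 2 1(5) ext_trans[OF 1(3) 2(3)] by blast
  qed
qed

lemma sim_split:
  assumes "sim_list K ts n K' vs" "sim_app K' f vs n' K'' v" "f \<in> D"
  shows "sim_trm K (Fun f ts) (n' + n) K'' v"
  unfolding sim_trm_def
proof (intro allI impI)
  fix V T u and ks :: "'f tok list" and ss frs
  assume heap_inv: "heap_inv V T K" and u: "inst V u = Fun f ts" "vars_trm u \<subseteq> ids T"
  show "\<exists>V' T' i. reach (trm_size u + (n' + n) * rules_size) (code u @ ks, ss, frs, T) (ks, i # ss, frs, T') \<and>
        heap_inv V' T' K'' \<and> ext V T V' T' \<and> i \<in> ids T' \<and> V' i = v"
  proof (cases u)
    case (Var i)
    then have "f \<in> C" using u V_not_op[OF heap_inv, of i f ts] by simp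
    then show ?thesis using D_C[OF assms(3)] by contradiction
  next
    case (Fun s us)
    with u have us: "s = f" "map (inst V) us = ts" "\<forall>u\<in>set us. vars_trm u \<subseteq> ids T" by auto
    obtain V1 T1 as where 1: "reach (sum_list (map trm_size us) + n * rules_size)
        (concat (map code us) @ TApp f # ks, ss, frs, T) (TApp f # ks, rev as @ ss, frs, T1)"
      "heap_inv V1 T1 K'" "ext V T V1 T1" "set as \<subseteq> ids T1" "map V1 as = vs"
      using assms(1) heap_inv us unfolding sim_list_def by blast
    have "enters (TApp f) f as (rev as)" by (simp add: enters_def)
    then obtain V2 T2 i where 2: "reach (1 + n' * rules_size) (TApp f # ks, rev as @ ss, frs, T1) (ks, i # ss, frs, T2)"
      "heap_inv V2 T2 K''" "ext V1 T1 V2 T2" "i \<in> ids T2" "V2 i = v"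
      using assms(2) 1 unfolding sim_app_def by blast
    have "reach (trm_size u + (n' + n) * rules_size) (code u @ ks, ss, frs, T) (ks, i # ss, frs, T2)"
      using reach_trans[OF 1(1) 2(1)] by (simp add: Fun us(1) algebra_simps)
    then show ?thesis
      using 2 ext_trans[OF 1(3) 2(3)] by blast
  qed
qed

text \<open>Lets a direct (Read) or (Update) be treated like a (Split) preceded by trivial
  evaluations of its arguments (\<open>sim_trm_of_app\<close>).\<close>

lemma sim_vals:
  assumes "set vs \<subseteq> vals ar C"
  shows "sim_list K vs 0 K vs"
  using assms
proof (induction vs)
  case Nil
  show ?case by (rule sim_Nil)
next
  case (Cons v vs)
  have "sim_trm K v 0 K v" if "v \<in> vals ar C" for v
    using that
  proof (induction v rule: trm.induct)
    case (Fun c ts)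
    have ts: "c \<in> C" "length ts = ar c" "set ts \<subseteq> vals ar C"
      using Fun.prems by (auto elim: terms.cases)
    have "\<forall>t\<in>set ts. sim_trm K t 0 K t" using Fun.IH ts(3) by blast
    then have "sim_list K ts 0 K ts"
    proof (induction ts)
      case (Cons t ts)
      then show ?case using sim_Cons[of K t 0 K t ts 0 K ts] by simp
    qed (simp add: sim_Nil)
    then show ?case using sim_con[OF _ ts(1,2) refl] by simp
  qed (auto elim: terms.cases)
  with Cons show ?case using sim_Cons[of K v 0 K v vs 0 K vs] by simp
qed

lemma lookup_op:
  assumes heap_inv: "heap_inv V T K" and f: "f \<in> D" and as: "length as = ar f" "set as \<subseteq> ids T"
    and l: "lookup T f (pad as) = Some i"
  shows "i \<in> ids T \<and> sem (Fun f (map V as)) (V i) \<and> (Fun f (map V as), V i) \<in> K"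
proof -
  obtain j where j: "j < length T" "fst (T ! j) = f" "drop 2 (snd (T ! j)) = pad as" "snd (T ! j) ! 1 = i"
    using l by (rule lookup_Some)
  have "j \<notin> ids T" using j f D_C by (auto simp: ids_def)
  then obtain t v where tv: "(t, v) \<in> K" "op_row V T j t v"
    using invD(3)[OF heap_inv j(1)] by blast
  then obtain bs r where "snd (T ! j) = j # r # pad bs" "length bs = ar f" "r \<in> ids T" "t = Fun f (map V bs)" "v = V r"
    unfolding op_row_def j(2) by blast
  moreover from this have "bs = as" "r = i" using j pad_inj[of bs as] as by auto
  ultimately show ?thesis using tv(1) invD(5)[OF heap_inv] by auto
qed

text \<open>The search may stop at another row for the same call than the one belonging to the given
  pair; by \<open>sem_det\<close> its result represents the same value.\<close>

lemma sim_read: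
  assumes K: "K \<in> caches ar D C" "(Fun f vs, v) \<in> K"
  shows "sim_app K f vs 0 K v"
  unfolding sim_app_def
proof (intro allI impI)
  fix V T as k xs ss frs and ks :: "'f tok list"
  assume heap_inv: "heap_inv V T K" and as: "map V as = vs" "set as \<subseteq> ids T" and k: "enters k f as xs"
  have f: "f \<in> D" "length vs = ar f" using K by (auto simp: caches_def)
  then have len: "length as = ar f" using as by auto
  have "lookup T f (pad as) \<noteq> None"
  proof
    assume none: "lookup T f (pad as) = None"
    obtain i where i: "i < length T" "op_row V T i (Fun f vs) v"
      using invD(4)[OF heap_inv K(2)] by blast
    then obtain bs r where bs: "fst (T ! i) = f" "snd (T ! i) = i # r # pad bs" "set bs \<subseteq> ids T" "vs = map V bs"
      unfolding op_row_def by auto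
    have "inj_on V (set as \<union> set bs)" using invD(2)[OF heap_inv] as(2) bs(3) by (auto intro: inj_on_subset)
    then have "bs = as" using as(1) bs(4) inj_on_map_eq_map[of V bs as] by (simp add: Un_commute)
    then show False using lookup_None[OF none i(1) bs(1)] bs(2) by simp
  qed
  then obtain i where l: "lookup T f (pad as) = Some i" by blast
  note i = lookup_op[OF heap_inv f(1) len as(2) l]
  then have "V i = v" using invD(5)[OF heap_inv K(2)] as(1) sem_det by blast
  moreover have "reach (1 + 0 * rules_size) (k # ks, xs @ ss, frs, T) (ks, i # ss, frs, T)"
    using reach_step[OF astep.hit[OF k _ len l]] f(1) by simp
  ultimately show "\<exists>V' T' i. reach (1 + 0 * rules_size) (k # ks, xs @ ss, frs, T) (ks, i # ss, frs, T') \<and>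
        heap_inv V' T' K \<and> ext V T V' T' \<and> i \<in> ids T' \<and> V' i = v"
    using heap_inv i ext_refl by blast
qed

section \<open>Correctness of matching\<close>

lemma row_args_eq:
  assumes heap_inv: "heap_inv V T K" and i: "i \<in> ids T"
  obtains as where "map (\<lambda>j. snd (T ! i) ! (j + 2)) [0..<ar (fst (T ! i))] = as"
    "length as = ar (fst (T ! i))" "set as \<subseteq> ids T" "V i = Fun (fst (T ! i)) (map V as)"
proof -
  obtain as where as: "snd (T ! i) = i # i # pad as" "length as = ar (fst (T ! i))"
    "\<forall>a\<in>set as. a < i \<and> fst (T ! a) \<in> C" "V i = Fun (fst (T ! i)) (map V as)"
    using invD(1)[OF heap_inv i] unfolding con_row_def by blast
  have "map (\<lambda>j. snd (T ! i) ! (j + 2)) [0..<ar (fst (T ! i))] = as"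
    by (rule nth_equalityI) (auto simp: as(1,2) pad_def nth_append)
  moreover have "set as \<subseteq> ids T" using as(3) i by (auto simp: ids_def)
  ultimately show ?thesis using that as by blast
qed

lemma pmatch_complete:
  assumes "heap_inv V T K" "set xs \<subseteq> ids T" "set ps \<subseteq> terms ar C UNIV" "map (subst \<sigma>) ps = map V xs"
  shows "\<exists>\<rho>'. pmatch T ps xs \<rho> = (True, [], \<rho>') \<and>
    (\<forall>x\<in>\<Union> (vars_trm ` set ps). \<rho>' x \<noteq> [] \<and> V (hd (\<rho>' x)) = \<sigma> x \<and> hd (\<rho>' x) \<in> ids T)"
  using assms
proof (induction T ps xs \<rho> rule: pmatch.induct)
  case (1 T xs \<rho>)
  then show ?case by simp
next
  case (2 T p ps \<rho>)
  then show ?case by simp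
next
  case (3 T x ps i xs \<rho>)
  note p = "3.prems"
  have "\<exists>\<rho>'. pmatch T ps xs (\<rho>(x := i # \<rho> x)) = (True, [], \<rho>') \<and>
    (\<forall>x\<in>\<Union> (vars_trm ` set ps). \<rho>' x \<noteq> [] \<and> V (hd (\<rho>' x)) = \<sigma> x \<and> hd (\<rho>' x) \<in> ids T)"
    by (rule "3.IH"[OF p(1)]) (use p in auto)
  then obtain \<rho>' where r: "pmatch T ps xs (\<rho>(x := i # \<rho> x)) = (True, [], \<rho>')"
    "\<forall>x\<in>\<Union> (vars_trm ` set ps). \<rho>' x \<noteq> [] \<and> V (hd (\<rho>' x)) = \<sigma> x \<and> hd (\<rho>' x) \<in> ids T" by blast
  have len: "length xs = length ps" using arg_cong[OF p(4), of length] by simp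
  have "\<rho>' x \<noteq> [] \<and> V (hd (\<rho>' x)) = \<sigma> x \<and> hd (\<rho>' x) \<in> ids T"
  proof (cases "x \<in> \<Union> (vars_trm ` set ps)")
    case True
    then show ?thesis using r(2) by blast
  next
    case False
    then have "\<rho>' x = i # \<rho> x" using pmatch_vars[OF r(1) len] by simp
    then show ?thesis using p by simp
  qed
  then show ?case using r by simp
next
  case (4 T c qs ps i xs \<rho>)
  note p = "4.prems"
  have i: "i \<in> ids T" using p(2) by simp
  obtain as where as: "map (\<lambda>j. snd (T ! i) ! (j + 2)) [0..<ar (fst (T ! i))] = as"
    "length as = ar (fst (T ! i))" "set as \<subseteq> ids T" "V i = Fun (fst (T ! i)) (map V as)"
    by (rule row_args_eq[OF p(1) i])
  have c: "fst (T ! i) = c" "map (subst \<sigma>) qs = map V as" using as(4) p(4) by auto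
  have q: "length qs = ar c" "set qs \<subseteq> terms ar C UNIV" using sub_terms p(3) by fastforce+
  have cond: "i < length T \<and> fst (T ! i) = c" using i c by (simp add: ids_def)
  have eq: "map (\<lambda>j. snd (T ! i) ! (j + 2)) [0..<length qs] = as" using as(1) c q by simp
  have "\<exists>\<rho>'. pmatch T (qs @ ps) (as @ xs) \<rho> = (True, [], \<rho>') \<and>
    (\<forall>x\<in>\<Union> (vars_trm ` set (qs @ ps)). \<rho>' x \<noteq> [] \<and> V (hd (\<rho>' x)) = \<sigma> x \<and> hd (\<rho>' x) \<in> ids T)"
    by (rule "4.IH"[OF cond p(1), unfolded eq]) (use p as c q in auto)
  then show ?case using cond unfolding pmatch.simps eq by simp
qed

text \<open>Linearity enters here: \<open>pmatch\<close> does not compare the bindings of repeated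
  variables. With a single occurrence of \<open>x\<close>, the head of \<open>\<rho>' x\<close> is
  the number met at that occurrence.\<close>

lemma pmatch_sound:
  assumes "heap_inv V T K" "set xs \<subseteq> ids T" "set ps \<subseteq> terms ar C UNIV" "length xs = length ps"
    "distinct (concat (map var_list ps))" "pmatch T ps xs \<rho> = (True, ys, \<rho>')"
  shows "map (subst (\<lambda>x. V (hd (\<rho>' x)))) ps = map V xs"
  using assms
proof (induction T ps xs \<rho> rule: pmatch.induct)
  case (3 T x ps i xs \<rho>)
  note p = "3.prems"
  have vl: "set (var_list t) = vars_trm t" for t :: "('f, 'v) trm" by (induction t) auto
  have IH: "map (subst (\<lambda>x. V (hd (\<rho>' x)))) ps = map V xs"
    by (rule "3.IH"[OF p(1) _ _ _ _ p(6)[unfolded pmatch.simps]]) (use p in auto)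
  have "x \<notin> \<Union> (vars_trm ` set ps)" using p(5) by (auto simp: vl)
  moreover have "length xs = length ps" using p(4) by simp
  ultimately have "\<rho>' x = i # \<rho> x"
    using pmatch_vars[OF p(6)[unfolded pmatch.simps]] by simp
  then show ?case using IH by simp
next
  case (4 T c qs ps i xs \<rho>)
  note p = "4.prems"
  have i: "i \<in> ids T" using p(2) by simp
  have cond: "i < length T \<and> fst (T ! i) = c" using p(6) by (auto split: if_splits)
  obtain as where as: "map (\<lambda>j. snd (T ! i) ! (j + 2)) [0..<ar (fst (T ! i))] = as"
    "length as = ar (fst (T ! i))" "set as \<subseteq> ids T" "V i = Fun (fst (T ! i)) (map V as)"
    by (rule row_args_eq[OF p(1) i])
  have q: "length qs = ar c" "set qs \<subseteq> terms ar C UNIV" using sub_terms p(3) by fastforce+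
  have eq: "map (\<lambda>j. snd (T ! i) ! (j + 2)) [0..<length qs] = as" using as(1) cond q by simp
  have "pmatch T (qs @ ps) (as @ xs) \<rho> = (True, ys, \<rho>')"
    using p(6) cond unfolding pmatch.simps eq by simp
  then have "map (subst (\<lambda>x. V (hd (\<rho>' x)))) (qs @ ps) = map V (as @ xs)"
    by (intro "4.IH"[OF cond p(1), unfolded eq]) (use p as cond q in auto)
  then have "map (subst (\<lambda>x. V (hd (\<rho>' x)))) qs = map V as \<and> map (subst (\<lambda>x. V (hd (\<rho>' x)))) ps = map V xs"
    using as(2) cond q(1) by (simp add: append_eq_append_conv)
  then show ?case using as(4) cond by simp
qed auto

lemma inst_ren:
  "\<forall>x\<in>vars_trm r. V (hd (\<rho> x)) = \<sigma> x \<Longrightarrow> inst V (ren \<rho> r) = subst \<sigma> r"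
  by (induction r) auto

lemma ren_size: "trm_size (ren \<rho> r) = trm_size r"
  by (induction r) (auto simp: comp_def cong: map_cong)

lemma ren_vars: "vars_trm (ren \<rho> r) = (\<lambda>x. hd (\<rho> x)) ` vars_trm r"
  by (simp add: ren_def trm.set_map)

text \<open>The premise of (Update) excludes only the pair with this particular \<open>v\<close>. A
  successful look-up would yield some pair for the call, and by determinism it would be this very
  pair; so the look-up fails and the machine makes the call too. By \<open>rule_unique\<close> no
  other rule matches.\<close>

lemma sim_update:
  assumes vs: "set vs \<subseteq> vals ar C" and new: "(Fun f vs, v) \<notin> K" and rule: "(Fun f ps, r) \<in> R" "map (subst \<sigma>) ps = vs"
    and ev: "eval ar D C R K (subst \<sigma> r) m K' v" and sim: "sim_trm K (subst \<sigma> r) m K' v"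
  shows "sim_app K f vs (m + 1) (insert (Fun f vs, v) K') v"
  unfolding sim_app_def
proof (intro allI impI)
  fix V T as k xs ss frs and ks :: "'f tok list"
  assume heap_inv: "heap_inv V T K" and as: "map V as = vs" "set as \<subseteq> ids T" and k: "enters k f as xs"
  have l: "f \<in> D" "length ps = ar f" "set ps \<subseteq> terms ar C UNIV" "vars_trm r \<subseteq> \<Union> (vars_trm ` set ps)"
    by (rule rule_shape[OF rule(1)], simp)+
  have len: "length as = ar f" "length as = length ps"
    using l rule(2) as(1) by (metis length_map)+
  have f: "f \<in> D \<union> C" using l by simp
  have K: "\<forall>(t, v)\<in>K. sem t v" using invD(5)[OF heap_inv] by blast
  then have sem_r: "sem (subst \<sigma> r) v" using eval_sem(1)[OF ev] by blast
  then have semv: "sem (Fun f vs) v"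
    using l(1) rule list_all2_sem_vals[OF vs] by (blast intro: sem.op)
  have none: "lookup T f (pad as) = None"
  proof (rule ccontr)
    assume "lookup T f (pad as) \<noteq> None"
    then obtain i where "lookup T f (pad as) = Some i" by blast
    from lookup_op[OF heap_inv l(1) len(1) as(2) this] show False
      using semv as(1) new sem_det by blast
  qed
  have tk: "take (length qs) (pad as) = as" if "length qs = ar f" for qs :: "('f, 'v) trm list"
    using that len by (simp add: pad_def)
  obtain \<rho> where \<rho>: "pmatch T ps as (\<lambda>_. []) = (True, [], \<rho>)"
    "\<forall>x\<in>\<Union> (vars_trm ` set ps). \<rho> x \<noteq> [] \<and> V (hd (\<rho> x)) = \<sigma> x \<and> hd (\<rho> x) \<in> ids T"
    using pmatch_complete[OF heap_inv as(2) l(3), of \<sigma> "\<lambda>_. []"] rule(2) as(1) by auto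
  let ?u = "ren \<rho> r"
  have hit: "hits T (pad as) (Fun f ps, r) = Some ?u"
    using \<rho>(1) tk[OF l(2)] by (simp add: hits_def)
  have miss: "\<forall>qs r'. (Fun f qs, r') \<in> R \<longrightarrow> (Fun f qs, r') \<noteq> (Fun f ps, r) \<longrightarrow> hits T (pad as) (Fun f qs, r') = None"
  proof (intro allI impI)
    fix qs r' assume r': "(Fun f qs, r') \<in> R" "(Fun f qs, r') \<noteq> (Fun f ps, r)"
    have q: "length qs = ar f" "set qs \<subseteq> terms ar C UNIV"
      by (rule rule_shape[OF r'(1)], simp)+
    have dist: "distinct (concat (map var_list qs))"
      using orth r'(1) unfolding orthogonal_def by fastforce
    obtain ok ys \<rho>' where pm: "pmatch T qs as (\<lambda>_. []) = (ok, ys, \<rho>')" by (metis prod_cases3)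
    have "\<not> ok"
    proof
      assume ok
      then have "map (subst (\<lambda>x. V (hd (\<rho>' x)))) qs = map V as"
        using pmatch_sound[OF heap_inv as(2) q(2) _ dist] pm len q(1) by simp
      then show False using rule_unique[OF r'(1) rule(1)] rule(2) as(1) r'(2) by metis
    qed
    then show "hits T (pad as) (Fun f qs, r') = None"
      using pm tk[OF q(1)] by (simp add: hits_def)
  qed
  have 1: "astep (k # ks, xs @ ss, frs, T) (code ?u @ TMemo f # ks, ss, pad as # frs, T)"
    by (rule astep.call[OF k l(1) len(1) none rule(1) hit miss])
  have u: "inst V ?u = subst \<sigma> r" using \<rho>(2) l(4) by (intro inst_ren) blast
  have "vars_trm ?u \<subseteq> ids T" using \<rho>(2) l(4) unfolding ren_vars by blast
  from sim[unfolded sim_trm_def, rule_format, OF heap_inv u this, of "TMemo f # ks" ss "pad as # frs"]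
  obtain V1 T1 i where 2: "reach (trm_size ?u + m * rules_size)
      (code ?u @ TMemo f # ks, ss, pad as # frs, T) (TMemo f # ks, i # ss, pad as # frs, T1)"
    "heap_inv V1 T1 K'" "ext V T V1 T1" "i \<in> ids T1" "V1 i = v"
    by blast
  let ?T = "T1 @ [(f, length T1 # i # pad as)]"
  have 3: "astep (TMemo f # ks, i # ss, pad as # frs, T1) (ks, i # ss, frs, ?T)"
    by (rule astep.memo[OF l(1) refl])
  have as1: "set as \<subseteq> ids T1" "map V1 as = vs"
    using as ext_ids[OF 2(3)] map_ext_ids[OF 2(3) as(2)] by auto
  have "heap_inv V1 ?T (insert (Fun f vs, v) K')"
    using inv_new_op[OF 2(2) l(1) len(1) as1(1) 2(4)] semv as1(2) 2(5) by simp
  moreover have "ext V T V1 ?T"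
    using 2(3) by (rule ext_trans) (auto simp: ext_def)
  moreover have "i \<in> ids ?T" using 2(4) ids_append by blast
  \<comment> \<open>The left-hand side contributes at least 1 to \<open>rules_size\<close>, which
    pays for the memo token. Hence one (Update) accounts for at most \<open>rules_size\<close>
    further steps.\<close>
  moreover have "trm_size ?u + 1 \<le> rules_size"
    using rules_size[OF rule(1)] by (simp add: ren_size)
  then have "reach (1 + (m + 1) * rules_size) (k # ks, xs @ ss, frs, T) (ks, i # ss, frs, ?T)"
    by (intro reach_trans[OF reach_step[OF 1] reach_trans[OF 2(1) reach_step[OF 3] order.refl]]) simp
  ultimately show "\<exists>V' T' i. reach (1 + (m + 1) * rules_size) (k # ks, xs @ ss, frs, T) (ks, i # ss, frs, T') \<and>
        heap_inv V' T' (insert (Fun f vs, v) K') \<and> ext V T V' T' \<and> i \<in> ids T' \<and> V' i = v"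
    using 2(5) by blast
qed

lemma sim_trm_of_app:
  assumes "set vs \<subseteq> vals ar C" "f \<in> D" "sim_app K f vs m K' v"
  shows "sim_trm K (Fun f vs) m K' v"
  using sim_split[OF sim_vals[OF assms(1)] assms(3,2)] by simp

text \<open>The addition on \<open>sim_app\<close> is what (Split) uses for its second premise. That
  premise may end in a (Split) again, on the same values; by \<open>eval_of_vals\<close> its
  arguments are then evaluated without effect, so the statement passes through.\<close>

lemma simulation:
  "eval ar D C R K t m K' v \<Longrightarrow> sim_trm K t m K' v \<and>
     (\<forall>f vs. t = Fun f vs \<longrightarrow> f \<in> D \<longrightarrow> set vs \<subseteq> vals ar C \<longrightarrow> sim_app K f vs m K' v)"
  "evals ar D C R K ts m K' vs \<Longrightarrow> sim_list K ts m K' vs"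
proof (induction rule: eval_evals.inducts)
  case (Split f ts K n K' vs n' K'' v)
  have vs: "set vs \<subseteq> vals ar C" using \<open>evals ar D C R K ts n K' vs\<close> eval_vals(2) by blast
  have app: "sim_app K' f vs n' K'' v" using Split vs by blast
  have "sim_trm K (Fun f ts) (n' + n) K'' v"
    using sim_split[OF _ app] Split by blast
  moreover have "sim_app K f ts (n' + n) K'' v" if "set ts \<subseteq> vals ar C"
    using eval_of_vals(2)[OF \<open>evals ar D C R K ts n K' vs\<close> that] app by simp
  ultimately show ?case by simp
next
  case (Con c ts K n K' vs)
  have "length vs = length ts" using \<open>evals ar D C R K ts n K' vs\<close> eval_vals(2) by blast
  then have "sim_trm K (Fun c ts) n K' (Fun c vs)"
    using sim_con Con eval_of_vals(2)[OF \<open>evals ar D C R K ts n K' vs\<close>] by blast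
  then show ?case using D_C Con by auto
next
  case (Read K f vs v)
  then have "f \<in> D" "set vs \<subseteq> vals ar C" by (auto simp: caches_def)
  then show ?case using sim_read[OF Read] sim_trm_of_app by auto
next
  case (Update vs f v K ps r \<sigma> m K')
  have "f \<in> D" using rule_head \<open>(Fun f ps, r) \<in> R\<close> by blast
  moreover have "sim_app K f vs (m + 1) (insert (Fun f vs, v) K') v"
    using sim_update Update by blast
  ultimately show ?case using sim_trm_of_app Update by auto
next
  case (Nil K)
  show ?case by (rule sim_Nil)
next
  case (Cons K t n K' v ts n' K'' vs)
  then show ?case using sim_Cons by blast
qed

section \<open>Building the arguments of the call from the input\<close>

lemma input_list:
  assumes "\<And>t V T ks ss. t \<in> set ts \<Longrightarrow> heap_inv V T K \<Longrightarrow>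
      \<exists>V' T' i. reach (trm_size t) (input_code t @ ks, ss, frs, T) (ks, i # ss, frs, T') \<and>
        heap_inv V' T' K \<and> ext V T V' T' \<and> i \<in> ids T' \<and> V' i = t"
    and heap_inv: "heap_inv V T K"
  shows "\<exists>V' T' as. reach (sum_list (map trm_size ts)) (concat (rev (map input_code ts)) @ ks, ss, frs, T)
      (ks, as @ ss, frs, T') \<and> heap_inv V' T' K \<and> ext V T V' T' \<and> set as \<subseteq> ids T' \<and> map V' as = ts"
  using assms(1)
proof (induction ts arbitrary: ks)
  case Nil
  then show ?case using heap_inv by (intro exI[of _ V] exI[of _ T] exI[of _ "[]"]) (simp add: reach_refl ext_refl)
next
  case (Cons t ts)
  have "\<exists>V' T' as. reach (sum_list (map trm_size ts)) (concat (rev (map input_code ts)) @ input_code t @ ks, ss, frs, T)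
      (input_code t @ ks, as @ ss, frs, T') \<and> heap_inv V' T' K \<and> ext V T V' T' \<and> set as \<subseteq> ids T' \<and> map V' as = ts"
    by (rule Cons.IH) (use Cons.prems in simp)
  then obtain V1 T1 as where 1: "reach (sum_list (map trm_size ts)) (concat (rev (map input_code ts)) @ input_code t @ ks, ss, frs, T)
    (input_code t @ ks, as @ ss, frs, T1)" "heap_inv V1 T1 K" "ext V T V1 T1" "set as \<subseteq> ids T1" "map V1 as = ts"
    by blast
  obtain V2 T2 i where 2: "reach (trm_size t) (input_code t @ ks, as @ ss, frs, T1) (ks, i # as @ ss, frs, T2)"
    "heap_inv V2 T2 K" "ext V1 T1 V2 T2" "i \<in> ids T2" "V2 i = t"
    using Cons.prems[of t, OF list.set_intros(1) 1(2), of ks "as @ ss"] by (elim exE conjE)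
  have "reach (sum_list (map trm_size (t # ts))) (concat (rev (map input_code (t # ts))) @ ks, ss, frs, T)
    (ks, (i # as) @ ss, frs, T2)"
    using reach_trans[OF 1(1) 2(1)] by simp
  moreover have "map V2 (i # as) = t # ts" "set (i # as) \<subseteq> ids T2"
    using 1 2 ext_ids[OF 2(3)] map_ext_ids[OF 2(3) 1(4)] by auto
  ultimately show ?case
    using 2(2) ext_trans[OF 1(3) 2(3)] by (intro exI[of _ V2] exI[of _ T2] exI[of _ "i # as"] conjI)
qed

lemma input_run:
  assumes "v \<in> vals ar C" "heap_inv V T K"
  shows "\<exists>V' T' i. reach (trm_size v) (input_code v @ ks, ss, frs, T) (ks, i # ss, frs, T') \<and>
    heap_inv V' T' K \<and> ext V T V' T' \<and> i \<in> ids T' \<and> V' i = v"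
  using assms
proof (induction v arbitrary: V T ks ss rule: trm.induct)
  case (Fun c ts)
  have ts: "c \<in> C" "length ts = ar c" "\<forall>t\<in>set ts. t \<in> vals ar C"
    using Fun.prems by (auto elim: terms.cases)
  have "\<exists>V' T' as. reach (sum_list (map trm_size ts)) (concat (rev (map input_code ts)) @ TRev c # ks, ss, frs, T)
      (TRev c # ks, as @ ss, frs, T') \<and> heap_inv V' T' K \<and> ext V T V' T' \<and> set as \<subseteq> ids T' \<and> map V' as = ts"
    by (rule input_list[OF Fun.IH Fun.prems(2)]) (use ts(3) in auto)
  then obtain V1 T1 as where 1: "reach (sum_list (map trm_size ts)) (concat (rev (map input_code ts)) @ TRev c # ks, ss, frs, T)
      (TRev c # ks, as @ ss, frs, T1)" "heap_inv V1 T1 K" "ext V T V1 T1" "set as \<subseteq> ids T1" "map V1 as = ts"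
    by blast
  have "length as = ar c" using 1(5) ts(2) by auto
  moreover have "enters (TRev c) c as as" by (simp add: enters_def)
  ultimately obtain V2 T2 i where 2: "astep (TRev c # ks, as @ ss, frs, T1) (ks, i # ss, frs, T2)"
    "heap_inv V2 T2 K" "ext V1 T1 V2 T2" "i \<in> ids T2" "V2 i = Fun c (map V1 as)"
    using con_step[OF 1(2) ts(1) _ 1(4)] by meson
  have "reach (trm_size (Fun c ts)) (input_code (Fun c ts) @ ks, ss, frs, T) (ks, i # ss, frs, T2)"
    using reach_trans[OF 1(1) reach_step[OF 2(1)]] by simp
  then show ?case using 2 1(5) ext_trans[OF 1(3) 2(3)] by auto
qed (auto elim: terms.cases)

lemma inv_empty: "heap_inv V [] {}"
  by (auto simp: heap_inv_def ids_def)

text \<open>The input is executed as code: everything up to its last token builds the arguments, one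
  step for each symbol, and the last token \<open>TRev f\<close> is the call itself.\<close>

theorem run:
  assumes "f \<in> D" "length vs = ar f" "set vs \<subseteq> vals ar C" "eval ar D C R {} (Fun f vs) m K v"
  shows "\<exists>V T i. reach (sum_list (map trm_size vs) + 1 + m * rules_size) (input_code (Fun f vs), [], [], []) ([], [i], [], T) \<and>
    heap_inv V T K \<and> i \<in> ids T \<and> V i = v"
proof -
  obtain V1 T1 as where 1: "reach (sum_list (map trm_size vs)) (concat (rev (map input_code vs)) @ [TRev f], [], [], [])
      ([TRev f], as, [], T1)" "heap_inv V1 T1 {}" "set as \<subseteq> ids T1" "map V1 as = vs"
    using input_list[of vs "{}" "[]" _ "[]" "[TRev f]" "[]", OF input_run inv_empty] assms(3)
    unfolding append_Nil2 by blast
  have app: "sim_app {} f vs m K v" using simulation(1)[OF assms(4)] assms by blast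
  have "enters (TRev f) f as as" by (simp add: enters_def)
  then obtain V2 T2 i where 2: "reach (1 + m * rules_size) ([TRev f], as @ [], [], T1) ([], [i], [], T2)"
    "heap_inv V2 T2 K" "i \<in> ids T2" "V2 i = v"
    using app 1 unfolding sim_app_def by blast
  have "reach (sum_list (map trm_size vs) + 1 + m * rules_size) (input_code (Fun f vs), [], [], []) ([], [i], [], T2)"
    using reach_trans[OF 1(1) 2(1)[unfolded append_Nil2]] by simp
  with 2 show ?thesis by blast
qed


section \<open>Output and running time\<close>

definition kids :: "'f row list \<Rightarrow> nat \<Rightarrow> nat list" where
  "kids T j = row_args (T ! j)"

lemma kids:
  assumes heap_inv: "heap_inv V T K" and j: "j \<in> ids T"
  shows "V j = Fun (fst (T ! j)) (map V (kids T j))" "length (kids T j) = ar (fst (T ! j))"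
    "\<And>a. a \<in> set (kids T j) \<Longrightarrow> a < j \<and> a \<in> ids T"
proof -
  obtain as where as: "snd (T ! j) = j # j # pad as" "length as = ar (fst (T ! j))"
    "\<forall>a\<in>set as. a < j \<and> fst (T ! a) \<in> C" "V j = Fun (fst (T ! j)) (map V as)"
    using invD(1)[OF heap_inv j] unfolding con_row_def by blast
  have eq: "kids T j = as" using as(1,2) by (simp add: kids_def row_args_def pad_def)
  show "V j = Fun (fst (T ! j)) (map V (kids T j))" "length (kids T j) = ar (fst (T ! j))"
    unfolding eq using as by blast+
  show "a < j \<and> a \<in> ids T" if "a \<in> set (kids T j)" for a
    using as(3) that j unfolding eq by (auto simp: ids_def)
qed

lemma row_own:
  assumes heap_inv: "heap_inv V T K" and j: "j < length T"
  shows "snd (T ! j) ! 0 = j" "fst (T ! j) \<in> D \<union> C"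
proof -
  have "snd (T ! j) ! 0 = j \<and> fst (T ! j) \<in> D \<union> C"
  proof (cases "j \<in> ids T")
    case True
    then show ?thesis using invD(1)[OF heap_inv True] by (auto simp: con_row_def ids_def)
  next
    case False
    then obtain t v where "op_row V T j t v" using invD(3)[OF heap_inv j] by blast
    then show ?thesis by (auto simp: op_row_def)
  qed
  then show "snd (T ! j) ! 0 = j" "fst (T ! j) \<in> D \<union> C" by auto
qed

text \<open>Since the arguments of a node have smaller numbers, one pass from the newest to the oldest row
  finds all nodes reachable from the marked ones.\<close>

fun select :: "'f row list \<Rightarrow> nat \<Rightarrow> nat list \<Rightarrow> nat list" where
  "select T 0 ms = []"
| "select T (Suc n) ms = (if n \<in> set ms then n # select T n (rev (kids T n) @ ms) else select T n ms)"

lemma gc_out_select: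
  assumes "\<forall>j<length T. snd (T ! j) ! 0 = j" "n \<le> length T"
  shows "gc_out (rev (take n T)) ms = concat (map (\<lambda>j. row_string (T ! j)) (select T n ms))"
  using assms(2)
proof (induction n arbitrary: ms)
  case (Suc n)
  then show ?case using assms(1) by (simp add: take_Suc_conv_app_nth kids_def)
qed simp

lemma select_distinct: "distinct (select T n ms) \<and> (\<forall>j\<in>set (select T n ms). j < n)"
proof (induction n arbitrary: ms)
  case (Suc n)
  have "j < n" if "j \<in> set (select T n ms)" for j ms using Suc that by blast
  with Suc show ?case by (auto intro: less_SucI)
qed simp

definition arcs :: "'f row list \<Rightarrow> (nat \<times> nat) set" where
  "arcs T = {(a, b). a \<in> ids T \<and> b \<in> set (kids T a)}"

lemma arcs_less:
  assumes "heap_inv V T K" "(a, b) \<in> (arcs T)\<^sup>*"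
  shows "b \<le> a \<and> (a \<in> ids T \<longrightarrow> b \<in> ids T)"
  using assms(2)
proof (induction rule: rtrancl_induct)
  case (step b c)
  then have "b \<in> ids T" "c \<in> set (kids T b)" by (auto simp: arcs_def)
  then have "c < b \<and> c \<in> ids T" using kids(3)[OF assms(1)] by blast
  then show ?case using step.IH by simp
qed simp

text \<open>Only marks below \<open>n\<close> count. In the pass a mark at or above \<open>n\<close>
  has been dealt with already, and its arguments have become marks themselves.\<close>

lemma set_select:
  assumes heap_inv: "heap_inv V T K" and "set ms \<subseteq> ids T"
  shows "set (select T n ms) = {j. j < n \<and> (\<exists>m\<in>set ms. m < n \<and> (m, j) \<in> (arcs T)\<^sup>*)}"
  using assms(2)
proof (induction n arbitrary: ms)
  case (Suc n)
  note less = arcs_less[OF heap_inv]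
  show ?case
  proof (cases "n \<in> set ms")
    case True
    then have n: "n \<in> ids T" using Suc.prems by blast
    note k = kids(3)[OF heap_inv n]
    have IH: "set (select T n (rev (kids T n) @ ms)) =
        {j. j < n \<and> (\<exists>m\<in>set (kids T n) \<union> set ms. m < n \<and> (m, j) \<in> (arcs T)\<^sup>*)}"
      using Suc.IH[of "rev (kids T n) @ ms"] Suc.prems k by auto
    have "(n, j) \<in> (arcs T)\<^sup>* \<longleftrightarrow> j = n \<or> (\<exists>m\<in>set (kids T n). (m, j) \<in> (arcs T)\<^sup>*)" for j
      using n by (auto simp: arcs_def elim: converse_rtranclE intro: converse_rtrancl_into_rtrancl)
    moreover have "j < n" if "m \<in> set (kids T n)" "(m, j) \<in> (arcs T)\<^sup>*" for m j
      using less[OF that(2)] k[OF that(1)] by simp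
    moreover have "j < n" if "m < n" "(m, j) \<in> (arcs T)\<^sup>*" for m j
      using less[OF that(2)] that(1) by simp
    ultimately show ?thesis
      unfolding select.simps if_P[OF True] list.set IH using True k
      by (auto simp: less_Suc_eq) blast+
  next
    case False
    have "j < n" if "m < n" "(m, j) \<in> (arcs T)\<^sup>*" for m j
      using less[OF that(2)] that(1) by simp
    then show ?thesis
      using Suc.IH[OF Suc.prems] False by (auto simp: less_Suc_eq)
  qed
qed simp

section \<open>The word written is a DAG representation\<close>

definition name :: "nat \<Rightarrow> bool list" where
  "name j = replicate j True"

lemma length_name [simp]: "length (name j) = j"
  by (simp add: name_def)

lemma name_inj: "inj name"
  by (metis injI length_name)

lemma name_string: "name_string (name j) = num j"
  by (simp add: name_string_def name_def num_def)

definition heap_dag :: "'f row list \<Rightarrow> nat \<Rightarrow> (bool list, 'f) dag" where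
  "heap_dag T i = \<lparr>nodes = name ` {j. (i, j) \<in> (arcs T)\<^sup>*}, label = (\<lambda>u. fst (T ! length u)),
     succs = (\<lambda>u. map name (kids T (length u))), root = name i\<rparr>"

theorem heap_dag:
  assumes heap_inv: "heap_inv V T K" and i: "i \<in> ids T"
  shows "dag_representation ar C (num i @ gc_out (rev T) [i]) (V i)"
proof -
  let ?G = "heap_dag T i" and ?N = "{j. (i, j) \<in> (arcs T)\<^sup>*}"
  have N: "j \<in> ids T" if "j \<in> ?N" for j using arcs_less[OF heap_inv] that i by blast
  have Nk: "a \<in> ?N" if "j \<in> ?N" "a \<in> set (kids T j)" for a j
    using that N[OF that(1)] by (auto simp: arcs_def intro: rtrancl_into_rtrancl)
  have sel: "set (select T (length T) [i]) = ?N"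
    using set_select[OF heap_inv, of "[i]" "length T"] i N by (auto simp: ids_def)
  have fin: "finite ?N" unfolding sel[symmetric] by simp
  \<comment> \<open>The length of a name is its row number, and arguments have smaller numbers; so
    \<open>length\<close> is a measure that proves acyclicity.\<close>
  have edge: "length w < length u" if "(u, w) \<in> edges ?G" for u w
    using that kids(3)[OF heap_inv N] by (auto simp: edges_def heap_dag_def)
  have "(name i, name j) \<in> (edges ?G)\<^sup>*" if "(i, j) \<in> (arcs T)\<^sup>*" for j
    using that
  proof (induction rule: rtrancl_induct)
    case (step j a)
    then have "(name j, name a) \<in> edges ?G" by (auto simp: edges_def heap_dag_def arcs_def)
    with step.IH show ?case by (rule rtrancl_into_rtrancl)
  qed simp
  moreover have "acyclic (edges ?G)" using edge by (intro acyclicI_order[where f = length])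
  ultimately have "rooted_dag ar C ?G"
    unfolding rooted_dag_def using fin kids(2)[OF heap_inv N] Nk N
    by (auto simp: heap_dag_def ids_def)
  moreover have "maximally_shared ?G"
  proof -
    \<comment> \<open>Equal labels and equal successors give equal values, and \<open>V\<close> is
      injective on the nodes.\<close>
    have "a = b" if "a \<in> ?N" "b \<in> ?N" "fst (T ! a) = fst (T ! b)" "map name (kids T a) = map name (kids T b)" for a b
    proof -
      have "kids T a = kids T b" using that(4) name_inj by (simp add: inj_map_eq_map)
      then have "V a = V b" using kids(1)[OF heap_inv N] that(1-3) by simp
      then show ?thesis using invD(2)[OF heap_inv] N that(1,2) by (auto dest: inj_onD)
    qed
    then show ?thesis unfolding maximally_shared_def by (auto simp: heap_dag_def)
  qed
  moreover have "unfolds ?G (name j) (V j)" if "j \<in> ?N" for j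
    using that
  proof (induction j rule: less_induct)
    case (less j)
    have "unfolds ?G (name a) (V a)" if "a \<in> set (kids T j)" for a
      using less Nk kids(3)[OF heap_inv N] that by blast
    then have "list_all2 (unfolds ?G) (succs ?G (name j)) (map V (kids T j))"
      by (simp add: heap_dag_def list_all2_conv_all_nth)
    moreover have "name j \<in> nodes ?G" using less.prems by (simp add: heap_dag_def)
    ultimately have "unfolds ?G (name j) (Fun (label ?G (name j)) (map V (kids T j)))"
      by (rule unfolds.intros[rotated])
    then show ?case using kids(1)[OF heap_inv N[OF less.prems]] by (simp add: heap_dag_def)
  qed
  then have "unfolds ?G (root ?G) (V i)" by (simp add: heap_dag_def)
  moreover have "encodes_dag (num i @ gc_out (rev T) [i]) ?G"
    unfolding encodes_dag_def
  proof (intro exI[of _ "map name (select T (length T) [i])"] conjI)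
    show "distinct (map name (select T (length T) [i]))"
      using select_distinct inj_on_subset[OF name_inj subset_UNIV] by (simp add: distinct_map)
    show "set (map name (select T (length T) [i])) = nodes ?G"
      using sel by (simp add: heap_dag_def)
    have "row_string (T ! j) = node_string ?G (name j)" if "j \<in> ?N" for j
      using row_own(1)[OF heap_inv, of j] N[OF that]
      by (simp add: row_string_def node_string_def heap_dag_def name_string ids_def kids_def ns_def comp_def)
    then have rows: "map (\<lambda>j. row_string (T ! j)) (select T (length T) [i]) =
        map (node_string ?G) (map name (select T (length T) [i]))"
      using sel by auto
    have gc: "gc_out (rev T) [i] = concat (map (\<lambda>j. row_string (T ! j)) (select T (length T) [i]))"
      using gc_out_select[of T "length T" "[i]"] row_own(1)[OF heap_inv] by simp
    have "root ?G = name i" by (simp add: heap_dag_def)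
    then show "num i @ gc_out (rev T) [i] =
        name_string (root ?G) @ concat (map (node_string ?G) (map name (select T (length T) [i])))"
      by (simp only: gc rows name_string)
  qed
  ultimately show ?thesis unfolding dag_representation_def by blast
qed

section \<open>Restricted use of the output register\<close>

lemma out_only_seqs: "out_only w (seqs cs) \<longleftrightarrow> (\<forall>c\<in>set cs. out_only w c)"
  by (induction cs) auto

lemma out_only_macros:
  "r \<noteq> Outp \<Longrightarrow> q \<noteq> Outp \<Longrightarrow> out_only Outp (copytop r q)"
  "r \<noteq> Outp \<Longrightarrow> out_only Outp (poptop r)"
  "r \<noteq> Outp \<Longrightarrow> q \<noteq> Outp \<Longrightarrow> out_only Outp (movetop r q)"
  "r \<noteq> Outp \<Longrightarrow> out_only Outp (emittop r)"
  "r \<noteq> Outp \<Longrightarrow> out_only Outp (clear r)"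
  "r \<noteq> Outp \<Longrightarrow> q \<noteq> Outp \<Longrightarrow> out_only Outp (eqtest r q)"
  by (simp_all add: copytop_def poptop_def movetop_def emittop_def clear_def eqtest_def)

lemma out_only_table: "out_only Outp advance" "out_only Outp retreat" "out_only Outp to_end" "out_only Outp rewind"
  by (simp_all add: advance_def retreat_def to_end_def rewind_def out_only_seqs out_only_macros)

lemma out_only_find: "out_only Outp tst \<Longrightarrow> out_only Outp (find_row tst)"
  by (simp add: find_row_def out_only_table out_only_macros)

lemma out_only_match: "out_only Outp k \<Longrightarrow> out_only Outp (match_com ps k)"
  by (induction ps k rule: match_com.induct)
    (simp_all add: out_only_find own_test_def out_only_macros out_only_seqs)

lemma out_only_push_term: "out_only Outp (push_term r)"
  by (induction r) (auto simp: out_only_macros out_only_seqs)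

lemma out_only_app: "out_only Outp (app s)"
proof -
  have "out_only Outp (try_rule lr)" for lr
    by (auto simp: try_rule_def out_only_seqs out_only_macros out_only_match out_only_push_term
        split: prod.split trm.split)
  then show ?thesis
    by (simp add: app_def out_only_find key_test_def append_row_def pop_frame_def rules_com_def
        out_only_seqs out_only_macros)
qed

lemma out_only_dispatch: "out_only Outp (dispatch ss)"
  by (induction ss) (simp_all add: out_only_app pop_args_def pad_args_def append_row_def out_only_table
      out_only_seqs out_only_macros)

lemma out_only_out_dispatch: "out_only Outp (out_dispatch ss)"
  by (induction ss) (simp_all add: out_row_def out_only_seqs out_only_macros)

lemma out_only_whole: "out_only Outp whole"
  by (simp add: whole_def start_up_def finish_def body_def collect_def member_def drop_row_def
      out_only_dispatch out_only_out_dispatch out_only_table out_only_seqs out_only_macros)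

end

section \<open>Polynomial bounds\<close>

definition poly_bounded :: "(nat \<Rightarrow> nat) \<Rightarrow> bool" where
  "poly_bounded f \<longleftrightarrow> (\<exists>a k. \<forall>b. f b \<le> a * (b + 1) ^ k)"

lemma poly_bounded_const: "poly_bounded (\<lambda>b. c)"
  unfolding poly_bounded_def by (intro exI[of _ c] exI[of _ 0]) simp

lemma poly_bounded_id: "poly_bounded (\<lambda>b. b)"
  unfolding poly_bounded_def by (intro exI[of _ 1] exI[of _ 1]) simp

text \<open>The base \<open>b + 1\<close> is at least 1, so both powers may be raised to a common
  exponent.\<close>

lemma poly_bounded_add:
  assumes "poly_bounded f" "poly_bounded g"
  shows "poly_bounded (\<lambda>b. f b + g b)"
proof -
  obtain a k a' k' where *: "\<And>b. f b \<le> a * (b + 1) ^ k" "\<And>b. g b \<le> a' * (b + 1) ^ k'"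
    using assms unfolding poly_bounded_def by blast
  have "f b + g b \<le> (a + a') * (b + 1) ^ (k + k')" for b
  proof -
    have "(b + 1) ^ k \<le> (b + 1) ^ (k + k')" "(b + 1) ^ k' \<le> (b + 1) ^ (k + k')"
      by (intro power_increasing; simp)+
    then have "a * (b + 1) ^ k + a' * (b + 1) ^ k' \<le> a * (b + 1) ^ (k + k') + a' * (b + 1) ^ (k + k')"
      by (intro add_mono mult_le_mono2)
    then show ?thesis using add_mono[OF *(1)[of b] *(2)[of b]] unfolding add_mult_distrib by linarith
  qed
  then show ?thesis unfolding poly_bounded_def by blast
qed

lemma poly_bounded_mult:
  assumes "poly_bounded f" "poly_bounded g"
  shows "poly_bounded (\<lambda>b. f b * g b)"
proof -
  obtain a k a' k' where *: "\<And>b. f b \<le> a * (b + 1) ^ k" "\<And>b. g b \<le> a' * (b + 1) ^ k'"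
    using assms unfolding poly_bounded_def by blast
  have "f b * g b \<le> (a * a') * (b + 1) ^ (k + k')" for b
    using mult_le_mono[OF *(1)[of b] *(2)[of b]] by (simp add: power_add algebra_simps)
  then show ?thesis unfolding poly_bounded_def by blast
qed

lemma poly_bounded_Suc: "poly_bounded f \<Longrightarrow> poly_bounded (\<lambda>b. Suc (f b))"
  using poly_bounded_add[OF _ poly_bounded_const[of 1], of f] by simp

lemmas poly_bounded = poly_bounded_const poly_bounded_id poly_bounded_add poly_bounded_mult poly_bounded_Suc

lemma (in prog) poly_bounded_whole: "poly_bounded whole_cost"
  unfolding whole_cost_def body_cost_def app_cost_def try_cost_def match_cost_def push_cost_def find_cost_def
    enter_cost_def append_cost_def key_cost_def adv_cost_def collect_cost_def member_cost_def unit_cost_def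
  by (intro poly_bounded)

text \<open>The binomial theorem in each variable turns this product into the double sum of the
  definition, with coefficients \<open>a * (k choose i) * (k choose j)\<close>.\<close>

lemma polynomial2_power: "polynomial2 (\<lambda>(x, y). a * ((x + 1) ^ k * (y + 1) ^ k))"
proof -
  have expand: "(x + 1) ^ k = (\<Sum>i\<le>k. (k choose i) * x ^ i)" for x :: nat
    using binomial[of x 1 k] by simp
  have prod: "(x + 1) ^ k * (y + 1) ^ k = (\<Sum>i\<le>k. \<Sum>j\<le>k. ((k choose i) * x ^ i) * ((k choose j) * y ^ j))" for x y :: nat
    unfolding expand by (rule sum_product)
  have "a * ((x + 1) ^ k * (y + 1) ^ k) =
      (\<Sum>i\<le>k. \<Sum>j\<le>k. (a * (k choose i) * (k choose j)) * x ^ i * y ^ j)" for x y :: nat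
    unfolding prod sum_distrib_left by (intro sum.cong refl) (simp only: ac_simps)
  then show ?thesis
    unfolding polynomial2_def by (intro exI[of _ k] exI[of _ "\<lambda>i j. a * (k choose i) * (k choose j)"]) simp
qed

section \<open>Input words and their execution\<close>

lemma length_trm_string: "t \<in> vals ar C \<Longrightarrow> length (trm_string t) = trm_size t"
proof (induction t rule: trm.induct)
  case (Fun s ts)
  then have "\<forall>t\<in>set ts. length (trm_string t) = trm_size t" by (auto elim: terms.cases)
  then show ?case by (simp add: length_concat comp_def cong: map_cong)
qed (auto elim: terms.cases)

lemma set_trm_string: "t \<in> terms ar F V \<Longrightarrow> set (trm_string t) \<subseteq> Sym ` F"
  by (induction rule: terms.induct) auto

text \<open>So \<open>start_up\<close>, which merely reverses the input onto \<open>Ctl\<close>,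
  leaves there exactly the code to be executed.\<close>

lemma (in prog) toks_input: "toks (input_code t) = rev (trm_string t)"
proof (induction t)
  case (Fun s ts)
  have "toks (concat us) = concat (map toks us)" for us by (induction us) auto
  then have "toks (input_code (Fun s ts)) = concat (map (\<lambda>t. toks (input_code t)) (rev ts)) @ [Sym s]"
    by (simp add: rev_map comp_def)
  also have "map (\<lambda>t. toks (input_code t)) (rev ts) = map (\<lambda>t. rev (trm_string t)) (rev ts)"
    using Fun.IH by (intro map_cong) auto
  finally show ?case by (simp add: rev_concat rev_map comp_def)
qed simp

lemma input_no_push: "TPush i \<notin> set (input_code t)"
  by (induction t) auto

text \<open>Turns the bound on steps into a bound on the table, and thereby on all numbers that
  occur.\<close>

lemma (in prog) astep_length:
  "(astep ^^ k) (ks, vs, frs, T) (ks', vs', frs', T') \<Longrightarrow> length T' \<le> length T + k"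
proof (induction k arbitrary: ks' vs' frs' T')
  case (Suc k)
  then obtain ks1 vs1 frs1 T1 where "(astep ^^ k) (ks, vs, frs, T) (ks1, vs1, frs1, T1)"
    "astep (ks1, vs1, frs1, T1) (ks', vs', frs', T')"
    by (metis prod_cases4 relpowp_Suc_E)
  moreover from this(2) have "length T' \<le> length T1 + 1" by (cases rule: astep.cases) auto
  ultimately show ?case using Suc.IH by fastforce
qed simp

theorem (in prog) computation:
  assumes "f \<in> D" "length vs = ar f" "set vs \<subseteq> vals ar C" "eval ar D C R {} (Fun f vs) m K v"
  shows "\<exists>w s. dag_representation ar C w v \<and> s Outp = w \<and>
    runs whole (\<lambda>r. if r = Inp then trm_string (Fun f vs) else []) s
      (whole_cost ((\<Sum>u\<leftarrow>vs. trm_size u) + 1 + m * rules_size))"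
proof -
  \<comment> \<open>One bound for the three quantities in \<open>whole\<close>: the length of the
    input, the number of steps and the number of rows.\<close>
  let ?b = "(\<Sum>u\<leftarrow>vs. trm_size u) + 1 + m * rules_size" and ?x = "trm_string (Fun f vs)"
  obtain V T i where r: "reach ?b (input_code (Fun f vs), [], [], []) ([], [i], [], T)"
    and heap_inv: "heap_inv V T K" and i: "i \<in> ids T" "V i = v"
    using run[OF assms] by blast
  obtain k where k: "k \<le> ?b" "(astep ^^ k) (input_code (Fun f vs), [], [], []) ([], [i], [], T)"
    using r unfolding reach_def by blast
  have T: "length T \<le> ?b" using astep_length[OF k(2)] k(1) by simp
  have eq: "map (length \<circ> trm_string) vs = map trm_size vs"
    using assms(3) length_trm_string by (auto simp: subset_iff)
  have x: "length ?x \<le> ?b" by (simp add: length_concat eq del: map_eq_conv)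
  have "\<forall>rw\<in>set T. fst rw \<in> D \<union> C"
    using row_own(2)[OF heap_inv] by (metis in_set_conv_nth)
  then obtain t where "t Outp = num i @ gc_out (rev T) [i]" "runs whole (\<lambda>r. if r = Inp then ?x else []) t (whole_cost ?b)"
    using whole[OF k(2) toks_input[symmetric] _ x k(1) T] input_no_push by blast
  moreover have "dag_representation ar C (num i @ gc_out (rev T) [i]) v"
    using heap_dag[OF heap_inv i(1)] i(2) by simp
  ultimately show ?thesis by blast
qed

section \<open>Choice of the parameters and of the polynomial\<close>

lemma finite_vars_trm: "finite (vars_trm t)"
  by (induction t) auto

lemma program_prog:
  fixes ar :: "'f \<Rightarrow> nat" and R :: "('f, 'v) rules"
  assumes "program ar D C R" "orthogonal R"
  shows "\<exists>e A sl rl vl. prog ar D C R e A sl rl vl"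
proof -
  have fin: "finite (D \<union> C)" "finite R" using assms(1) by (auto simp: program_def)
  obtain e :: "'f \<Rightarrow> nat" where e: "inj_on e (D \<union> C)"
    using finite_imp_inj_to_nat_seg[OF fin(1)] by metis
  obtain sl where sl: "set sl = D \<union> C" "distinct sl" using finite_distinct_list[OF fin(1)] by blast
  obtain rl where rl: "set rl = R" "distinct rl" using finite_distinct_list[OF fin(2)] by blast
  have "finite (\<Union>(l, r)\<in>R. vars_trm l)" using fin(2) finite_vars_trm by auto
  from finite_distinct_list[OF this]
  obtain vl where vl: "set vl = (\<Union>(l, r)\<in>R. vars_trm l)" "distinct vl"
    by (elim exE conjE)
  \<comment> \<open>The sum of all arities serves as a common bound \<open>A\<close> on
    them.\<close>
  have "prog ar D C R e (\<Sum>s\<in>D \<union> C. ar s) sl rl vl"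
    using assms e sl rl vl fin(1) by unfold_locales (auto intro: member_le_sum)
  then show ?thesis by blast
qed

theorem theorem4p17:
  fixes ar :: "'f \<Rightarrow> nat" and D C :: "'f set" and R :: "('f, 'v) rules"
  assumes "program ar D C R" and "orthogonal R"
  shows "\<exists>(p :: nat \<times> nat \<Rightarrow> nat) (M :: (nat, 'f letter) tm).
    polynomial2 p \<and> turing_machine M \<and>
    (\<forall>f vs m K v.
       f \<in> D \<and> length vs = ar f \<and> set vs \<subseteq> vals ar C \<and>
       eval ar D C R {} (Fun f vs) m K v \<longrightarrow>
       (\<exists>w. dag_representation ar C w v \<and>
            computes_within M (trm_string (Fun f vs)) w (p (\<Sum>u\<leftarrow>vs. trm_size u, m))))"
proof -
  obtain e A sl rl vl where "prog ar D C R e A sl rl vl" using program_prog[OF assms] by blast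
  then interpret prog ar D C R e A sl rl vl .
  have fin: "finite (Sym ` (D \<union> C))" using assms(1) by (auto simp: program_def)
  obtain M :: "(nat, 'f letter) tm" where M: "turing_machine M"
    "\<And>x s n. set x \<subseteq> Sym ` (D \<union> C) \<Longrightarrow> exec whole (\<lambda>r. if r = Inp then x else []) s n \<Longrightarrow>
      computes_within M x (s Outp) n"
    using com_to_tm[OF fin _ out_only_whole, of Inp] by auto
  obtain a k where poly: "\<And>b. whole_cost b \<le> a * (b + 1) ^ k"
    using poly_bounded_whole unfolding poly_bounded_def by blast
  define p where "p = (\<lambda>(x, y). (a * (rules_size + 2) ^ k) * ((x + 1) ^ k * (y + 1) ^ k))"
  have p: "whole_cost (x + 1 + y * rules_size) \<le> p (x, y)" for x y
  proof -
    \<comment> \<open>Separates the two variables: the bound depends on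
      \<open>x + 1 + y * rules_size\<close>, while \<open>polynomial2_power\<close> wants a product
      of powers of \<open>x + 1\<close> and \<open>y + 1\<close>. The last summand 1 stems from the
      base \<open>b + 1\<close> in \<open>poly_bounded\<close>.\<close>
    have "x + 1 + y * rules_size + 1 \<le> (rules_size + 2) * ((x + 1) * (y + 1))"
      by (simp add: algebra_simps)
    then have "(x + 1 + y * rules_size + 1) ^ k \<le> (rules_size + 2) ^ k * ((x + 1) ^ k * (y + 1) ^ k)"
      by (metis power_mono power_mult_distrib zero_le)
    then have "a * (x + 1 + y * rules_size + 1) ^ k \<le> p (x, y)"
      by (simp add: p_def mult.assoc)
    with poly[of "x + 1 + y * rules_size"] show ?thesis by (rule order_trans)
  qed
  have "\<exists>w. dag_representation ar C w v \<and>
      computes_within M (trm_string (Fun f vs)) w (p (\<Sum>u\<leftarrow>vs. trm_size u, m))"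
    if call: "f \<in> D" "length vs = ar f" "set vs \<subseteq> vals ar C" "eval ar D C R {} (Fun f vs) m K v" for f vs m K v
  proof -
    obtain s where dag: "dag_representation ar C (s Outp) v" and
      "runs whole (\<lambda>r. if r = Inp then trm_string (Fun f vs) else []) s
        (whole_cost ((\<Sum>u\<leftarrow>vs. trm_size u) + 1 + m * rules_size))"
      using computation[OF call] by blast
    then obtain n where n: "exec whole (\<lambda>r. if r = Inp then trm_string (Fun f vs) else []) s n"
      "n \<le> whole_cost ((\<Sum>u\<leftarrow>vs. trm_size u) + 1 + m * rules_size)"
      unfolding runs_def by blast
    have "set (trm_string u) \<subseteq> Sym ` C" if "u \<in> set vs" for u
      using set_trm_string that call(3) by blast
    then have "set (trm_string (Fun f vs)) \<subseteq> Sym ` (D \<union> C)" using call(1) by auto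
    from M(2)[OF this n(1)] have "computes_within M (trm_string (Fun f vs)) (s Outp) n" .
    moreover have "n \<le> p (\<Sum>u\<leftarrow>vs. trm_size u, m)" using n(2) p by (rule order_trans)
    ultimately have "computes_within M (trm_string (Fun f vs)) (s Outp) (p (\<Sum>u\<leftarrow>vs. trm_size u, m))"
      unfolding computes_within_def by (meson order_trans)
    with dag show ?thesis by blast
  qed
  moreover have "polynomial2 p" unfolding p_def by (rule polynomial2_power)
  ultimately show ?thesis using M(1) by blast
qed

end
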